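(* Assume (A.1), (A.2), (A.3), and fix $T>0$ and $N>0$. For $k\in K=L^2([0,T];\mathbb{R})$ let $u^k\in X_T$ be the first component of the unique solution $(u^k,L^k)$ of the deterministic reflection problem $$du^k(t)+Au^k(t)\,dt=f(u^k(t))\,dt+B(u^k(t),u^k(t))\,dt+\sigma(u^k(t))k(t)\,dt+dL^k(t),\quad t\in[0,T],\qquad u^k(0)=u_0 .$$ Let $\{k^\varepsilon;\varepsilon>0\}\subset S_N$ be such that $k^\varepsilon\to k$ weakly in the Hilbert space $K$ as $\varepsilon\to0$. Then $u^{k^\varepsilon}$ converges to $u^k$ in the space $X_T$ as $\varepsilon\to 0$, where $u^{k^\varepsilon}$ denotes the first component of the unique solution $(u^{k^\varepsilon},L^{k^\varepsilon})$ of the deterministic reflection problem $$du^{k^\varepsilon}(t)+Au^{k^\varepsilon}(t)\,dt=f(u^{k^\varepsilon}(t))\,dt+B(u^{k^\varepsilon}(t),u^{k^\varepsilon}(t))\,dt+\sigma(u^{k^\varepsilon}(t))k^\varepsilon(t)\,dt+dL^{k^\varepsilon}(t),\quad t\in[0,T],\qquad u^{k^\varepsilon}(0)=u_0 .$$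
   Context: Setting. $H$ is a separable Hilbert space with norm $|\cdot|$ and inner product $(\cdot,\cdot)$; $\overline D$ is the closed unit ball of $H$. $A$ is a self-adjoint, positive definite operator on $H$ such that for some $\lambda_1>0$, $(Au,u)\ge\lambda_1|u|^2$ for all $u\in D(A)$. $V:=D(A^{1/2})$ is a Hilbert space with inner product $((u,v))=(A^{1/2}u,A^{1/2}v)$ and norm $\|\cdot\|$; $V^*$ is its dual, $V\hookrightarrow H=H^*\hookrightarrow V^*$ is a Gelfand triple, $\langle\cdot,\cdot\rangle$ is the duality between $V$ and $V^*$, and $A$ is also regarded as a bounded operator $V\to V^*$. Assumptions. (A.1) $f:H\to V^*$ and $\sigma:H\to H$ are measurable and there is a constant $C$ with $|f(u)-f(v)|_{V^*}+|\sigma(u)-\sigma(v)|\le C|u-v|$ for all $u,v\in H$. (A.2) $B:V\times V\to V^*$ is bilinear and $\overline b(u,v,w)=\langle B(u,v),w\rangle$ satisfies, for all $u,v,w\in V$: (a) $\overline b(u,v,w)=-\overline b(u,w,v)$; (b) $|\overline b(u,v,w)|\le 2\|u\|^{1/2}|u|^{1/2}\|w\|^{1/2}|w|^{1/2}\|v\|$. (A.3) $u_0\in\overline D$ is deterministic. $X_T=C([0,T];H)\cap L^2([0,T];V)$ with norm $|u|_{X_T}^2=\sup_{t\in[0,T]}|u(t)|^2+\int_0^T\|u(s)\|^2ds$. $S_N=\{k\in K:\int_0^Tk^2(s)ds\le N\}$. Solution of the deterministic reflection problem: a pair $(u^k,L^k)$ with $u^k\in X_T$ taking values in $\overline D$,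 $L^k:[0,T]\to H$ continuous of bounded variation with $L^k(0)=0$, satisfying for all $t\in[0,T]$, in $V^*$, $u^k(t)+\int_0^tAu^k(s)ds-\int_0^tf(u^k(s))ds-\int_0^tB(u^k(s),u^k(s))ds=u_0+\int_0^t\sigma(u^k(s))k(s)ds+L^k(t)$, and $\int_0^T(\phi(t)-u^k(t),L^k(dt))\ge0$ (Riemann-Stieltjes integral of an $H$-valued function against an $H$-valued bounded-variation function) for all $\phi\in C([0,T],\overline D)$. Under (A.1)-(A.3) it exists and is unique for every $k\in K$. *)

theory Defs
  imports "HOL-Analysis.Analysis"
begin

text \<open>The Bochner integral of the library needs a second countable range type.  The instance
  below, obtained from the Riesz representation theorem, makes it available for functions with
  values in the dual \<open>'v \<Rightarrow>\<^sub>L real\<close> of a separable Hilbert space \<open>'v\<close>.\<close>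

lemma riesz_representation:
  fixes F :: "'a::{real_inner, banach} \<Rightarrow>\<^sub>L real"
  obtains z where "F = blinfun_inner_right z"
proof -
  define Q where "Q = (\<lambda>v. v \<bullet> v - 2 * F v)"
  have lower: "Q v \<ge> - (norm F)\<^sup>2" for v
  proof -
    have "F v \<le> norm F * norm v"
      using norm_blinfun[of F v] by auto
    moreover have "0 \<le> (norm v - norm F)\<^sup>2" by simp
    moreover have "v \<bullet> v = (norm v)\<^sup>2" by (simp add: dot_square_norm)
    ultimately show ?thesis
      by (simp add: Q_def power2_eq_square algebra_simps)
  qed
  define m where "m = (INF v. Q v)"
  have bdd: "bdd_below (range Q)"
    using lower by (auto intro!: bdd_belowI[where m = "- (norm F)\<^sup>2"])
  have m_le: "m \<le> Q v" for v
    unfolding m_def by (rule cINF_lower[OF bdd]) simp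
  have ex: "\<exists>v. Q v < m + inverse (real (Suc n))" for n
  proof -
    have "(INF v. Q v) < m + inverse (real (Suc n))" by (simp add: m_def)
    then show ?thesis using cINF_less_iff[OF _ bdd] by auto
  qed
  then obtain s where s: "\<And>n. Q (s n) < m + inverse (real (Suc n))" by metis
  have par: "(norm (u - v))\<^sup>2 \<le> 2 * (Q u + Q v - 2 * m)" for u v
  proof -
    have "Q u + Q v = 2 * Q ((1/2) *\<^sub>R (u + v)) + (norm (u - v))\<^sup>2 / 2"
      unfolding Q_def
      by (simp add: dot_square_norm[symmetric] blinfun.bilinear_simps inner_simps inner_commute field_simps)
    with m_le[of "(1/2) *\<^sub>R (u + v)"] show ?thesis by simp
  qed
  have "Cauchy s"
  proof (rule metric_CauchyI)
    fix e :: real assume e: "e > 0"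
    then have "e\<^sup>2 / 4 > 0" by simp
    then obtain M where M: "inverse (real (Suc M)) < e\<^sup>2 / 4" using reals_Archimedean by blast
    have "dist (s i) (s j) < e" if ij: "i \<ge> M" "j \<ge> M" for i j
    proof -
      have le: "inverse (real (Suc i)) \<le> inverse (real (Suc M))"
               "inverse (real (Suc j)) \<le> inverse (real (Suc M))"
        using ij by (auto intro!: le_imp_inverse_le)
      have "(norm (s i - s j))\<^sup>2 < e\<^sup>2"
        using par[of "s i" "s j"] s[of i] s[of j] le M by argo
      then show ?thesis using e by (simp add: dist_norm power_less_imp_less_base)
    qed
    then show "\<exists>M. \<forall>i\<ge>M. \<forall>j\<ge>M. dist (s i) (s j) < e" by blast
  qed
  then obtain z where z: "s \<longlonglongrightarrow> z"
    using Cauchy_convergent_iff convergent_def by blast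
  have "(\<lambda>n. Q (s n)) \<longlonglongrightarrow> Q z"
    unfolding Q_def by (intro tendsto_intros z)
  moreover have "(\<lambda>n. m + inverse (real (Suc n))) \<longlonglongrightarrow> m + 0"
    by (intro tendsto_intros LIMSEQ_inverse_real_of_nat)
  ultimately have Qz: "Q z \<le> m"
    using s by (intro tendsto_le[of sequentially _ "m" _ "Q z"]) (auto intro!: always_eventually less_imp_le)
  have "F h = z \<bullet> h" for h
  proof -
    define c where "c = z \<bullet> h - F h"
    define t where "t = - c / (h \<bullet> h + 1)"
    have pos: "h \<bullet> h + 1 > 0" by (simp add: add_nonneg_pos)
    have "Q z \<le> Q (z + t *\<^sub>R h)" using Qz m_le order_trans by blast
    then have "0 \<le> 2 * t * c + t\<^sup>2 * (h \<bullet> h)"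
      unfolding Q_def c_def
      by (simp add: blinfun.bilinear_simps inner_simps inner_commute power2_eq_square algebra_simps)
    also have "\<dots> \<le> 2 * t * c + t\<^sup>2 * (h \<bullet> h + 1)" by (simp add: distrib_left)
    also have "\<dots> = 2 * t * c + t * (t * (h \<bullet> h + 1))" by (simp add: power2_eq_square)
    also have "t * (h \<bullet> h + 1) = - c" using pos by (simp add: t_def)
    also have "2 * t * c + t * (- c) = - (c\<^sup>2 / (h \<bullet> h + 1))"
      by (simp add: t_def power2_eq_square)
    finally have "c\<^sup>2 / (h \<bullet> h + 1) \<le> 0" by simp
    then have "c = 0" using pos by (simp add: divide_le_0_iff)
    then show ?thesis by (simp add: c_def)
  qed
  then have "F = blinfun_inner_right z" by (intro blinfun_eqI) simp
  then show thesis by (rule that)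
qed

lemma second_countable_from_dense:
  fixes D :: "'a::metric_space set"
  assumes "countable D" and "\<And>x e. e > 0 \<Longrightarrow> \<exists>d\<in>D. dist d x < e"
  shows "\<exists>B::'a set set. countable B \<and> open = generate_topology B"
proof (intro exI conjI)
  let ?B = "(\<lambda>(d, n). ball d (inverse (real (Suc n)))) ` (D \<times> (UNIV::nat set))"
  show "countable ?B" using assms(1) by auto
  have "topological_basis ?B"
  proof (rule topological_basisI)
    fix S x assume "open (S::'a set)" "x \<in> S"
    then obtain e where e: "e > 0" "ball x e \<subseteq> S" using open_contains_ball by blast
    obtain n where n: "inverse (real (Suc n)) < e / 2" using reals_Archimedean[of "e/2"] e by auto
    obtain d where d: "d \<in> D" "dist d x < inverse (real (Suc n))"
      using assms(2)[of "inverse (real (Suc n))" x] by auto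
    have "ball d (inverse (real (Suc n))) \<subseteq> ball x e"
    proof
      fix y assume "y \<in> ball d (inverse (real (Suc n)))"
      then have "dist d y < inverse (real (Suc n))" by simp
      with d n dist_triangle[of x y d] show "y \<in> ball x e" by (simp add: dist_commute)
    qed
    with d e show "\<exists>B'\<in>?B. x \<in> B' \<and> B' \<subseteq> S"
      by (intro bexI[of _ "ball d (inverse (real (Suc n)))"]) auto
  qed auto
  then show "open = generate_topology ?B" by (rule topological_basis_imp_subbasis)
qed

instance blinfun ::
  ("{real_inner, banach, second_countable_topology}", euclidean_space) second_countable_topology
proof
  obtain C :: "'a set" where C: "countable C" "\<And>X. open X \<Longrightarrow> X \<noteq> {} \<Longrightarrow> \<exists>d\<in>C. d \<in> X"
    using countable_dense_setE by metis
  define \<Phi> :: "('b \<Rightarrow> 'a) \<Rightarrow> 'a \<Rightarrow>\<^sub>L 'b" where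
    "\<Phi> z = (\<Sum>b\<in>Basis. blinfun_scaleR_left b o\<^sub>L blinfun_inner_right (z b))" for z
  have \<Phi>_apply: "\<Phi> z v = (\<Sum>b\<in>Basis. (z b \<bullet> v) *\<^sub>R b)" for z v
    by (simp add: \<Phi>_def blinfun.sum_left)
  show "\<exists>B::('a \<Rightarrow>\<^sub>L 'b) set set. countable B \<and> open = generate_topology B"
  proof (rule second_countable_from_dense)
    show "countable (\<Phi> ` (PiE Basis (\<lambda>_. C)))"
      using C(1) by (intro countable_image countable_PiE) auto
  next
    fix F :: "'a \<Rightarrow>\<^sub>L 'b" and e :: real assume e: "e > 0"
    have "\<exists>z. \<forall>v. F v \<bullet> b = z \<bullet> v" for b
    proof -
      obtain z where "blinfun_inner_right b o\<^sub>L F = blinfun_inner_right z"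
        by (rule riesz_representation)
      then have "(blinfun_inner_right b o\<^sub>L F) v = blinfun_inner_right z v" for v by simp
      then show ?thesis by (auto simp: inner_commute)
    qed
    then obtain z where z: "\<And>b v. F v \<bullet> b = z b \<bullet> v" by metis
    define \<delta> where "\<delta> = e / (2 * real DIM('b))"
    have \<delta>: "\<delta> > 0" using e by (simp add: \<delta>_def)
    have "\<exists>y\<in>C. dist (z b) y < \<delta>" for b
      using C(2)[of "ball (z b) \<delta>"] \<delta> by auto
    then obtain y where y: "\<And>b. y b \<in> C" "\<And>b. dist (z b) (y b) < \<delta>" by metis
    let ?y = "restrict y Basis"
    have "norm (\<Phi> ?y - F) \<le> real DIM('b) * \<delta>"
    proof (rule norm_blinfun_bound)
      fix v
      have "(\<Phi> ?y - F) v = (\<Sum>b\<in>Basis. ((y b - z b) \<bullet> v) *\<^sub>R b)"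
        using euclidean_representation[of "F v"]
        by (simp add: blinfun.diff_left \<Phi>_apply z inner_diff_left scaleR_diff_left sum_subtractf)
      also have "norm \<dots> \<le> (\<Sum>b\<in>(Basis::'b set). \<delta> * norm v)"
      proof (rule sum_norm_le)
        fix b :: 'b assume "b \<in> Basis"
        then have "norm (((y b - z b) \<bullet> v) *\<^sub>R b) = \<bar>(y b - z b) \<bullet> v\<bar>" by simp
        also have "\<dots> \<le> norm (y b - z b) * norm v" by (rule Cauchy_Schwarz_ineq2)
        also have "\<dots> \<le> \<delta> * norm v"
          using y(2)[of b] by (intro mult_right_mono) (auto simp: dist_norm norm_minus_commute)
        finally show "norm (((y b - z b) \<bullet> v) *\<^sub>R b) \<le> \<delta> * norm v" .
      qed
      finally show "norm ((\<Phi> ?y - F) v) \<le> real DIM('b) * \<delta> * norm v" by simp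
    qed (use \<delta> in auto)
    also have "\<dots> < e" using e by (simp add: \<delta>_def)
    finally have "dist (\<Phi> ?y) F < e" by (simp add: dist_norm)
    moreover have "?y \<in> PiE Basis (\<lambda>_. C)" using y(1) by auto
    ultimately show "\<exists>d\<in>\<Phi> ` (PiE Basis (\<lambda>_. C)). dist d F < e" by blast
  qed
qed

text \<open>An unbounded operator is a pair of a domain \<open>D\<close> and a function whose values
  outside of \<open>D\<close> are irrelevant.  The last clause says that the graph of the adjoint of \<open>A\<close>
  is the graph of \<open>A\<close>.\<close>

definition selfadjoint_op :: "'h::real_inner set \<Rightarrow> ('h \<Rightarrow> 'h) \<Rightarrow> bool" where
  "selfadjoint_op D A \<longleftrightarrow>
     subspace D \<and> closure D = UNIV \<and>
     (\<forall>u\<in>D. \<forall>v\<in>D. A (u + v) = A u + A v) \<and> (\<forall>c. \<forall>u\<in>D. A (c *\<^sub>R u) = c *\<^sub>R A u) \<and>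
     (\<forall>v w. (\<forall>u\<in>D. A u \<bullet> v = u \<bullet> w) \<longleftrightarrow> v \<in> D \<and> w = A v)"

text \<open>\<open>(DS, S)\<close> is the nonnegative self-adjoint square root of \<open>(DA, A)\<close>; as operators on their
  domains, \<open>S\<close> is uniquely determined by \<open>A\<close>.\<close>

definition sqrt_op :: "'h::real_inner set \<Rightarrow> ('h \<Rightarrow> 'h) \<Rightarrow> 'h set \<Rightarrow> ('h \<Rightarrow> 'h) \<Rightarrow> bool" where
  "sqrt_op DA A DS S \<longleftrightarrow>
     selfadjoint_op DS S \<and> (\<forall>u\<in>DS. 0 \<le> S u \<bullet> u) \<and>
     DA = {u \<in> DS. S u \<in> DS} \<and> (\<forall>u\<in>DA. A u = S (S u))"

text \<open>The space \<open>V = D(S)\<close>, where \<open>S\<close> is the square root of \<open>A\<close>, with its inner product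
  \<open>((u,v)) = (S u, S v)\<close> is represented by a Hilbert space type \<open>'v\<close> together with its embedding
  \<open>\<iota>\<close> into \<open>H\<close>.  (If \<open>S\<close> is bounded below, then \<open>'v = 'h\<close> and the inverse of \<open>S\<close> is one such
  representation, so that the representation by a type is no restriction.)\<close>

definition form_domain ::
  "'h::real_inner set \<Rightarrow> ('h \<Rightarrow> 'h) \<Rightarrow> ('v::real_inner \<Rightarrow>\<^sub>L 'h) \<Rightarrow> bool" where
  "form_domain DS S \<iota> \<longleftrightarrow>
     inj (blinfun_apply \<iota>) \<and> range (blinfun_apply \<iota>) = DS \<and>
     (\<forall>u v. u \<bullet> v = S (\<iota> u) \<bullet> S (\<iota> v))"

text \<open>The embedding of \<open>H\<close>, identified with its dual, into the dual of \<open>V\<close>.\<close>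

definition to_dual :: "('v::real_normed_vector \<Rightarrow>\<^sub>L 'h::real_inner) \<Rightarrow> 'h \<Rightarrow> 'v \<Rightarrow>\<^sub>L real" where
  "to_dual \<iota> h = blinfun_inner_right h o\<^sub>L \<iota>"

text \<open>The operator \<open>A\<close> regarded as a bounded operator from \<open>V\<close> to its dual, that is,
  \<open>\<langle>A u, v\<rangle> = ((u,v))\<close>.\<close>

definition dual_op :: "'v::real_inner \<Rightarrow> 'v \<Rightarrow>\<^sub>L real" where
  "dual_op u = blinfun_inner_right u"

lemma dual_op_extends:
  assumes "sqrt_op DA A DS S" "form_domain DS S \<iota>" "\<iota> u \<in> DA"
  shows "dual_op u = to_dual \<iota> (A (\<iota> u))"
proof (rule blinfun_eqI)
  fix v
  have "S (\<iota> u) \<in> DS" "\<iota> v \<in> DS" "A (\<iota> u) = S (S (\<iota> u))"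
    using assms by (auto simp: sqrt_op_def form_domain_def)
  moreover have "\<forall>x\<in>DS. S x \<bullet> y = x \<bullet> S y" if "y \<in> DS" for y
    using assms(1) that by (auto simp: sqrt_op_def selfadjoint_op_def)
  ultimately show "dual_op u v = to_dual \<iota> (A (\<iota> u)) v"
    using assms(2) by (simp add: dual_op_def to_dual_def form_domain_def)
qed

definition lipschitz_coeffs ::
  "('h::{real_inner, second_countable_topology} \<Rightarrow> 'v::real_normed_vector \<Rightarrow>\<^sub>L real) \<Rightarrow> ('h \<Rightarrow> 'h) \<Rightarrow> bool" where
  "lipschitz_coeffs f \<sigma> \<longleftrightarrow>
     f \<in> borel_measurable borel \<and> \<sigma> \<in> borel_measurable borel \<and>
     (\<exists>C. \<forall>u v. norm (f u - f v) + norm (\<sigma> u - \<sigma> v) \<le> C * norm (u - v))"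

definition antisym_bilinear ::
  "('v::real_normed_vector \<Rightarrow>\<^sub>L 'h::real_normed_vector) \<Rightarrow> ('v \<Rightarrow> 'v \<Rightarrow> 'v \<Rightarrow>\<^sub>L real) \<Rightarrow> bool" where
  "antisym_bilinear \<iota> B \<longleftrightarrow>
     bilinear B \<and>
     (\<forall>u v w. B u v w = - B u w v) \<and>
     (\<forall>u v w. \<bar>B u v w\<bar> \<le>
        2 * sqrt (norm u) * sqrt (norm (\<iota> u)) * sqrt (norm w) * sqrt (norm (\<iota> w)) * norm v)"

text \<open>Square integrable functions on \<open>[0,T]\<close>; functions that agree almost everywhere are not
  identified.\<close>

definition L2_space :: "real \<Rightarrow> (real \<Rightarrow> 'a::{real_normed_vector, second_countable_topology}) set" where
  "L2_space T = {k. set_borel_measurable lebesgue {0..T} k \<and>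
                    set_integrable lebesgue {0..T} (\<lambda>t. (norm (k t))\<^sup>2)}"

definition L2_bounded :: "real \<Rightarrow> real \<Rightarrow> (real \<Rightarrow> real) set" where
  "L2_bounded T N = {k \<in> L2_space T. (LINT t:{0..T}|lebesgue. (k t)\<^sup>2) \<le> N}"

definition L2_weak_conv :: "real \<Rightarrow> (real \<Rightarrow> real \<Rightarrow> real) \<Rightarrow> (real \<Rightarrow> real) \<Rightarrow> real filter \<Rightarrow> bool" where
  "L2_weak_conv T kk k F \<longleftrightarrow>
     (\<forall>h\<in>L2_space T. ((\<lambda>\<epsilon>. LINT t:{0..T}|lebesgue. kk \<epsilon> t * h t)
        \<longlongrightarrow> (LINT t:{0..T}|lebesgue. k t * h t)) F)"

text \<open>An \<open>H\<close>-valued path lies in \<open>L\<^sup>2([0,T]; V)\<close> if almost all of its values lie in the range of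
  \<open>\<iota>\<close> and it is square integrable in the norm of \<open>V\<close>.  The arbitrary value that \<open>V_part \<iota> h\<close> has
  outside of the range of \<open>\<iota>\<close> therefore matters only on a null set of times.\<close>

definition V_part :: "('v::real_normed_vector \<Rightarrow>\<^sub>L 'h::real_normed_vector) \<Rightarrow> 'h \<Rightarrow> 'v" where
  "V_part \<iota> = inv (blinfun_apply \<iota>)"

definition XT_space ::
  "('v::{real_normed_vector, second_countable_topology} \<Rightarrow>\<^sub>L 'h::real_normed_vector) \<Rightarrow> real \<Rightarrow> (real \<Rightarrow> 'h) set" where
  "XT_space \<iota> T = {u. continuous_on {0..T} u \<and>
     (AE t in lebesgue. t \<in> {0..T} \<longrightarrow> u t \<in> range (blinfun_apply \<iota>)) \<and>
     (\<lambda>t. V_part \<iota> (u t)) \<in> L2_space T}"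

definition XT_norm ::
  "('v::real_normed_vector \<Rightarrow>\<^sub>L 'h::real_normed_vector) \<Rightarrow> real \<Rightarrow> (real \<Rightarrow> 'h) \<Rightarrow> real" where
  "XT_norm \<iota> T u = sqrt ((SUP t\<in>{0..T}. (norm (u t))\<^sup>2) +
     (LINT t:{0..T}|lebesgue. (norm (V_part \<iota> (u t)))\<^sup>2))"

text \<open>Partitions of \<open>[a,b]\<close> are divisions into compact intervals \<open>K = [Inf K, Sup K]\<close>; fineness
  with respect to balls of radius \<open>\<delta>\<close> forces the mesh below \<open>2 * \<delta>\<close>.\<close>

definition bounded_variation_on :: "real \<Rightarrow> real \<Rightarrow> (real \<Rightarrow> 'h::real_normed_vector) \<Rightarrow> bool" where
  "bounded_variation_on a b L \<longleftrightarrow>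
     (\<exists>M. \<forall>d. d division_of {a..b} \<longrightarrow> (\<Sum>K\<in>d. norm (L (Sup K) - L (Inf K))) \<le> M)"

definition has_rs_integral ::
  "(real \<Rightarrow> 'h::real_inner) \<Rightarrow> (real \<Rightarrow> 'h) \<Rightarrow> real \<Rightarrow> real \<Rightarrow> real \<Rightarrow> bool" where
  "has_rs_integral g L a b I \<longleftrightarrow>
     (\<forall>e>0. \<exists>\<delta>>0. \<forall>p. p tagged_division_of {a..b} \<and> (\<lambda>x. ball x \<delta>) fine p \<longrightarrow>
        \<bar>(\<Sum>(x, K)\<in>p. g x \<bullet> (L (Sup K) - L (Inf K))) - I\<bar> < e)"

text \<open>The integral equation is an equation in the dual of \<open>V\<close>.  For \<open>u\<close> in \<open>XT_space \<iota> T\<close>, \<open>k\<close> in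
  \<open>L2_space T\<close> and coefficients as above, all integrands are Bochner integrable, so that no
  integral takes the default value that the library assigns to non-integrable functions.\<close>

definition reflection_solution ::
  "('v::{real_inner, banach, second_countable_topology} \<Rightarrow>\<^sub>L 'h::{real_inner, banach, second_countable_topology})
    \<Rightarrow> real \<Rightarrow> ('h \<Rightarrow> 'v \<Rightarrow>\<^sub>L real) \<Rightarrow> ('h \<Rightarrow> 'h) \<Rightarrow> ('v \<Rightarrow> 'v \<Rightarrow> 'v \<Rightarrow>\<^sub>L real) \<Rightarrow> 'h
    \<Rightarrow> (real \<Rightarrow> real) \<Rightarrow> (real \<Rightarrow> 'h) \<Rightarrow> (real \<Rightarrow> 'h) \<Rightarrow> bool" where
  "reflection_solution \<iota> T f \<sigma> B u\<^sub>0 k u L \<longleftrightarrow>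
     u \<in> XT_space \<iota> T \<and> (\<forall>t\<in>{0..T}. u t \<in> cball 0 1) \<and>
     continuous_on {0..T} L \<and> bounded_variation_on 0 T L \<and> L 0 = 0 \<and>
     (\<forall>t\<in>{0..T}.
        to_dual \<iota> (u t)
          + (LINT s:{0..t}|lebesgue. dual_op (V_part \<iota> (u s)))
          - (LINT s:{0..t}|lebesgue. f (u s))
          - (LINT s:{0..t}|lebesgue. B (V_part \<iota> (u s)) (V_part \<iota> (u s)))
        = to_dual \<iota> (u\<^sub>0 + (LINT s:{0..t}|lebesgue. k s *\<^sub>R \<sigma> (u s)) + L t)) \<and>
     (\<forall>\<phi>. continuous_on {0..T} \<phi> \<and> (\<forall>t\<in>{0..T}. \<phi> t \<in> cball 0 1) \<longrightarrow>
        (\<exists>I\<ge>0. has_rs_integral (\<lambda>t. \<phi> t - u t) L 0 T I))"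

end

theory Submission
  imports Defs
begin

text \<open>The proof rests on an energy inequality for \<open>w = u\<^sup>\<epsilon> - u\<close>.  In it the antisymmetry of \<open>B\<close>
  leaves only \<open>\<langle>B(w, u), w\<rangle>\<close>, the reflection terms have a sign by the variational inequality, and
  Gronwall's lemma would conclude were it not for the term \<open>\<integral> (k\<^sup>\<epsilon> - k) (\<sigma>(u), w)\<close>.  Since \<open>V\<close> need
  not embed compactly into \<open>H\<close>, that term is removed before the energy inequality is applied: \<open>\<sigma>(u)\<close>
  is approximated in \<open>L\<^sup>2([0,T]; H)\<close> by a simple function \<open>g\<close> with values in \<open>V\<close>, and
  \<open>\<eta>(t) = \<integral>\<^sub>0\<^sup>t (k\<^sup>\<epsilon> - k) g\<close>, which tends to \<open>0\<close> uniformly in the norm of \<open>V\<close>, is subtracted from \<open>w\<close>.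
  The reflection terms lose their sign by this only up to a multiple of \<open>sup \<parallel>\<eta>\<parallel>\<close>.\<close>

section \<open>Riemann-Stieltjes integrals\<close>

text \<open>Two features of the problem shape the estimates. The reflection is only continuous and
  of bounded variation in H, so the time derivative of a solution need not be square integrable with
  values in the dual of V, and the usual chain rule for the squared H norm is not at hand. An
  inequality suffices, and discrete increments give it. Moreover the variational inequality holds
  over all of [0,T] and for continuous test paths, so an estimate up to a time t uses a continuous
  cutoff with a ramp after t in place of an indicator; the ramp is shrunk afterwards. Smallness of
  \<eta> in H would not do: \<eta> is also paired with the differences of the A terms and of the B
  terms, which live in the dual of V. This is why g takes values in V. The order of choice matters:
  first g, with error \<alpha>; then the size c of \<eta>, which may depend on the supremum of g and
  hence on \<alpha>; last \<epsilon>. Both errors get multiplied by a Gronwall factor whose weight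
  is built from the squared V norm of u and from the modulus of the control. The bound N on the
  controls makes the integral of this weight bounded uniformly in \<epsilon>.\<close>

lemma has_rs_integralE:
  assumes "has_rs_integral g L a b I" and "e > 0"
  obtains \<delta> where "\<delta> > 0" and
    "\<And>p. p tagged_division_of {a..b} \<Longrightarrow> (\<lambda>x. ball x \<delta>) fine p \<Longrightarrow>
        \<bar>(\<Sum>(x, K)\<in>p. g x \<bullet> (L (Sup K) - L (Inf K))) - I\<bar> < e"
  using assms(1)[unfolded has_rs_integral_def, rule_format, OF assms(2)] by blast

lemma has_rs_integral_lincomb:
  assumes "has_rs_integral g\<^sub>1 L a b I\<^sub>1" and "has_rs_integral g\<^sub>2 L a b I\<^sub>2"
  shows "has_rs_integral (\<lambda>t. c\<^sub>1 *\<^sub>R g\<^sub>1 t + c\<^sub>2 *\<^sub>R g\<^sub>2 t) L a b (c\<^sub>1 * I\<^sub>1 + c\<^sub>2 * I\<^sub>2)"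
  unfolding has_rs_integral_def
proof (intro allI impI)
  fix e :: real assume e: "e > 0"
  define e' where "e' = e / (\<bar>c\<^sub>1\<bar> + \<bar>c\<^sub>2\<bar> + 1)"
  have "\<bar>c\<^sub>1\<bar> + \<bar>c\<^sub>2\<bar> + 1 > 0" by simp
  then have e': "e' > 0" "(\<bar>c\<^sub>1\<bar> + \<bar>c\<^sub>2\<bar> + 1) * e' = e" using e by (simp_all add: e'_def)
  obtain d1 where d1: "d1 > 0" and S1: "\<And>p. p tagged_division_of {a..b} \<Longrightarrow> (\<lambda>x. ball x d1) fine p \<Longrightarrow>
        \<bar>(\<Sum>(x, K)\<in>p. g\<^sub>1 x \<bullet> (L (Sup K) - L (Inf K))) - I\<^sub>1\<bar> < e'"
    using has_rs_integralE[OF assms(1) e'(1)] by blast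
  obtain d2 where d2: "d2 > 0" and S2: "\<And>p. p tagged_division_of {a..b} \<Longrightarrow> (\<lambda>x. ball x d2) fine p \<Longrightarrow>
        \<bar>(\<Sum>(x, K)\<in>p. g\<^sub>2 x \<bullet> (L (Sup K) - L (Inf K))) - I\<^sub>2\<bar> < e'"
    using has_rs_integralE[OF assms(2) e'(1)] by blast
  show "\<exists>\<delta>>0. \<forall>p. p tagged_division_of {a..b} \<and> (\<lambda>x. ball x \<delta>) fine p \<longrightarrow>
        \<bar>(\<Sum>(x, K)\<in>p. (c\<^sub>1 *\<^sub>R g\<^sub>1 x + c\<^sub>2 *\<^sub>R g\<^sub>2 x) \<bullet> (L (Sup K) - L (Inf K))) - (c\<^sub>1 * I\<^sub>1 + c\<^sub>2 * I\<^sub>2)\<bar> < e"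
  proof (intro exI[of _ "min d1 d2"] conjI allI impI)
    fix p assume p: "p tagged_division_of {a..b} \<and> (\<lambda>x. ball x (min d1 d2)) fine p"
    then have "(\<lambda>x. ball x d1) fine p" "(\<lambda>x. ball x d2) fine p"
      by (auto simp: fine_def subset_iff)
    with p S1[of p] S2[of p] have
      b: "\<bar>(\<Sum>(x, K)\<in>p. g\<^sub>1 x \<bullet> (L (Sup K) - L (Inf K))) - I\<^sub>1\<bar> \<le> e'" (is "\<bar>?s1 - _\<bar> \<le> _")
      "\<bar>(\<Sum>(x, K)\<in>p. g\<^sub>2 x \<bullet> (L (Sup K) - L (Inf K))) - I\<^sub>2\<bar> \<le> e'" (is "\<bar>?s2 - _\<bar> \<le> _")
      by auto
    have "(\<Sum>(x, K)\<in>p. (c\<^sub>1 *\<^sub>R g\<^sub>1 x + c\<^sub>2 *\<^sub>R g\<^sub>2 x) \<bullet> (L (Sup K) - L (Inf K))) = c\<^sub>1 * ?s1 + c\<^sub>2 * ?s2"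
      unfolding sum_distrib_left sum.distrib[symmetric]
      by (intro sum.cong) (auto simp: inner_add_left)
    also have "\<bar>\<dots> - (c\<^sub>1 * I\<^sub>1 + c\<^sub>2 * I\<^sub>2)\<bar> = \<bar>c\<^sub>1 * (?s1 - I\<^sub>1) + c\<^sub>2 * (?s2 - I\<^sub>2)\<bar>"
      by (simp add: algebra_simps)
    also have "\<dots> \<le> \<bar>c\<^sub>1\<bar> * \<bar>?s1 - I\<^sub>1\<bar> + \<bar>c\<^sub>2\<bar> * \<bar>?s2 - I\<^sub>2\<bar>"
      unfolding abs_mult[symmetric] by (rule abs_triangle_ineq)
    also have "\<dots> \<le> \<bar>c\<^sub>1\<bar> * e' + \<bar>c\<^sub>2\<bar> * e'"
      using b by (intro add_mono mult_left_mono) auto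
    also have "\<dots> < e" using e' by (simp add: distrib_right)
    finally show "\<bar>(\<Sum>(x, K)\<in>p. (c\<^sub>1 *\<^sub>R g\<^sub>1 x + c\<^sub>2 *\<^sub>R g\<^sub>2 x) \<bullet> (L (Sup K) - L (Inf K))) - (c\<^sub>1 * I\<^sub>1 + c\<^sub>2 * I\<^sub>2)\<bar> < e" .
  qed (use d1 d2 in auto)
qed

lemma has_rs_integral_diff_integrator:
  assumes "has_rs_integral g L\<^sub>1 a b I\<^sub>1" and "has_rs_integral g L\<^sub>2 a b I\<^sub>2"
  shows "has_rs_integral g (\<lambda>t. L\<^sub>1 t - L\<^sub>2 t) a b (I\<^sub>1 - I\<^sub>2)"
  unfolding has_rs_integral_def
proof (intro allI impI)
  fix e :: real assume e: "e > 0"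
  then have e': "e / 2 > 0" by simp
  obtain d1 where d1: "d1 > 0" and S1: "\<And>p. p tagged_division_of {a..b} \<Longrightarrow> (\<lambda>x. ball x d1) fine p \<Longrightarrow>
        \<bar>(\<Sum>(x, K)\<in>p. g x \<bullet> (L\<^sub>1 (Sup K) - L\<^sub>1 (Inf K))) - I\<^sub>1\<bar> < e / 2"
    using has_rs_integralE[OF assms(1) e'(1)] by blast
  obtain d2 where d2: "d2 > 0" and S2: "\<And>p. p tagged_division_of {a..b} \<Longrightarrow> (\<lambda>x. ball x d2) fine p \<Longrightarrow>
        \<bar>(\<Sum>(x, K)\<in>p. g x \<bullet> (L\<^sub>2 (Sup K) - L\<^sub>2 (Inf K))) - I\<^sub>2\<bar> < e / 2"
    using has_rs_integralE[OF assms(2) e'(1)] by blast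
  show "\<exists>\<delta>>0. \<forall>p. p tagged_division_of {a..b} \<and> (\<lambda>x. ball x \<delta>) fine p \<longrightarrow>
        \<bar>(\<Sum>(x, K)\<in>p. g x \<bullet> (L\<^sub>1 (Sup K) - L\<^sub>2 (Sup K) - (L\<^sub>1 (Inf K) - L\<^sub>2 (Inf K)))) - (I\<^sub>1 - I\<^sub>2)\<bar> < e"
  proof (intro exI[of _ "min d1 d2"] conjI allI impI)
    fix p assume p: "p tagged_division_of {a..b} \<and> (\<lambda>x. ball x (min d1 d2)) fine p"
    then have "(\<lambda>x. ball x d1) fine p" "(\<lambda>x. ball x d2) fine p"
      by (auto simp: fine_def subset_iff)
    with p S1[of p] S2[of p] have
      b: "\<bar>(\<Sum>(x, K)\<in>p. g x \<bullet> (L\<^sub>1 (Sup K) - L\<^sub>1 (Inf K))) - I\<^sub>1\<bar> < e / 2" (is "\<bar>?s1 - _\<bar> < _")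
      "\<bar>(\<Sum>(x, K)\<in>p. g x \<bullet> (L\<^sub>2 (Sup K) - L\<^sub>2 (Inf K))) - I\<^sub>2\<bar> < e / 2" (is "\<bar>?s2 - _\<bar> < _")
      by auto
    have "(\<Sum>(x, K)\<in>p. g x \<bullet> (L\<^sub>1 (Sup K) - L\<^sub>2 (Sup K) - (L\<^sub>1 (Inf K) - L\<^sub>2 (Inf K)))) = ?s1 - ?s2"
      unfolding sum_subtractf[symmetric]
      by (intro sum.cong) (auto simp: inner_diff_right)
    with b show "\<bar>(\<Sum>(x, K)\<in>p. g x \<bullet> (L\<^sub>1 (Sup K) - L\<^sub>2 (Sup K) - (L\<^sub>1 (Inf K) - L\<^sub>2 (Inf K)))) - (I\<^sub>1 - I\<^sub>2)\<bar> < e"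
      by linarith
  qed (use d1 d2 in auto)
qed

lemma sequence_less_upto:
  fixes t :: "nat \<Rightarrow> real"
  assumes "\<And>j. j < n \<Longrightarrow> t j < t (Suc j)" and "i < j" and "j \<le> n"
  shows "t i < t j"
  using assms(2,3)
proof (induction j)
  case (Suc j)
  then show ?case using assms(1)[of j] by (cases "i = j") auto
qed simp

text \<open>The tags are right endpoints because the energy inequality pairs the increment over an
  interval with the value of the path at its right end.\<close>

lemma tagged_division_of_sequence:
  fixes t :: "nat \<Rightarrow> real"
  assumes "n > 0" and "\<And>j. j < n \<Longrightarrow> t j < t (Suc j)"
  shows "(\<lambda>j. (t (Suc j), {t j..t (Suc j)})) ` {..<n} tagged_division_of {t 0..t n}"
  using assms
proof (induction n rule: nat_induct_non_zero)
  case 1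
  then have "{(t 1, {t 0..t 1})} tagged_division_of {t 0..t 1}"
    by (intro tagged_division_of_self_real) auto
  then show ?case by (simp add: lessThan_Suc)
next
  case (Suc n)
  have mono: "t 0 \<le> t n"
    using sequence_less_upto[of n t 0 n] Suc by (auto simp: less_imp_le)
  have "{(t (Suc n), {t n..t (Suc n)})} tagged_division_of {t n..t (Suc n)}"
    using Suc.prems[of n] by (intro tagged_division_of_self_real) auto
  moreover have "(\<lambda>j. (t (Suc j), {t j..t (Suc j)})) ` {..<n} tagged_division_of {t 0..t n}"
    using Suc by auto
  ultimately have "(\<lambda>j. (t (Suc j), {t j..t (Suc j)})) ` {..<n} \<union> {(t (Suc n), {t n..t (Suc n)})}
      tagged_division_of {t 0..t n} \<union> {t n..t (Suc n)}"
    by (intro tagged_division_Un) simp_all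
  also have "{t 0..t n} \<union> {t n..t (Suc n)} = {t 0..t (Suc n)}"
    using mono Suc.prems[of n] by (intro ivl_disj_un_two_touch) auto
  finally show ?case by (simp add: lessThan_Suc)
qed

text \<open>An interval tagged at its right end lies in the ball of radius \<delta> around the tag
  as soon as its length is below \<delta>, so for such partitions the mesh alone decides
  fineness.\<close>

lemma has_rs_integral_sequence:
  assumes "has_rs_integral g L a b I" and "e > 0"
  obtains \<delta> where "\<delta> > 0" and
    "\<And>(t::nat \<Rightarrow> real) n. n > 0 \<Longrightarrow> t 0 = a \<Longrightarrow> t n = b \<Longrightarrow>
       (\<And>j. j < n \<Longrightarrow> t j < t (Suc j) \<and> t (Suc j) - t j < \<delta>) \<Longrightarrow>
       \<bar>(\<Sum>j<n. g (t (Suc j)) \<bullet> (L (t (Suc j)) - L (t j))) - I\<bar> < e"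
proof -
  obtain d where d: "d > 0" and S: "\<And>p. p tagged_division_of {a..b} \<Longrightarrow> (\<lambda>x. ball x d) fine p \<Longrightarrow>
        \<bar>(\<Sum>(x, K)\<in>p. g x \<bullet> (L (Sup K) - L (Inf K))) - I\<bar> < e"
    using has_rs_integralE[OF assms] by blast
  show thesis
  proof (rule that[OF d])
    fix t :: "nat \<Rightarrow> real" and n :: nat
    assume n: "n > 0" "t 0 = a" "t n = b"
      and t: "\<And>j. j < n \<Longrightarrow> t j < t (Suc j) \<and> t (Suc j) - t j < d"
    let ?f = "\<lambda>j. (t (Suc j), {t j..t (Suc j)})"
    have "?f ` {..<n} tagged_division_of {a..b}"
      using tagged_division_of_sequence[of n t] t n by auto
    moreover have "(\<lambda>x. ball x d) fine (?f ` {..<n})"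
      using t by (force simp: fine_def dist_real_def)
    ultimately have *: "\<bar>(\<Sum>(x, K)\<in>?f ` {..<n}. g x \<bullet> (L (Sup K) - L (Inf K))) - I\<bar> < e"
      by (rule S)
    \<comment> \<open>A tagged division is a set, so the sum over it equals the sum over indices
      only if no pair repeats; the strictly increasing tags ensure this.\<close>
    have "inj_on ?f {..<n}"
    proof (rule inj_onI)
      fix i j assume ij: "i \<in> {..<n}" "j \<in> {..<n}" "?f i = ?f j"
      then show "i = j"
        using sequence_less_upto[of n t "Suc i" "Suc j"] sequence_less_upto[of n t "Suc j" "Suc i"] t
        by (cases i j rule: linorder_cases) auto
    qed
    then have "(\<Sum>(x, K)\<in>?f ` {..<n}. g x \<bullet> (L (Sup K) - L (Inf K)))
      = (\<Sum>j<n. g (t (Suc j)) \<bullet> (L (Sup {t j..t (Suc j)}) - L (Inf {t j..t (Suc j)})))"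
      by (simp add: sum.reindex)
    also have "\<dots> = (\<Sum>j<n. g (t (Suc j)) \<bullet> (L (t (Suc j)) - L (t j)))"
    proof (rule sum.cong[OF refl])
      fix j assume "j \<in> {..<n}"
      then have "t j \<le> t (Suc j)" using t less_imp_le by auto
      then show "g (t (Suc j)) \<bullet> (L (Sup {t j..t (Suc j)}) - L (Inf {t j..t (Suc j)}))
          = g (t (Suc j)) \<bullet> (L (t (Suc j)) - L (t j))" by simp
    qed
    finally show "\<bar>(\<Sum>j<n. g (t (Suc j)) \<bullet> (L (t (Suc j)) - L (t j))) - I\<bar> < e"
      using * by simp
  qed
qed

section \<open>Square integrable functions on an interval\<close>

lemma set_integrable_lebesgue_on:
  fixes f :: "real \<Rightarrow> 'a::{banach, second_countable_topology}"
  shows "set_integrable lebesgue {a..b} f \<longleftrightarrow> integrable (lebesgue_on {a..b}) f"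
  by (simp add: set_integrable_def integrable_restrict_space)

lemma set_integral_lebesgue_on:
  fixes f :: "real \<Rightarrow> 'a::{banach, second_countable_topology}"
  shows "(LINT t:{a..b}|lebesgue. f t) = (LINT t|lebesgue_on {a..b}. f t)"
  by (simp add: set_lebesgue_integral_def integral_restrict_space)

text \<open>Over the restricted measure, set integrals become plain ones, for which measurability is
  automatic and the comparison theorems of integration apply directly.\<close>

lemma L2_space_iff:
  "f \<in> L2_space T \<longleftrightarrow> f \<in> borel_measurable (lebesgue_on {0..T}) \<and>
     integrable (lebesgue_on {0..T}) (\<lambda>t. (norm (f t))\<^sup>2)"
  by (simp add: L2_space_def set_integrable_lebesgue_on set_borel_measurable_def
      borel_measurable_restrict_space_iff)

lemma L2_space_measurable: "f \<in> L2_space T \<Longrightarrow> f \<in> borel_measurable (lebesgue_on {0..T})"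
  by (simp add: L2_space_iff)

lemma L2_space_integrable_square:
  "f \<in> L2_space T \<Longrightarrow> set_integrable lebesgue {0..T} (\<lambda>t. (norm (f t))\<^sup>2)"
  by (simp add: L2_space_def)

lemma L2_space_bound:
  assumes "f \<in> borel_measurable (lebesgue_on {0..T})" and "g \<in> L2_space T"
    and "AE t in lebesgue. t \<in> {0..T} \<longrightarrow> norm (f t) \<le> norm (g t)"
  shows "f \<in> L2_space T"
  unfolding L2_space_iff
proof
  show "integrable (lebesgue_on {0..T}) (\<lambda>t. (norm (f t))\<^sup>2)"
  proof (rule Bochner_Integration.integrable_bound)
    show "integrable (lebesgue_on {0..T}) (\<lambda>t. (norm (g t))\<^sup>2)"
      using assms(2) by (simp add: L2_space_iff)
    show "AE t in lebesgue_on {0..T}. norm ((norm (f t))\<^sup>2) \<le> norm ((norm (g t))\<^sup>2)"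
      using assms(3) by (auto simp: AE_restrict_space_iff intro: power_mono)
  qed (use assms(1) in measurable)
qed fact

lemma L2_space_const: "(\<lambda>t. c) \<in> L2_space T"
  by (simp add: L2_space_iff)

lemma L2_space_bounded:
  assumes "f \<in> borel_measurable (lebesgue_on {0..T})" and "\<And>t. t \<in> {0..T} \<Longrightarrow> norm (f t) \<le> c"
  shows "f \<in> L2_space T"
proof (rule L2_space_bound[OF assms(1) L2_space_const[of c]])
  show "AE t in lebesgue. t \<in> {0..T} \<longrightarrow> norm (f t) \<le> norm c"
    using assms(2) by (intro AE_I2 impI) (smt (verit) real_norm_def)
qed

lemma L2_space_norm: "f \<in> L2_space T \<Longrightarrow> (\<lambda>t. norm (f t)) \<in> L2_space T"
  by (auto simp: L2_space_iff)

lemma L2_space_add: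
  assumes "f \<in> L2_space T" and "g \<in> L2_space T"
  shows "(\<lambda>t. f t + g t) \<in> L2_space T"
  unfolding L2_space_iff
proof
  show [measurable]: "(\<lambda>t. f t + g t) \<in> borel_measurable (lebesgue_on {0..T})"
    using assms[THEN L2_space_measurable] by measurable
  show "integrable (lebesgue_on {0..T}) (\<lambda>t. (norm (f t + g t))\<^sup>2)"
  proof (rule Bochner_Integration.integrable_bound)
    show "integrable (lebesgue_on {0..T}) (\<lambda>t. 2 * (norm (f t))\<^sup>2 + 2 * (norm (g t))\<^sup>2)"
      using assms by (simp add: L2_space_iff)
    have "(norm (f t + g t))\<^sup>2 \<le> 2 * (norm (f t))\<^sup>2 + 2 * (norm (g t))\<^sup>2" for t
    proof -
      have "(norm (f t + g t))\<^sup>2 \<le> (norm (f t) + norm (g t))\<^sup>2"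
        by (intro power_mono norm_triangle_ineq) simp
      also have "\<dots> \<le> 2 * (norm (f t))\<^sup>2 + 2 * (norm (g t))\<^sup>2"
        using zero_le_power2[of "norm (f t) - norm (g t)"] by (simp add: power2_eq_square algebra_simps)
      finally show ?thesis .
    qed
    then show "AE t in lebesgue_on {0..T}. norm ((norm (f t + g t))\<^sup>2) \<le> norm (2 * (norm (f t))\<^sup>2 + 2 * (norm (g t))\<^sup>2)"
      by simp
  qed measurable
qed

lemma L2_space_scaleR:
  assumes "f \<in> L2_space T"
  shows "(\<lambda>t. c *\<^sub>R f t) \<in> L2_space T"
  using assms by (auto simp: L2_space_iff power_mult_distrib)

lemma L2_space_diff:
  assumes "f \<in> L2_space T" and "g \<in> L2_space T"
  shows "(\<lambda>t. f t - g t) \<in> L2_space T"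
  using L2_space_add[OF assms(1) L2_space_scaleR[OF assms(2), of "-1"]] by simp

lemma L2_space_mult_integrable:
  fixes f g :: "real \<Rightarrow> real"
  assumes "f \<in> L2_space T" and "g \<in> L2_space T"
  shows "set_integrable lebesgue {0..T} (\<lambda>t. f t * g t)"
  unfolding set_integrable_lebesgue_on
proof (rule Bochner_Integration.integrable_bound)
  show "integrable (lebesgue_on {0..T}) (\<lambda>t. (norm (f t))\<^sup>2 + (norm (g t))\<^sup>2)"
    using assms by (simp add: L2_space_iff)
  show "(\<lambda>t. f t * g t) \<in> borel_measurable (lebesgue_on {0..T})"
    using assms[THEN L2_space_measurable] by measurable
  have "\<bar>a * b\<bar> \<le> a\<^sup>2 + b\<^sup>2" for a b :: real
  proof -
    have "2 * \<bar>a\<bar> * \<bar>b\<bar> \<le> \<bar>a\<bar>\<^sup>2 + \<bar>b\<bar>\<^sup>2" by (rule sum_squares_bound)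
    moreover have "0 \<le> \<bar>a\<bar> * \<bar>b\<bar>" by simp
    ultimately show ?thesis unfolding abs_mult power2_abs by linarith
  qed
  then show "AE t in lebesgue_on {0..T}. norm (f t * g t) \<le> norm ((norm (f t))\<^sup>2 + (norm (g t))\<^sup>2)"
    by simp
qed

lemma set_integrable_bound_mult:
  fixes h :: "real \<Rightarrow> 'a::{banach, second_countable_topology}" and f :: "real \<Rightarrow> 'b::real_normed_vector"
    and g :: "real \<Rightarrow> 'c::real_normed_vector"
  assumes "h \<in> borel_measurable (lebesgue_on {0..T})"
    and "(\<lambda>t. norm (f t)) \<in> L2_space T" and "(\<lambda>t. norm (g t)) \<in> L2_space T"
    and "\<And>t. t \<in> {0..T} \<Longrightarrow> norm (h t) \<le> norm (f t) * norm (g t)"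
  shows "set_integrable lebesgue {0..T} h"
  unfolding set_integrable_lebesgue_on
proof (rule Bochner_Integration.integrable_bound)
  show "integrable (lebesgue_on {0..T}) (\<lambda>t. norm (f t) * norm (g t))"
    using L2_space_mult_integrable[OF assms(2,3)] by (simp add: set_integrable_lebesgue_on)
  show "AE t in lebesgue_on {0..T}. norm (h t) \<le> norm (norm (f t) * norm (g t))"
    using assms(4) by (auto simp: AE_restrict_space_iff)
qed fact

lemma L2_space_integrable:
  fixes f :: "real \<Rightarrow> 'a::{banach, second_countable_topology}"
  assumes "f \<in> L2_space T"
  shows "set_integrable lebesgue {0..T} f"
  by (rule set_integrable_bound_mult[where f=f and g="\<lambda>_. 1::real"])
    (use assms L2_space_measurable L2_space_norm L2_space_const in auto)

lemma continuous_imp_measurable_lebesgue_on: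
  fixes f :: "real \<Rightarrow> 'a::real_normed_vector"
  assumes "continuous_on {a..b} f"
  shows "f \<in> borel_measurable (lebesgue_on {a..b})"
proof -
  have "(\<lambda>x. indicator {a..b} x *\<^sub>R f x) \<in> borel_measurable borel"
    using assms by (intro borel_measurable_continuous_on_indicator) auto
  then show ?thesis
    by (simp add: borel_measurable_restrict_space_iff measurable_completion)
qed

lemma set_integral_point_eq_0 [simp]:
  fixes f :: "real \<Rightarrow> 'a::{banach, second_countable_topology}"
  shows "(LINT r:{a}|lebesgue. f r) = 0"
proof -
  have "AE x in lebesgue. x \<noteq> a"
    by (rule AE_completion) (rule AE_lborel_singleton)
  then have "AE x in lebesgue. indicator {a} x *\<^sub>R f x = 0"
    by eventually_elim auto
  then show ?thesis
    unfolding set_lebesgue_integral_def by (rule integral_eq_zero_AE)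
qed

lemma set_integral_split:
  fixes f :: "real \<Rightarrow> 'a::{banach, second_countable_topology}"
  assumes "set_integrable lebesgue {a..c} f" and "a \<le> b" and "b \<le> c"
  shows "(LINT r:{a..c}|lebesgue. f r) = (LINT r:{a..b}|lebesgue. f r) + (LINT r:{b..c}|lebesgue. f r)"
proof -
  have 1: "set_integrable lebesgue {a..b} f" "set_integrable lebesgue {b..c} f"
    using assms by (auto intro: set_integrable_subset[OF assms(1)])
  have "AE x in lebesgue. x \<noteq> b"
    by (rule AE_completion) (rule AE_lborel_singleton)
  then have "AE x in lebesgue. \<not> (x \<in> {a..b} \<and> x \<in> {b..c})"
    by eventually_elim auto
  from set_integral_Un_AE[OF this _ _ 1] have "(LINT r:{a..b} \<union> {b..c}|lebesgue. f r)
      = (LINT r:{a..b}|lebesgue. f r) + (LINT r:{b..c}|lebesgue. f r)" by simp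
  moreover have "{a..b} \<union> {b..c} = {a..c}" using assms by auto
  ultimately show ?thesis by simp
qed

lemma set_integral_nonneg_real:
  fixes f :: "'a \<Rightarrow> real"
  assumes "\<And>x. x \<in> A \<Longrightarrow> 0 \<le> f x"
  shows "0 \<le> (LINT x:A|M. f x)"
  unfolding set_lebesgue_integral_def using assms
  by (intro Bochner_Integration.integral_nonneg) (auto simp: indicator_def)

text \<open>Continuity is inherited from the Henstock-Kurzweil integral, which agrees with the
  Lebesgue integral on integrable functions.\<close>

lemma continuous_on_indefinite_integral:
  fixes f :: "real \<Rightarrow> real"
  assumes "set_integrable lebesgue {0..T} f"
  shows "continuous_on {0..T} (\<lambda>t. LINT r:{0..t}|lebesgue. f r)"
proof -
  have "continuous_on {0..T} (\<lambda>t. integral {0..t} f)"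
    using assms by (intro indefinite_integral_continuous_1 set_lebesgue_integral_eq_integral)
  moreover have "(LINT r:{0..t}|lebesgue. f r) = integral {0..t} f" if "t \<in> {0..T}" for t
    using that by (intro set_lebesgue_integral_eq_integral set_integrable_subset[OF assms]) auto
  ultimately show ?thesis by (auto intro: continuous_on_eq)
qed

text \<open>As \<open>a\<close> is only integrable, the bound is obtained over short intervals on which \<open>x = \<integral> a \<le> 1/2\<close>;
  the factor \<open>2\<close> in the exponent comes from \<open>1 \<le> (1 - x) exp (2 x)\<close> for such \<open>x\<close>.\<close>

lemma gronwall:
  fixes a y :: "real \<Rightarrow> real"
  assumes a: "set_integrable lebesgue {0..T} a" "\<And>t. t \<in> {0..T} \<Longrightarrow> 0 \<le> a t"
    and y: "continuous_on {0..T} y" "\<And>t. t \<in> {0..T} \<Longrightarrow> 0 \<le> y t"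
    and le: "\<And>t. t \<in> {0..T} \<Longrightarrow> y t \<le> R + (LINT r:{0..t}|lebesgue. a r * y r)"
    and ay: "set_integrable lebesgue {0..T} (\<lambda>t. a t * y t)"
    and t: "t \<in> {0..T}"
  shows "y t \<le> R * exp (2 * (LINT r:{0..T}|lebesgue. a r))"
proof -
  define A where "A t = (LINT r:{0..t}|lebesgue. a r)" for t
  define Y where "Y t = R + (LINT r:{0..t}|lebesgue. a r * y r)" for t
  have sub: "set_integrable lebesgue {s..t} a" "set_integrable lebesgue {s..t} (\<lambda>r. a r * y r)"
    if "0 \<le> s" "t \<le> T" for s t
    using that by (auto intro: set_integrable_subset[OF a(1)] set_integrable_subset[OF ay])
  have Adiff: "A t - A s = (LINT r:{s..t}|lebesgue. a r)" if "0 \<le> s" "s \<le> t" "t \<le> T" for s t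
    using set_integral_split[OF sub(1), of 0 t s] that by (simp add: A_def)
  have Ydiff: "Y t - Y s = (LINT r:{s..t}|lebesgue. a r * y r)" if "0 \<le> s" "s \<le> t" "t \<le> T" for s t
    using set_integral_split[OF sub(2), of 0 t s] that by (simp add: Y_def)
  have nonneg: "0 \<le> (LINT r:{s..t}|lebesgue. f r)" if "0 \<le> s" "t \<le> T" "\<And>r. r \<in> {0..T} \<Longrightarrow> 0 \<le> f r"
    for s t and f :: "real \<Rightarrow> real"
    unfolding set_lebesgue_integral_def using that
    by (intro Bochner_Integration.integral_nonneg) (auto simp: indicator_def)
  have Ymono: "Y s \<le> Y t" if "0 \<le> s" "s \<le> t" "t \<le> T" for s t
    using Ydiff[OF that] nonneg[of s t "\<lambda>r. a r * y r"] that a y by force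
  have Amono: "A s \<le> A t" if "0 \<le> s" "s \<le> t" "t \<le> T" for s t
    using Adiff[OF that] nonneg[of s t a] that a by force
  have yY: "y t \<le> Y t" if "t \<in> {0..T}" for t
    using le[OF that] by (simp add: Y_def)
  \<comment> \<open>An implicit Euler inequality: since \<open>Y\<close> is nondecreasing and
    dominates \<open>y\<close>, the integrand on the interval is bounded by its weight times the
    value of \<open>Y\<close> at the right end.\<close>
  have step: "Y t - Y s \<le> (A t - A s) * Y t" if "0 \<le> s" "s \<le> t" "t \<le> T" for s t
  proof -
    have "Y t - Y s = (LINT r:{s..t}|lebesgue. a r * y r)" using Ydiff[OF that] .
    also have "\<dots> \<le> (LINT r:{s..t}|lebesgue. a r * Y t)"
    proof (rule set_integral_mono)
      fix r assume r: "r \<in> {s..t}"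
      then have "y r \<le> Y t" using yY[of r] Ymono[of r t] that by auto
      then show "a r * y r \<le> a r * Y t" using a(2)[of r] r that by (intro mult_left_mono) auto
    qed (use sub that in auto)
    also have "\<dots> = (A t - A s) * Y t" using Adiff[OF that] by simp
    finally show ?thesis .
  qed
  have Y0: "0 \<le> Y t" if "t \<in> {0..T}" for t using yY[OF that] y(2)[OF that] by linarith
  \<comment> \<open>The bound with an integrating factor; it remains to see that \<open>Z\<close>
    does not increase, which \<open>step\<close> gives over intervals where \<open>A\<close> grows
    by at most 1/2.\<close>
  define Z where "Z t = Y t * exp (- 2 * A t)" for t
  have Zstep: "Z t \<le> Z s" if st: "0 \<le> s" "s \<le> t" "t \<le> T" "A t - A s \<le> 1/2" for s t
  proof -
    define x where "x = A t - A s"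
    have x: "0 \<le> x" "x \<le> 1/2" using Amono st by (auto simp: x_def)
    have "1 \<le> (1 + 2 * x) * (1 - x)"
      using x mult_nonneg_nonneg[of x "1 - 2 * x"] by (simp add: algebra_simps)
    also have "\<dots> \<le> exp (2 * x) * (1 - x)"
      using x exp_ge_add_one_self[of "2 * x"] by (intro mult_right_mono) auto
    finally have "Y t * exp (- 2 * A t) * 1 \<le> Y t * exp (- 2 * A t) * (exp (2 * x) * (1 - x))"
      using Y0[of t] st by (intro mult_left_mono) auto
    also have "\<dots> = (Y t * (1 - x)) * exp (- 2 * A s)"
      by (simp add: x_def exp_add[symmetric] exp_diff exp_minus field_simps)
    also have "\<dots> \<le> Y s * exp (- 2 * A s)"
      using step[OF st(1-3)] by (intro mult_right_mono) (auto simp: x_def algebra_simps)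
    finally show ?thesis by (simp add: Z_def)
  qed
  have "uniformly_continuous_on {0..T} A"
    unfolding A_def by (intro compact_uniformly_continuous continuous_on_indefinite_integral a) auto
  then obtain d where d: "d > 0" "\<And>s t. s \<in> {0..T} \<Longrightarrow> t \<in> {0..T} \<Longrightarrow> dist t s < d \<Longrightarrow> dist (A t) (A s) < 1/2"
    unfolding uniformly_continuous_on_def by (metis half_gt_zero_iff zero_less_one)
  have A_close: "A t - A s \<le> 1/2" if "s \<in> {0..T}" "t \<in> {0..T}" "\<bar>t - s\<bar> < d" for s t
    using d(2)[OF that(1,2)] that(3) unfolding dist_real_def by linarith
  \<comment> \<open>Descent from \<open>t\<close> to 0 in steps of length at most
    \<open>d/2\<close>; the half keeps the length strictly below \<open>d\<close>, the modulus of
    uniform continuity of \<open>A\<close>.\<close>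
  have "t \<in> {0..T} \<Longrightarrow> t \<le> real n * (d/2) \<Longrightarrow> Z t \<le> Z 0" for n t
  proof (induction n arbitrary: t)
    case 0 then show ?case by simp
  next
    case (Suc n)
    let ?s = "max 0 (t - d/2)"
    have "Z t \<le> Z ?s"
      using Suc.prems d(1) by (intro Zstep A_close) auto
    also have "\<dots> \<le> Z 0"
      using Suc.prems d(1) by (intro Suc.IH) (auto simp: algebra_simps max_def)
    finally show ?case .
  qed
  moreover obtain n where "t \<le> real n * (d/2)"
    using d(1) reals_Archimedean3[of "d/2"] by (meson half_gt_zero less_imp_le)
  ultimately have "Z t \<le> Z 0" using t by blast
  moreover have "Z 0 = R"
    by (simp add: Z_def Y_def A_def)
  ultimately have "Y t \<le> R * exp (2 * A t)"
    by (simp add: Z_def exp_minus field_simps)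
  \<comment> \<open>The sign of \<open>R\<close> is a consequence: \<open>R = Y 0\<close>, which
    dominates the nonnegative \<open>y 0\<close>.\<close>
  moreover have "0 \<le> R" using Y0[of 0] t by (simp add: Y_def)
  then have "R * exp (2 * A t) \<le> R * exp (2 * A T)" using Amono[of t T] t by (intro mult_left_mono) auto
  ultimately show ?thesis using yY[OF t] by (simp add: A_def)
qed

text \<open>Dominated convergence gives a simple function near \<open>F\<close>, and a choice
  function \<open>\<psi>\<close> then moves each of its values to a nearby point of
  \<open>D\<close>. Composing a simple function with any function gives a simple function again, so
  an arbitrary choice is good enough.\<close>

lemma L2_simple_approximation:
  fixes F :: "real \<Rightarrow> 'a::{real_normed_vector, second_countable_topology}"
  assumes F: "F \<in> L2_space T" and D: "closure D = UNIV" and e: "e > 0"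
  obtains G where "simple_function lebesgue G" and "range G \<subseteq> D"
    and "(LINT t:{0..T}|lebesgue. (norm (F t - G t))\<^sup>2) \<le> e"
proof -
  let ?M = "lebesgue_on {0..T}"
  define F' where "F' t = indicator {0..T} t *\<^sub>R F t" for t
  have "F' \<in> borel_measurable lebesgue"
    using F by (simp add: L2_space_def set_borel_measurable_def F'_def[abs_def])
  from borel_measurable_implies_sequence_metric[OF this, of 0] obtain s where
    s: "\<And>i. simple_function lebesgue (s i)"
    and lim: "\<And>t. (\<lambda>i. s i t) \<longlonglongrightarrow> F' t"
    and bd: "\<And>i t. norm (s i t) \<le> 2 * norm (F' t)"
    by auto
  \<comment> \<open>The bound by twice the norm of \<open>F'\<close> on the approximants gives 3
    times the norm of \<open>F\<close> for the difference, hence 9 for its square: a dominating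
    function independent of \<open>i\<close>.\<close>
  have near: "(norm (F t - s i t))\<^sup>2 \<le> 9 * (norm (F t))\<^sup>2" if "t \<in> {0..T}" for i t
  proof -
    have "F' t = F t" using that by (simp add: F'_def)
    then have "norm (F t - s i t) \<le> 3 * norm (F t)"
      using norm_triangle_ineq4[of "F t" "s i t"] bd[of i t] by simp
    then have "(norm (F t - s i t))\<^sup>2 \<le> (3 * norm (F t))\<^sup>2" by (intro power_mono) auto
    then show ?thesis by (simp add: power_mult_distrib)
  qed
  have [measurable]: "F \<in> borel_measurable ?M" using F by (rule L2_space_measurable)
  have sm [measurable]: "s i \<in> borel_measurable ?M" for i
    by (rule measurable_restrict_space1) (rule borel_measurable_simple_function[OF s])
  have "(\<lambda>i. LINT t|?M. (norm (F t - s i t))\<^sup>2) \<longlonglongrightarrow> (LINT t|?M. 0)"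
  proof (rule integral_dominated_convergence)
    show "integrable ?M (\<lambda>t. 9 * (norm (F t))\<^sup>2)"
      using F by (simp add: L2_space_iff)
    show "AE t in ?M. (\<lambda>i. (norm (F t - s i t))\<^sup>2) \<longlonglongrightarrow> 0"
    proof (rule AE_I2)
      fix t assume "t \<in> space ?M"
      then have "F' t = F t" by (simp add: F'_def)
      then have "(\<lambda>i. (norm (F t - s i t))\<^sup>2) \<longlonglongrightarrow> (norm (F t - F t))\<^sup>2"
        using lim[of t] by (intro tendsto_intros) auto
      then show "(\<lambda>i. (norm (F t - s i t))\<^sup>2) \<longlonglongrightarrow> 0" by simp
    qed
    show "AE t in ?M. norm ((norm (F t - s i t))\<^sup>2) \<le> 9 * (norm (F t))\<^sup>2" for i
    proof (rule AE_I2)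
      fix t assume "t \<in> space ?M"
      then have "(norm (F t - s i t))\<^sup>2 \<le> 9 * (norm (F t))\<^sup>2" by (intro near) auto
      then show "norm ((norm (F t - s i t))\<^sup>2) \<le> 9 * (norm (F t))\<^sup>2" by simp
    qed
  qed measurable
  then have "\<forall>\<^sub>F i in sequentially. (LINT t|?M. (norm (F t - s i t))\<^sup>2) < e / 4"
    using e by (intro order_tendstoD) auto
  then obtain i where i: "(LINT t|?M. (norm (F t - s i t))\<^sup>2) < e / 4"
    using eventually_happens'[OF sequentially_bot] by blast
  \<comment> \<open>Chosen so that moving the values costs at most \<open>e / 2\<close> after
    integration over [0,T]; adding 1 keeps the denominator positive. The other \<open>e / 2\<close>
    is twice the \<open>e / 4\<close> just obtained.\<close>
  define \<delta> where "\<delta> = sqrt (e / (4 * (\<bar>T\<bar> + 1)))"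
  have \<delta>: "\<delta> > 0" "\<delta>\<^sup>2 = e / (4 * (\<bar>T\<bar> + 1))" using e by (auto simp: \<delta>_def)
  have "\<exists>d\<in>D. dist d x < \<delta>" for x
    using D \<delta>(1) closure_approachable[of x D] by auto
  then obtain \<psi> where \<psi>: "\<And>x. \<psi> x \<in> D" "\<And>x. dist (\<psi> x) x < \<delta>" by metis
  define G where "G t = \<psi> (s i t)" for t
  have Gs: "simple_function lebesgue G"
    unfolding G_def using simple_function_compose1[OF s, where g = \<psi>] by simp
  have [measurable]: "G \<in> borel_measurable ?M"
    by (rule measurable_restrict_space1) (rule borel_measurable_simple_function[OF Gs])
  have le: "(norm (F t - G t))\<^sup>2 \<le> 2 * (norm (F t - s i t))\<^sup>2 + 2 * \<delta>\<^sup>2" for t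
  proof -
    have "norm (F t - G t) \<le> norm (F t - s i t) + \<delta>"
      using \<psi>(2)[of "s i t"] norm_triangle_ineq[of "F t - s i t" "s i t - G t"]
      by (simp add: G_def dist_norm norm_minus_commute)
    then have "(norm (F t - G t))\<^sup>2 \<le> (norm (F t - s i t) + \<delta>)\<^sup>2" by (intro power_mono) auto
    also have "\<dots> \<le> 2 * (norm (F t - s i t))\<^sup>2 + 2 * \<delta>\<^sup>2"
      using sum_squares_bound[of "norm (F t - s i t)" \<delta>] by (simp add: power2_sum)
    finally show ?thesis .
  qed
  have int: "integrable ?M (\<lambda>t. (norm (F t - s i t))\<^sup>2)"
  proof (rule Bochner_Integration.integrable_bound)
    show "integrable ?M (\<lambda>t. 9 * (norm (F t))\<^sup>2)" using F by (simp add: L2_space_iff)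
    show "AE t in ?M. norm ((norm (F t - s i t))\<^sup>2) \<le> norm (9 * (norm (F t))\<^sup>2)"
    proof (rule AE_I2)
      fix t assume "t \<in> space ?M"
      then have "(norm (F t - s i t))\<^sup>2 \<le> 9 * (norm (F t))\<^sup>2" by (intro near) auto
      then show "norm ((norm (F t - s i t))\<^sup>2) \<le> norm (9 * (norm (F t))\<^sup>2)" by simp
    qed
  qed measurable
  have int2: "integrable ?M (\<lambda>t. 2 * (norm (F t - s i t))\<^sup>2 + 2 * \<delta>\<^sup>2)"
    using int by simp
  have "(LINT t|?M. (norm (F t - G t))\<^sup>2) \<le> (LINT t|?M. 2 * (norm (F t - s i t))\<^sup>2 + 2 * \<delta>\<^sup>2)"
  proof (rule integral_mono)
    show "integrable ?M (\<lambda>t. (norm (F t - G t))\<^sup>2)"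
      by (rule Bochner_Integration.integrable_bound[OF int2]) (use le order_trans in \<open>auto intro!: AE_I2\<close>)
  qed (use int2 le in auto)
  also have "\<dots> = 2 * (LINT t|?M. (norm (F t - s i t))\<^sup>2) + 2 * \<delta>\<^sup>2 * measure lebesgue {0..T}"
    using int by (simp add: measure_restrict_space)
  also have "\<dots> \<le> 2 * (e / 4) + 2 * \<delta>\<^sup>2 * \<bar>T\<bar>"
    using i by (intro add_mono mult_left_mono) auto
  also have "2 * \<delta>\<^sup>2 * \<bar>T\<bar> \<le> e / 2"
  proof -
    have "e * \<bar>T\<bar> \<le> e * (\<bar>T\<bar> + 1)" using e by simp
    then show ?thesis unfolding \<delta>(2) by (simp add: field_simps)
  qed
  finally have "(LINT t:{0..T}|lebesgue. (norm (F t - G t))\<^sup>2) \<le> e"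
    by (simp add: set_integral_lebesgue_on)
  moreover have "range G \<subseteq> D" using \<psi>(1) by (auto simp: G_def)
  ultimately show thesis using Gs that by blast
qed

text \<open>The mean over \<open>s\<close> in \<open>(0,h)\<close> of the Riemann sums below is \<open>\<integral> q\<close>.\<close>

lemma good_partition:
  fixes q :: "real \<Rightarrow> real" and n :: nat
  assumes T: "T > 0" and q: "set_integrable lebesgue {0..T} q" "\<And>t. 0 \<le> q t"
    and P: "AE t in lebesgue. t \<in> {0..T} \<longrightarrow> P t" and n: "n > 0" and h: "h = T / real n"
  obtains s where "0 < s" and "s < h" and "\<And>j. j < n \<Longrightarrow> P (s + real j * h)"
    and "h * (\<Sum>j<n. q (s + real j * h)) \<le> (LINT t:{0..T}|lebesgue. q t) + 1"
proof -
  define Q where "Q = (LINT t:{0..T}|lebesgue. q t)"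
  have h0: "h > 0" "real n * h = T" using T n by (auto simp: h)
  \<comment> \<open>The piece of \<open>q\<close> over the \<open>j\<close>-th cell, moved to [0,h).
    The half-open cells tile [0,T), so these pieces have total integral at most
    \<open>Q\<close>.\<close>
  define f where "f j s = indicator {0..<h} s *\<^sub>R q (s + real j * h)" for j :: nat and s
  have sub: "set_integrable lebesgue {real j * h..<real (Suc j) * h} q" if "j < n" for j
  proof (rule set_integrable_subset[OF q(1)])
    have "real (Suc j) * h \<le> real n * h" using that h0 by (intro mult_right_mono) auto
    moreover have "0 \<le> real j * h" using h0 by simp
    ultimately show "{real j * h..<real (Suc j) * h} \<subseteq> {0..T}" unfolding h0(2) by auto
  qed auto
  have f_eq: "f j = (\<lambda>s. indicator {real j * h..<real (Suc j) * h} (real j * h + 1 * s) *\<^sub>R q (real j * h + 1 * s))" for j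
    by (auto simp: f_def indicator_def algebra_simps)
  have f_int: "integrable lebesgue (f j)" if "j < n" for j
    unfolding f_eq using sub[OF that] unfolding set_integrable_def
    by (intro lebesgue_integrable_real_affine[of "\<lambda>t. indicator {real j * h..<real (Suc j) * h} t *\<^sub>R q t"]) auto
  have f_integral: "integral\<^sup>L lebesgue (f j) = (LINT t:{real j * h..<real (Suc j) * h}|lebesgue. q t)" for j
    unfolding set_lebesgue_integral_def f_eq
    by (subst (2) lebesgue_integral_real_affine[where c=1 and t="real j * h"]) auto
  have sum_int: "m \<le> n \<Longrightarrow> (\<Sum>j<m. integral\<^sup>L lebesgue (f j)) = (LINT t:{0..<real m * h}|lebesgue. q t)" for m
  proof (induction m)
    case 0 then show ?case by (simp add: set_lebesgue_integral_def)
  next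
    case (Suc m)
    have "(LINT t:{0..<real m * h} \<union> {real m * h..<real (Suc m) * h}|lebesgue. q t)
      = (LINT t:{0..<real m * h}|lebesgue. q t) + (LINT t:{real m * h..<real (Suc m) * h}|lebesgue. q t)"
    proof (rule set_integral_Un)
      have "real m * h \<le> real n * h" using Suc.prems h0 by (intro mult_right_mono) auto
      then show "set_integrable lebesgue {0..<real m * h} q"
        unfolding h0(2) by (intro set_integrable_subset[OF q(1)]) auto
    qed (use Suc.prems sub in auto)
    also have "{0..<real m * h} \<union> {real m * h..<real (Suc m) * h} = {0..<real (Suc m) * h}"
      using h0 by (intro ivl_disj_un_two) (auto intro: mult_right_mono)
    finally show ?case using Suc f_integral by simp
  qed
  have total: "(\<Sum>j<n. integral\<^sup>L lebesgue (f j)) \<le> Q"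
    unfolding sum_int[OF order_refl] Q_def h0(2) set_lebesgue_integral_def
  proof (rule integral_mono)
    show "integrable lebesgue (\<lambda>t. indicat_real {0..<T} t *\<^sub>R q t)"
      using set_integrable_subset[OF q(1), of "{0..<T}"] by (simp add: set_integrable_def subset_iff)
  qed (use q in \<open>auto simp: set_integrable_def indicator_def\<close>)
  \<comment> \<open>Translates of the exceptional null set are null, and only finitely many of them
    occur.\<close>
  have "AE s in lebesgue. \<forall>j\<in>{..<n}. s + real j * h \<in> {0..T} \<longrightarrow> P (s + real j * h)"
  proof (rule AE_finite_allI)
    fix j
    obtain Z where Z: "Z \<in> null_sets lebesgue" "{t. \<not> (t \<in> {0..T} \<longrightarrow> P t)} \<subseteq> Z"
      using P unfolding eventually_ae_filter by auto
    have "negligible ((\<lambda>t. - (real j * h) + t) ` Z)"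
      using Z(1) by (intro negligible_translation) (simp add: negligible_iff_null_sets)
    then have "(\<lambda>t. - (real j * h) + t) ` Z \<in> null_sets lebesgue" by (simp add: negligible_iff_null_sets)
    then show "AE s in lebesgue. s + real j * h \<in> {0..T} \<longrightarrow> P (s + real j * h)"
    proof (rule AE_I')
      show "{s \<in> space lebesgue. \<not> (s + real j * h \<in> {0..T} \<longrightarrow> P (s + real j * h))}
        \<subseteq> (\<lambda>t. - (real j * h) + t) ` Z"
      proof
        fix s assume "s \<in> {s \<in> space lebesgue. \<not> (s + real j * h \<in> {0..T} \<longrightarrow> P (s + real j * h))}"
        then have "s + real j * h \<in> Z" using Z(2) by auto
        then show "s \<in> (\<lambda>t. - (real j * h) + t) ` Z" by (intro image_eqI[of _ _ "s + real j * h"]) auto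
      qed
    qed
  qed simp
  then have AEP: "AE s in lebesgue. s \<in> {0<..<h} \<longrightarrow> (\<forall>j<n. P (s + real j * h))"
  proof eventually_elim
    case (elim s)
    show ?case
    proof (intro impI allI)
      fix j assume "s \<in> {0<..<h}" "j < n"
      moreover have "real (Suc j) * h \<le> real n * h" using \<open>j < n\<close> h0 by (intro mult_right_mono) auto
      ultimately have "s + real j * h \<in> {0..T}" using h0 by (auto simp: algebra_simps)
      then show "P (s + real j * h)" using elim \<open>j < n\<close> by auto
    qed
  qed
  show thesis
  proof (rule ccontr)
    \<comment> \<open>If no offset worked, the Riemann sum would exceed \<open>Q + 1\<close> for
      almost every \<open>s\<close> in (0,h); the mean over \<open>s\<close> would then be at least
      \<open>Q + 1\<close>, whereas it is at most \<open>Q\<close>. The added 1 in the claim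
      provides this gap.\<close>
    assume "\<not> thesis"
    then have no: "\<And>s. 0 < s \<Longrightarrow> s < h \<Longrightarrow> (\<And>j. j < n \<Longrightarrow> P (s + real j * h)) \<Longrightarrow>
        Q + 1 < h * (\<Sum>j<n. q (s + real j * h))"
      using that unfolding Q_def by force
    have "AE s in lebesgue. indicator {0<..<h} s *\<^sub>R ((Q + 1) / h) \<le> (\<Sum>j<n. f j s)"
      using AEP
    proof eventually_elim
      case (elim s)
      show ?case
      proof (cases "s \<in> {0<..<h}")
        case True
        then have "Q + 1 < h * (\<Sum>j<n. q (s + real j * h))" using no elim by auto
        then show ?thesis using True h0 by (simp add: f_def pos_divide_le_eq mult.commute)
      next
        case False
        then show ?thesis using q(2) by (auto simp: f_def intro!: sum_nonneg)
      qed
    qed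
    then have "(LINT s|lebesgue. indicator {0<..<h} s *\<^sub>R ((Q + 1) / h)) \<le> (LINT s|lebesgue. (\<Sum>j<n. f j s))"
    proof (rule integral_mono_AE[rotated 2])
      show "integrable lebesgue (\<lambda>s. indicator {0<..<h} s *\<^sub>R ((Q + 1) / h))"
        by (intro integrable_scaleR_left integrable_real_indicator) (auto simp: emeasure_lborel_Ioo h0(1) less_imp_le)
      show "integrable lebesgue (\<lambda>s. \<Sum>j<n. f j s)"
        using f_int by (intro Bochner_Integration.integrable_sum) auto
    qed
    also have "\<dots> = (\<Sum>j<n. integral\<^sup>L lebesgue (f j))"
      using f_int by (intro Bochner_Integration.integral_sum) auto
    also have "(LINT s|lebesgue. indicator {0<..<h} s *\<^sub>R ((Q + 1) / h)) = Q + 1"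
      using h0 by simp
    finally show False using total by simp
  qed
qed

section \<open>The energy inequality\<close>

lemma young_ineq:
  fixes a b e :: real
  assumes "e > 0"
  shows "a * b \<le> a\<^sup>2 / (2 * e) + e * b\<^sup>2 / 2"
proof -
  have "0 \<le> (a - e * b)\<^sup>2 / (2 * e)" using assms by simp
  also have "\<dots> = a\<^sup>2 / (2 * e) + e * b\<^sup>2 / 2 - a * b"
    using assms by (simp add: power2_eq_square field_simps)
  finally show ?thesis by simp
qed

lemma L2_space_blinfun_apply_integrable:
  fixes F :: "real \<Rightarrow> 'v::{real_inner, banach, second_countable_topology} \<Rightarrow>\<^sub>L real"
  assumes "F \<in> L2_space T" and "x \<in> L2_space T"
  shows "set_integrable lebesgue {0..T} (\<lambda>t. F t (x t))"
proof (rule set_integrable_bound_mult[where f = F and g = x])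
  show "(\<lambda>t. F t (x t)) \<in> borel_measurable (lebesgue_on {0..T})"
    using assms[THEN L2_space_measurable]
    by (rule borel_measurable_continuous_Pair) (intro continuous_intros)
  show "norm (F t (x t)) \<le> norm (F t) * norm (x t)" for t
    by (rule norm_blinfun)
qed (use assms L2_space_norm in auto)

lemma L2_space_inner_integrable:
  fixes g :: "real \<Rightarrow> 'h::{real_inner, second_countable_topology}"
  assumes "g \<in> L2_space T" and "x \<in> L2_space T"
  shows "set_integrable lebesgue {0..T} (\<lambda>t. g t \<bullet> x t)"
proof (rule set_integrable_bound_mult[where f = g and g = x])
  show "(\<lambda>t. g t \<bullet> x t) \<in> borel_measurable (lebesgue_on {0..T})"
    using assms[THEN L2_space_measurable] by measurable
qed (use assms L2_space_norm Cauchy_Schwarz_ineq2 in auto)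

lemma L2_space_continuous:
  assumes "continuous_on {0..T} f"
  shows "f \<in> L2_space T"
proof -
  have "bounded (f ` {0..T})"
    using assms by (intro compact_imp_bounded compact_continuous_image) auto
  then obtain c where "\<And>t. t \<in> {0..T} \<Longrightarrow> norm (f t) \<le> c" unfolding bounded_iff by (metis imageI)
  then show ?thesis
    using assms by (intro L2_space_bounded continuous_imp_measurable_lebesgue_on)
qed

lemma L2_space_cutoff:
  assumes "f \<in> L2_space T" and "continuous_on {0..T} \<theta>" and "\<And>t. t \<in> {0..T} \<Longrightarrow> \<bar>\<theta> t\<bar> \<le> 1"
  shows "(\<lambda>t. \<theta> t *\<^sub>R f t) \<in> L2_space T"
proof (rule L2_space_bound[OF _ assms(1)])
  show "(\<lambda>t. \<theta> t *\<^sub>R f t) \<in> borel_measurable (lebesgue_on {0..T})"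
    using L2_space_measurable[OF assms(1)] continuous_imp_measurable_lebesgue_on[OF assms(2)]
    by measurable
  show "AE t in lebesgue. t \<in> {0..T} \<longrightarrow> norm (\<theta> t *\<^sub>R f t) \<le> norm (f t)"
    using assms(3) by (intro AE_I2) (simp add: mult_left_le_one_le)
qed

lemma to_dual_apply: "to_dual \<iota> h v = h \<bullet> \<iota> v"
  by (simp add: to_dual_def)

text \<open>The inequality \<open>|b|\<^sup>2 - |a|\<^sup>2 \<le> 2 (b - a, b)\<close> is summed over a partition whose points, the right
  endpoints of its intervals, avoid the null set of times with \<open>v t \<noteq> \<iota> (V t)\<close> and along which the
  Riemann sums of \<open>\<parallel>V\<parallel>\<^sup>2\<close> are bounded.  Instead of a convergence of the step functions to \<open>V\<close> in the
  norm of \<open>V\<close> it is then enough that \<open>F\<close> is close in \<open>L\<^sup>2\<close> to a simple function with values in \<open>H\<close>,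
  against which \<open>v\<close> is tested in \<open>H\<close>, where it is continuous.  The weight \<open>\<theta>\<close> localises the
  integral over \<open>[0,T]\<close> to \<open>[0,t\<^sub>0]\<close>; as it vanishes at \<open>T\<close>, the value \<open>v T\<close>, which need not be in the
  range of \<open>\<iota>\<close>, does not enter.\<close>

lemma energy_inequality:
  fixes \<iota> :: "'v::{real_inner, banach, second_countable_topology} \<Rightarrow>\<^sub>L 'h::{real_inner, banach, second_countable_topology}"
    and v M :: "real \<Rightarrow> 'h" and V :: "real \<Rightarrow> 'v" and F :: "real \<Rightarrow> 'v \<Rightarrow>\<^sub>L real"
    and \<theta> :: "real \<Rightarrow> real"
  assumes T: "T > 0" and dense: "closure (range (to_dual \<iota>)) = UNIV"
    and v: "continuous_on {0..T} v" and V: "V \<in> L2_space T"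
    and vV: "AE t in lebesgue. t \<in> {0..T} \<longrightarrow> v t = \<iota> (V t)"
    and F: "F \<in> L2_space T"
    and eq: "\<And>s t x. 0 \<le> s \<Longrightarrow> s \<le> t \<Longrightarrow> t \<le> T \<Longrightarrow>
      (v t - v s) \<bullet> \<iota> x = (LINT r:{s..t}|lebesgue. F r x) + (M t - M s) \<bullet> \<iota> x"
    and \<theta>: "continuous_on {0..T} \<theta>" "\<And>s t. 0 \<le> s \<Longrightarrow> s \<le> t \<Longrightarrow> t \<le> T \<Longrightarrow> \<theta> t \<le> \<theta> s"
    and \<theta>1: "\<And>t. t \<in> {0..t\<^sub>0} \<Longrightarrow> \<theta> t = 1" and \<theta>0: "\<And>t. t \<in> {t\<^sub>0 + d..T} \<Longrightarrow> \<theta> t = 0"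
    and t\<^sub>0: "0 \<le> t\<^sub>0" "d > 0" "t\<^sub>0 + d \<le> T"
    and m: "\<And>r. r \<in> {0..T} \<Longrightarrow> t\<^sub>0 - d \<le> r \<Longrightarrow> r \<le> t\<^sub>0 + d \<Longrightarrow> m \<le> (norm (v r))\<^sup>2"
    and I: "has_rs_integral (\<lambda>t. \<theta> t *\<^sub>R v t) M 0 T I"
  shows "m - (norm (v 0))\<^sup>2 \<le> 2 * (LINT r:{0..T}|lebesgue. \<theta> r * F r (V r)) + 2 * I"
proof -
  define Q where "Q = (LINT t:{0..T}|lebesgue. (norm (V t))\<^sup>2)"
  define D where "D = (LINT r:{0..T}|lebesgue. \<theta> r * F r (V r))"
  define y where "y t = (norm (v t))\<^sup>2" for t
  have \<theta>T: "\<theta> T = 0" and \<theta>00: "\<theta> 0 = 1" using \<theta>0[of T] \<theta>1[of 0] t\<^sub>0 by auto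
  have \<theta>b: "0 \<le> \<theta> t" "\<theta> t \<le> 1" if "t \<in> {0..T}" for t
    using \<theta>(2)[of 0 t] \<theta>(2)[of t T] that by (auto simp: \<theta>T \<theta>00)
  \<comment> \<open>The factor of \<open>e\<close> collects \<open>2 * T\<close> from the modulus of
    continuity of \<open>w\<close>, 1 from \<open>R T / e\<close>, \<open>Q + 1\<close> from
    \<open>E\<close> at the partition points, 2 from the Riemann-Stieltjes sum and
    \<open>Q + 1\<close> from passing back from \<open>g\<close> to \<open>F\<close> under the
    integral.\<close>
  have bound: "m - y 0 \<le> 2 * D + 2 * I + e * (2 * T + 2 * Q + 5)" if e: "e > 0" for e
  proof -
    obtain G where Gs: "simple_function lebesgue G" and GD: "range G \<subseteq> range (to_dual \<iota>)"
      and GF: "(LINT t:{0..T}|lebesgue. (norm (F t - G t))\<^sup>2) \<le> e\<^sup>2"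
      using L2_simple_approximation[OF F dense, of "e\<^sup>2"] e by auto
    \<comment> \<open>A preimage in H of the functional \<open>G\<close>: paired with
      \<open>g\<close>, the path is tested through its values in H, where it is continuous.\<close>
    define g where "g t = inv (to_dual \<iota>) (G t)" for t
    have gG: "g t \<bullet> \<iota> x = G t x" for t x
    proof -
      have "G t \<in> range (to_dual \<iota>)" using GD by auto
      then have "to_dual \<iota> (g t) = G t" unfolding g_def by (rule f_inv_into_f)
      then show ?thesis using to_dual_apply[of \<iota> "g t" x] by simp
    qed
    have gs: "simple_function lebesgue g"
      unfolding g_def by (rule simple_function_compose1[OF Gs])
    have bdd: "bounded (range g)" "bounded (range G)"
      using simple_functionD(1)[OF gs] simple_functionD(1)[OF Gs] by (auto intro: finite_imp_bounded)
    obtain c where c: "\<And>t. norm (g t) \<le> c" "c > 0"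
      using bdd(1) unfolding bounded_pos by auto
    obtain c' where c': "\<And>t. norm (G t) \<le> c'"
      using bdd(2) unfolding bounded_iff by auto
    have gL2: "g \<in> L2_space T" 
      by (rule L2_space_bounded[OF measurable_restrict_space1[OF borel_measurable_simple_function[OF gs]] c(1)])
    have GL2: "G \<in> L2_space T" 
      by (rule L2_space_bounded[OF measurable_restrict_space1[OF borel_measurable_simple_function[OF Gs]] c'])
    define E where "E t = F t - G t" for t
    have EL2: "E \<in> L2_space T" unfolding E_def by (rule L2_space_diff[OF F GL2])
    define w where "w t = \<theta> t *\<^sub>R v t" for t
    have w: "continuous_on {0..T} w" unfolding w_def by (intro continuous_intros v \<theta>)
    define p where "p r = g r \<bullet> w r" for r
    have p_int: "set_integrable lebesgue {0..T} p"
      unfolding p_def by (rule L2_space_inner_integrable[OF gL2 L2_space_continuous[OF w]])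
    have EV: "set_integrable lebesgue {0..T} (\<lambda>t. (norm (E t))\<^sup>2)" "set_integrable lebesgue {0..T} (\<lambda>t. (norm (V t))\<^sup>2)"
      using EL2 V by (auto dest: L2_space_integrable_square)
    have Q0: "0 \<le> Q" unfolding Q_def set_lebesgue_integral_def by (intro Bochner_Integration.integral_nonneg) auto
    define P where "P t = (LINT r:{0..t}|lebesgue. p r)" for t
    define R where "R t = (LINT r:{0..t}|lebesgue. (norm (E r))\<^sup>2)" for t
    have RT: "R T \<le> e\<^sup>2" using GF by (simp add: R_def E_def)
    have sub: "set_integrable lebesgue {a..b} f" if "set_integrable lebesgue {0..T} f" "0 \<le> a" "b \<le> T"
      for a b and f :: "real \<Rightarrow> real"
      using that by (auto intro: set_integrable_subset[OF that(1)])
    have Pdiff: "P b - P a = (LINT r:{a..b}|lebesgue. p r)" if "0 \<le> a" "a \<le> b" "b \<le> T" for a b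
      using set_integral_split[OF sub[OF p_int], of 0 b a] that by (simp add: P_def)
    have Rdiff: "R b - R a = (LINT r:{a..b}|lebesgue. (norm (E r))\<^sup>2)" if "0 \<le> a" "a \<le> b" "b \<le> T" for a b
      using set_integral_split[OF sub[OF EV(1)], of 0 b a] that by (simp add: R_def)
    have \<open>uniformly_continuous_on {0..T} w\<close>
      using w by (intro compact_uniformly_continuous) auto
    \<comment> \<open>As \<open>c\<close> bounds the norm of \<open>g\<close>, a variation of
      \<open>w\<close> below \<open>e / c\<close> costs at most \<open>e\<close> per unit of
      time.\<close>
    moreover have "e / c > 0" using e c by simp
    ultimately obtain d1 where d1: "d1 > 0"
      "\<And>r r'. r \<in> {0..T} \<Longrightarrow> r' \<in> {0..T} \<Longrightarrow> dist r' r < d1 \<Longrightarrow> dist (w r') (w r) < e / c"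
      unfolding uniformly_continuous_on_def by metis
    obtain \<delta> where \<delta>: "\<delta> > 0" and RS:
      "\<And>(t::nat \<Rightarrow> real) n. n > 0 \<Longrightarrow> t 0 = 0 \<Longrightarrow> t n = T \<Longrightarrow>
       (\<And>j. j < n \<Longrightarrow> t j < t (Suc j) \<and> t (Suc j) - t j < \<delta>) \<Longrightarrow>
       \<bar>(\<Sum>j<n. w (t (Suc j)) \<bullet> (M (t (Suc j)) - M (t j))) - I\<bar> < e"
      using has_rs_integral_sequence[OF I e] unfolding w_def by blast
    \<comment> \<open>Mesh below \<open>d\<close> makes an interval that reaches beyond
      \<open>t\<^sub>0\<close> start after \<open>t\<^sub>0 - d\<close>, where \<open>m\<close> is a
      lower bound; \<open>d1\<close> is the modulus for \<open>w\<close>, and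
      \<open>\<delta>\<close> serves the Riemann-Stieltjes sum.\<close>
    define \<eta> where "\<eta> = Min {d, d1, \<delta>}"
    have \<eta>: "\<eta> > 0" "\<eta> \<le> d" "\<eta> \<le> d1" "\<eta> \<le> \<delta>" using d1 \<delta> t\<^sub>0 by (auto simp: \<eta>_def)
    obtain n where n: "T / \<eta> < real n" using reals_Archimedean2 by blast
    have "0 < T / \<eta>" using T \<eta> by simp
    with n have n0: "n > 0" by (metis gr0I less_asym of_nat_0)
    define h where "h = T / real n"
    have h: "h > 0" "real n * h = T" using T n0 by (auto simp: h_def)
    have h\<eta>: "h < \<eta>" using n n0 \<eta> by (simp add: h_def pos_divide_less_eq mult.commute)
    obtain s where s: "0 < s" "s < h" and s_good: "\<And>j. j < n \<Longrightarrow> v (s + real j * h) = \<iota> (V (s + real j * h))"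
      and s_sum: "h * (\<Sum>j<n. (norm (V (s + real j * h)))\<^sup>2) \<le> Q + 1"
      using good_partition[OF T EV(2) _ vV n0 h_def] unfolding Q_def by auto
    \<comment> \<open>The \<open>n\<close> good points with 0 and T added, hence
      \<open>Suc n\<close> intervals: the first has length \<open>s\<close>, the last
      \<open>h - s\<close>, all others \<open>h\<close>. The right end of the last one is T, which
      need not be a good point.\<close>
    define \<tau> where "\<tau> j = (if j = 0 then 0 else if j \<le> n then s + real (j - 1) * h else T)" for j
    have \<tau>Suc: "\<tau> (Suc j) = s + real j * h" if "j < n" for j using that by (simp add: \<tau>_def)
    have \<tau>ends: "\<tau> 0 = 0" "\<tau> (Suc n) = T" by (auto simp: \<tau>_def)
    have \<tau>step: "\<tau> j < \<tau> (Suc j) \<and> \<tau> (Suc j) - \<tau> j \<le> h" if j: "j < Suc n" for j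
    proof -
      consider "j = 0" | i where "j = Suc i" "Suc i < n" | i where "j = Suc i" "n = Suc i"
        using j n0 by (cases j) (auto simp: less_Suc_eq)
      then show ?thesis
      proof cases
        case 1 then show ?thesis using s n0 by (simp add: \<tau>_def)
      next
        case 2 then show ?thesis using h by (simp add: \<tau>_def algebra_simps)
      next
        case 3
        then have "\<tau> j = s + T - h" using h by (simp add: \<tau>_def algebra_simps)
        moreover have "\<tau> (Suc j) = T" using 3 by (simp add: \<tau>_def)
        ultimately show ?thesis using s h by simp
      qed
    qed
    have \<tau>lt: "i < j \<Longrightarrow> j \<le> Suc n \<Longrightarrow> \<tau> i < \<tau> j" for i j
      using sequence_less_upto[of "Suc n" \<tau> i j] \<tau>step by blast
    have \<tau>in: "\<tau> j \<in> {0..T}" if "j \<le> Suc n" for j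
      using \<tau>lt[of 0 j] \<tau>lt[of j "Suc n"] that \<tau>ends T by (cases "j = 0"; cases "j = Suc n") auto
    \<comment> \<open>The last interval contributes 0, so the sum of \<open>q\<close> runs over
      exactly the good points.\<close>
    define q where "q j = (if j < n then (norm (V (\<tau> (Suc j))))\<^sup>2 else 0)" for j
    \<comment> \<open>The elementary square inequality on one interval, weighted with \<theta> at
      the right end. Splitting \<open>F\<close> into \<open>g\<close> and \<open>E\<close>, the
      first part is compared with the integral of \<open>p\<close>, where \<open>w\<close> varies
      little; the second is small in the mean square and is handled by Young's inequality with
      weight \<open>e\<close>.\<close>
    have key: "\<theta> (\<tau> (Suc j)) * (y (\<tau> (Suc j)) - y (\<tau> j)) \<le>
        2 * (P (\<tau> (Suc j)) - P (\<tau> j)) + 2 * e * (\<tau> (Suc j) - \<tau> j)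
        + (R (\<tau> (Suc j)) - R (\<tau> j)) / e + e * h * q j
        + 2 * (w (\<tau> (Suc j)) \<bullet> (M (\<tau> (Suc j)) - M (\<tau> j)))" if j: "j < Suc n" for j
    proof -
      define a b where "a = \<tau> j" and "b = \<tau> (Suc j)"
      have ab: "0 \<le> a" "a < b" "b \<le> T" "b - a \<le> h" "a \<in> {0..T}" "b \<in> {0..T}"
        using \<tau>in[of j] \<tau>in[of "Suc j"] \<tau>step[OF j] j by (auto simp: a_def b_def)
      have gb: "(LINT r:{a..b}|lebesgue. g r \<bullet> w b) \<le> P b - P a + e * (b - a)"
      proof -
        have "(LINT r:{a..b}|lebesgue. g r \<bullet> w b) \<le> (LINT r:{a..b}|lebesgue. p r + e)"
        proof (rule set_integral_mono)
          fix r assume r: "r \<in> {a..b}"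
          have "dist (w b) (w r) < e / c"
            using r ab h\<eta> \<eta> by (intro d1(2)) (auto simp: dist_real_def)
          then have "norm (g r) * norm (w b - w r) \<le> c * (e / c)"
            using c e by (intro mult_mono) (auto simp: dist_norm)
          then have "\<bar>g r \<bullet> (w b - w r)\<bar> \<le> e"
            using Cauchy_Schwarz_ineq2[of "g r" "w b - w r"] c by simp
          then show "g r \<bullet> w b \<le> p r + e"
            unfolding p_def inner_diff_right abs_le_iff by linarith
        next
          show "set_integrable lebesgue {a..b} (\<lambda>r. g r \<bullet> w b)"
            using ab by (intro sub[OF L2_space_inner_integrable[OF gL2 L2_space_const]]) auto
        qed (use ab p_int sub in auto)
        also have "\<dots> = P b - P a + e * (b - a)"
          using ab p_int sub Pdiff by (simp add: set_integral_const)
        finally show ?thesis .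
      qed
      show ?thesis
      proof (cases "j < n")
        case False
        \<comment> \<open>At T the weight vanishes, so the left side is 0 and no representative of
          \<open>v T\<close> in V is asked for; the claim reduces to \<open>gb\<close> with
          \<open>w b = 0\<close>.\<close>
        then have "b = T" using j by (simp add: b_def \<tau>_def)
        then have "w b = 0" "\<theta> b = 0" by (auto simp: w_def \<theta>T)
        moreover have "0 \<le> R b - R a"
          unfolding Rdiff[OF ab(1) less_imp_le[OF ab(2)] ab(3)] set_lebesgue_integral_def
          by (intro Bochner_Integration.integral_nonneg) auto
        then have "0 \<le> (R b - R a) / e" using e by simp
        ultimately show ?thesis
          using gb False by (simp add: q_def a_def[symmetric] b_def[symmetric])
      next
        case True
        have vb: "v b = \<iota> (V b)" using s_good[OF True] \<tau>Suc[OF True] by (simp add: b_def)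
        have 1: "y b - y a \<le> 2 * ((v b - v a) \<bullet> v b)"
          using zero_le_power2[of "norm (v b - v a)"]
          by (simp add: y_def power2_norm_eq_inner inner_diff_left inner_diff_right inner_commute)
        have int1: "set_integrable lebesgue {a..b} (\<lambda>r. g r \<bullet> v b)"
          using ab by (intro sub[OF L2_space_inner_integrable[OF gL2 L2_space_const]]) auto
        have int2: "set_integrable lebesgue {a..b} (\<lambda>r. E r (V b))"
          using ab by (intro sub[OF L2_space_blinfun_apply_integrable[OF EL2 L2_space_const]]) auto
        have "(v b - v a) \<bullet> v b = (LINT r:{a..b}|lebesgue. F r (V b)) + (M b - M a) \<bullet> v b"
          using eq[of a b "V b"] ab unfolding vb[symmetric] by auto
        also have "(LINT r:{a..b}|lebesgue. F r (V b)) = (LINT r:{a..b}|lebesgue. g r \<bullet> v b + E r (V b))"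
          by (simp add: vb gG E_def blinfun.diff_left)
        also have "\<dots> = (LINT r:{a..b}|lebesgue. g r \<bullet> v b) + (LINT r:{a..b}|lebesgue. E r (V b))"
          using int1 int2 by simp
        finally have "\<theta> b * (y b - y a) \<le> \<theta> b * (2 * ((LINT r:{a..b}|lebesgue. g r \<bullet> v b) + (LINT r:{a..b}|lebesgue. E r (V b))
            + (M b - M a) \<bullet> v b))"
          using 1 \<theta>b[OF ab(6)] by (intro mult_left_mono) auto
        also have "\<dots> = 2 * (LINT r:{a..b}|lebesgue. g r \<bullet> w b) + 2 * (\<theta> b * (LINT r:{a..b}|lebesgue. E r (V b)))
            + 2 * (w b \<bullet> (M b - M a))"
          by (simp add: w_def algebra_simps inner_commute)
        also have "\<theta> b * (LINT r:{a..b}|lebesgue. E r (V b)) \<le> (R b - R a) / (2 * e) + e * h * q j / 2"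
        proof -
          have "\<theta> b * (LINT r:{a..b}|lebesgue. E r (V b)) = (LINT r:{a..b}|lebesgue. \<theta> b * E r (V b))" by simp
          also have "\<dots> \<le> (LINT r:{a..b}|lebesgue. (norm (E r))\<^sup>2 / (2 * e) + e * (norm (V b))\<^sup>2 / 2)"
          proof (rule set_integral_mono)
            fix r
            have "\<theta> b * E r (V b) \<le> \<bar>\<theta> b\<bar> * \<bar>E r (V b)\<bar>" by (metis abs_ge_self abs_mult)
            also have "\<dots> \<le> 1 * (norm (E r) * norm (V b))"
              using \<theta>b[OF ab(6)] norm_blinfun[of "E r" "V b"] by (intro mult_mono) auto
            also have "\<dots> \<le> (norm (E r))\<^sup>2 / (2 * e) + e * (norm (V b))\<^sup>2 / 2"
              using young_ineq[OF e] by simp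
            finally show "\<theta> b * E r (V b) \<le> (norm (E r))\<^sup>2 / (2 * e) + e * (norm (V b))\<^sup>2 / 2" .
          qed (use int2 ab sub EV in auto)
          also have "\<dots> = (R b - R a) / (2 * e) + (b - a) * (e * (norm (V b))\<^sup>2 / 2)"
            using ab EV sub by (simp add: set_integral_const Rdiff)
          also have "(b - a) * (e * (norm (V b))\<^sup>2 / 2) \<le> h * (e * (norm (V b))\<^sup>2 / 2)"
            using ab e by (intro mult_right_mono) auto
          also have "\<dots> = e * h * q j / 2" using True by (simp add: q_def b_def)
          finally show ?thesis by simp
        qed
        finally have "\<theta> b * (y b - y a) \<le> 2 * (LINT r:{a..b}|lebesgue. g r \<bullet> w b)
            + 2 * ((R b - R a) / (2 * e) + e * h * q j / 2) + 2 * (w b \<bullet> (M b - M a))"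
          by simp
        moreover have "2 * ((R b - R a) / (2 * e) + e * h * q j / 2) = (R b - R a) / e + e * h * q j"
          using e by (simp add: field_simps)
        moreover have "2 * (LINT r:{a..b}|lebesgue. g r \<bullet> w b) \<le> 2 * (P b - P a) + 2 * e * (b - a)"
          using gb by simp
        ultimately show ?thesis unfolding a_def[symmetric] b_def[symmetric] by linarith
      qed
    qed
    \<comment> \<open>Summation by parts. As \<theta> falls from 1 at 0 to 0 at T, its decrements
      are nonnegative weights of total mass 1; they vanish off the intervals that meet the ramp, and
      on those the left value of \<open>y\<close> is at least \<open>m\<close>.\<close>
    have "m - y 0 \<le> (\<Sum>j<Suc n. \<theta> (\<tau> (Suc j)) * (y (\<tau> (Suc j)) - y (\<tau> j)))"
    proof -
      have "(\<Sum>j<Suc n. \<theta> (\<tau> (Suc j)) * (y (\<tau> (Suc j)) - y (\<tau> j)))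
        = (\<Sum>j<Suc n. (\<theta> (\<tau> j) - \<theta> (\<tau> (Suc j))) * y (\<tau> j))
          + (\<Sum>j<Suc n. \<theta> (\<tau> (Suc j)) * y (\<tau> (Suc j)) - \<theta> (\<tau> j) * y (\<tau> j))"
        unfolding sum.distrib[symmetric] by (intro sum.cong) (auto simp: algebra_simps)
      also have "(\<Sum>j<Suc n. \<theta> (\<tau> (Suc j)) * y (\<tau> (Suc j)) - \<theta> (\<tau> j) * y (\<tau> j)) = - y 0"
        by (subst sum_lessThan_telescope) (simp add: \<tau>ends \<theta>T \<theta>00)
      finally have 1: "(\<Sum>j<Suc n. \<theta> (\<tau> (Suc j)) * (y (\<tau> (Suc j)) - y (\<tau> j)))
        = (\<Sum>j<Suc n. (\<theta> (\<tau> j) - \<theta> (\<tau> (Suc j))) * y (\<tau> j)) - y 0" by simp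
      have "(\<Sum>j<Suc n. (\<theta> (\<tau> j) - \<theta> (\<tau> (Suc j))) * m) \<le> (\<Sum>j<Suc n. (\<theta> (\<tau> j) - \<theta> (\<tau> (Suc j))) * y (\<tau> j))"
      proof (rule sum_mono)
        fix j assume "j \<in> {..<Suc n}"
        then have j: "j < Suc n" by simp
        define a b where "a = \<tau> j" and "b = \<tau> (Suc j)"
        have ab: "0 \<le> a" "a < b" "b \<le> T" "b - a \<le> h" "a \<in> {0..T}" "b \<in> {0..T}"
          using \<tau>in[of j] \<tau>in[of "Suc j"] \<tau>step[OF j] j by (auto simp: a_def b_def)
        show "(\<theta> (\<tau> j) - \<theta> (\<tau> (Suc j))) * m \<le> (\<theta> (\<tau> j) - \<theta> (\<tau> (Suc j))) * y (\<tau> j)"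
        proof (cases "b \<le> t\<^sub>0 \<or> a \<ge> t\<^sub>0 + d")
          case True
          then have "\<theta> a = \<theta> b" using \<theta>1[of a] \<theta>1[of b] \<theta>0[of a] \<theta>0[of b] ab by auto
          then show ?thesis by (simp add: a_def b_def)
        next
          case False
          then have "m \<le> y a" using m[of a] ab h\<eta> \<eta> by (auto simp: y_def)
          moreover have "\<theta> b \<le> \<theta> a" using ab by (intro \<theta>(2)) auto
          ultimately show ?thesis unfolding a_def b_def by (intro mult_left_mono) auto
        qed
      qed
      also have "(\<Sum>j<Suc n. (\<theta> (\<tau> j) - \<theta> (\<tau> (Suc j))) * m) = m"
        unfolding sum_distrib_right[symmetric]
        by (subst sum_lessThan_telescope') (simp add: \<tau>ends \<theta>T \<theta>00)
      finally show ?thesis using 1 by simp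
    qed
    also have "\<dots> \<le> (\<Sum>j<Suc n. 2 * (P (\<tau> (Suc j)) - P (\<tau> j)) + 2 * e * (\<tau> (Suc j) - \<tau> j)
        + (R (\<tau> (Suc j)) - R (\<tau> j)) / e + e * h * q j
        + 2 * (w (\<tau> (Suc j)) \<bullet> (M (\<tau> (Suc j)) - M (\<tau> j))))"
      by (intro sum_mono key) auto
    also have "\<dots> = 2 * P T + 2 * e * T + R T / e + e * (h * (\<Sum>j<Suc n. q j))
        + 2 * (\<Sum>j<Suc n. w (\<tau> (Suc j)) \<bullet> (M (\<tau> (Suc j)) - M (\<tau> j)))"
    proof -
      have tel: "(\<Sum>j<Suc n. f (\<tau> (Suc j)) - f (\<tau> j)) = f T - f 0" for f :: "real \<Rightarrow> real"
        using sum_lessThan_telescope[of "\<lambda>j. f (\<tau> j)" "Suc n"] by (simp only: \<tau>ends)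
      have "P 0 = 0" "R 0 = 0" by (simp_all add: P_def R_def)
      then show ?thesis
        unfolding sum.distrib sum_distrib_left[symmetric] sum_divide_distrib[symmetric]
          tel[of P] tel[of R] tel[of "\<lambda>x. x"]
        by (simp add: mult.assoc)
    qed
    also have "R T / e \<le> e" using RT e by (simp add: pos_divide_le_eq power2_eq_square)
    also have "e * (h * (\<Sum>j<Suc n. q j)) \<le> e * (Q + 1)"
      using s_sum e by (intro mult_left_mono) (auto simp: q_def \<tau>Suc)
    also have "(\<Sum>j<Suc n. w (\<tau> (Suc j)) \<bullet> (M (\<tau> (Suc j)) - M (\<tau> j))) \<le> I + e"
      using RS[of "Suc n" \<tau>] \<tau>ends \<tau>step h\<eta> \<eta>(4) by fastforce
    \<comment> \<open>Here \<open>g\<close> is replaced by \<open>F\<close> again. For almost every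
      \<open>r\<close>, \<open>w r\<close> is the image of \<open>\<theta> r *\<^sub>R V r\<close>,
      so the difference is \<open>E\<close> applied to that vector, and the same Young inequality
      bounds it.\<close>
    also have "P T \<le> D + e * (Q + 1) / 2"
    proof -
      have \<theta>V: "(\<lambda>r. \<theta> r *\<^sub>R V r) \<in> L2_space T"
        using \<theta>b by (intro L2_space_cutoff V \<theta>) auto
      have GV: "set_integrable lebesgue {0..T} (\<lambda>r. G r (\<theta> r *\<^sub>R V r))"
        "set_integrable lebesgue {0..T} (\<lambda>r. F r (\<theta> r *\<^sub>R V r))"
        by (intro L2_space_blinfun_apply_integrable GL2 F \<theta>V)+
      have "P T \<le> (LINT r:{0..T}|lebesgue. F r (\<theta> r *\<^sub>R V r) + ((norm (E r))\<^sup>2 / (2 * e) + e * (norm (V r))\<^sup>2 / 2))"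
        unfolding P_def
      proof (rule set_integral_mono_AE)
        have "p r \<le> F r (\<theta> r *\<^sub>R V r) + ((norm (E r))\<^sup>2 / (2 * e) + e * (norm (V r))\<^sup>2 / 2)"
          if r: "r \<in> {0..T}" "v r = \<iota> (V r)" for r
        proof -
          have "p r = F r (\<theta> r *\<^sub>R V r) + E r (- \<theta> r *\<^sub>R V r)"
            using gG[of r "V r"] r(2)
            by (simp add: p_def w_def E_def blinfun.diff_left blinfun.scaleR_right blinfun.minus_right right_diff_distrib)
          moreover have "E r (- \<theta> r *\<^sub>R V r) \<le> norm (E r) * norm (- \<theta> r *\<^sub>R V r)"
            using norm_blinfun[of "E r" "- \<theta> r *\<^sub>R V r"] by simp
          moreover have "norm (- \<theta> r *\<^sub>R V r) \<le> norm (V r)"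
            using \<theta>b[OF r(1)] by (simp add: mult_left_le_one_le)
          then have "norm (E r) * norm (- \<theta> r *\<^sub>R V r) \<le> norm (E r) * norm (V r)"
            by (intro mult_left_mono) auto
          moreover have "norm (E r) * norm (V r) \<le> (norm (E r))\<^sup>2 / (2 * e) + e * (norm (V r))\<^sup>2 / 2"
            using young_ineq[OF e] by simp
          ultimately show ?thesis by linarith
        qed
        then show "AE r\<in>{0..T} in lebesgue. p r \<le> F r (\<theta> r *\<^sub>R V r) + ((norm (E r))\<^sup>2 / (2 * e) + e * (norm (V r))\<^sup>2 / 2)"
          using vV by (auto elim!: eventually_mono)
      qed (use p_int GV EV in auto)
      also have "\<dots> = (LINT r:{0..T}|lebesgue. F r (\<theta> r *\<^sub>R V r)) + (R T / (2 * e) + e * Q / 2)"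
        using GV EV by (simp add: R_def Q_def)
      also have "R T / (2 * e) \<le> e / 2" using RT e by (simp add: field_simps power2_eq_square)
      also have "(LINT r:{0..T}|lebesgue. F r (\<theta> r *\<^sub>R V r)) = D"
        by (simp add: D_def blinfun.scaleR_right)
      finally show ?thesis by (simp add: algebra_simps add_divide_distrib)
    qed
    finally show ?thesis by (simp add: algebra_simps add_divide_distrib)
  qed
  have "m - y 0 \<le> 2 * D + 2 * I"
  proof (rule field_le_epsilon)
    fix e :: real assume e: "e > 0"
    have "Q \<ge> 0" unfolding Q_def set_lebesgue_integral_def by (intro Bochner_Integration.integral_nonneg) auto
    then have K: "2 * T + 2 * Q + 5 > 0" using T by linarith
    from bound[of "e / (2 * T + 2 * Q + 5)"] e K show "m - y 0 \<le> 2 * D + 2 * I + e" by simp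
  qed
  then show ?thesis by (simp add: y_def D_def)
qed

section \<open>Solutions of the reflection problem\<close>

lemma set_integral_bounded_linear:
  fixes g :: "'a \<Rightarrow> 'b::{banach, second_countable_topology}"
    and P :: "'b \<Rightarrow> 'c::{banach, second_countable_topology}"
  assumes "bounded_linear P" and "set_integrable M A g"
  shows "P (LINT r:A|M. g r) = (LINT r:A|M. P (g r))"
proof -
  interpret P: bounded_linear P by fact
  have "(LINT r|M. P (indicator A r *\<^sub>R g r)) = P (LINT r|M. indicator A r *\<^sub>R g r)"
    using assms unfolding set_integrable_def by (intro integral_bounded_linear)
  then show ?thesis by (simp add: set_lebesgue_integral_def P.scaleR)
qed

lemma set_integral_blinfun_apply:
  fixes g :: "'a \<Rightarrow> 'v::{real_inner, banach, second_countable_topology} \<Rightarrow>\<^sub>L real"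
  assumes "set_integrable M A g"
  shows "(LINT r:A|M. g r) x = (LINT r:A|M. g r x)"
  using blinfun.bounded_linear_left assms by (rule set_integral_bounded_linear)

lemma set_integral_inner_left:
  fixes g :: "'a \<Rightarrow> 'h::{real_inner, banach, second_countable_topology}"
  assumes "set_integrable M A g"
  shows "(LINT r:A|M. g r) \<bullet> x = (LINT r:A|M. g r \<bullet> x)"
  using bounded_linear_inner_left assms by (rule set_integral_bounded_linear)

lemma bounded_linear_to_dual: "bounded_linear (to_dual \<iota>)"
proof -
  have "to_dual \<iota> = (\<lambda>h. blinfun_inner_right h o\<^sub>L \<iota>)" by (simp add: to_dual_def fun_eq_iff)
  moreover have "bounded_linear (\<lambda>h. blinfun_inner_right h o\<^sub>L \<iota>)"
    by (rule bounded_linear_compose[OF bounded_bilinear.bounded_linear_left[OF bounded_bilinear_blinfun_compose]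
          bounded_linear_blinfun_inner_right])
  ultimately show ?thesis by simp
qed

lemma L2_space_to_dual:
  fixes g :: "real \<Rightarrow> 'h::{real_inner, banach, second_countable_topology}"
    and \<iota> :: "'v::{real_inner, banach, second_countable_topology} \<Rightarrow>\<^sub>L 'h"
  assumes "g \<in> L2_space T"
  shows "(\<lambda>r. to_dual \<iota> (g r)) \<in> L2_space T"
proof (rule L2_space_bound[OF _ L2_space_scaleR[OF assms, of "norm \<iota>"]])
  show "(\<lambda>r. to_dual \<iota> (g r)) \<in> borel_measurable (lebesgue_on {0..T})"
    using L2_space_measurable[OF assms]
    by (rule borel_measurable_continuous_on[OF linear_continuous_on[OF bounded_linear_to_dual]])
  show "AE t in lebesgue. t \<in> {0..T} \<longrightarrow> norm (to_dual \<iota> (g t)) \<le> norm (norm \<iota> *\<^sub>R g t)"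
  proof (intro AE_I2 impI norm_blinfun_bound)
    fix t x
    have "\<bar>g t \<bullet> \<iota> x\<bar> \<le> norm (g t) * norm (\<iota> x)" by (rule Cauchy_Schwarz_ineq2)
    also have "\<dots> \<le> norm (g t) * (norm \<iota> * norm x)" by (intro mult_left_mono norm_blinfun) auto
    finally show "norm (to_dual \<iota> (g t) x) \<le> norm (norm \<iota> *\<^sub>R g t) * norm x"
      by (simp add: to_dual_apply ac_simps)
  qed simp
qed

text \<open>A continuous substitute for the indicator of the times up to \<open>t\<^sub>0\<close>,
  linear on the ramp of length \<open>d\<close>. Continuity is forced by the test paths of the
  variational inequality.\<close>

definition cutoff :: "real \<Rightarrow> real \<Rightarrow> real \<Rightarrow> real" where
  "cutoff t\<^sub>0 d t = max 0 (min 1 ((t\<^sub>0 + d - t) / d))"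

lemma cutoff_continuous: "d > 0 \<Longrightarrow> continuous_on A (cutoff t\<^sub>0 d)"
  unfolding cutoff_def by (intro continuous_intros) auto

lemma cutoff_antimono: "d > 0 \<Longrightarrow> s \<le> t \<Longrightarrow> cutoff t\<^sub>0 d t \<le> cutoff t\<^sub>0 d s"
  unfolding cutoff_def by (intro max.mono min.mono divide_right_mono) auto

lemma cutoff_eq_1: "d > 0 \<Longrightarrow> t \<le> t\<^sub>0 \<Longrightarrow> cutoff t\<^sub>0 d t = 1"
  by (simp add: cutoff_def)

lemma cutoff_eq_0: "d > 0 \<Longrightarrow> t\<^sub>0 + d \<le> t \<Longrightarrow> cutoff t\<^sub>0 d t = 0"
  by (simp add: cutoff_def divide_le_0_iff)

lemma cutoff_bounds: "0 \<le> cutoff t\<^sub>0 d t" "cutoff t\<^sub>0 d t \<le> 1"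
  by (simp_all add: cutoff_def)

text \<open>The operator enters through the inner product of \<open>'v\<close> and the two
  densities. Density of V in H serves to approximate the coefficient of the control by functions
  with values in V; density of H in the dual of V serves to approximate the drift in the energy
  inequality.\<close>

locale reflection_data =
  fixes \<iota> :: "'v::{real_inner, banach, second_countable_topology} \<Rightarrow>\<^sub>L 'h::{real_inner, banach, second_countable_topology}"
    and T :: real and f :: "'h \<Rightarrow> 'v \<Rightarrow>\<^sub>L real" and \<sigma> :: "'h \<Rightarrow> 'h"
    and B :: "'v \<Rightarrow> 'v \<Rightarrow> 'v \<Rightarrow>\<^sub>L real" and u\<^sub>0 :: 'h and C :: real
  assumes T: "T > 0"
    and dense_V: "closure (range (blinfun_apply \<iota>)) = UNIV"
    and dense_H: "closure (range (to_dual \<iota>)) = UNIV"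
    and inj: "inj (blinfun_apply \<iota>)"
    and C_nonneg: "0 \<le> C"
    and f_lipschitz: "\<And>x y. norm (f x - f y) \<le> C * norm (x - y)"
    and \<sigma>_lipschitz: "\<And>x y. norm (\<sigma> x - \<sigma> y) \<le> C * norm (x - y)"
    and B_bilinear: "bilinear B"
    and B_antisym: "\<And>x y z. B x y z = - B x z y"
    and B_bound: "\<And>x y z. \<bar>B x y z\<bar> \<le>
        2 * sqrt (norm x) * sqrt (norm (\<iota> x)) * sqrt (norm z) * sqrt (norm (\<iota> z)) * norm y"
    and u\<^sub>0: "norm u\<^sub>0 \<le> 1"
begin

abbreviation V_of :: "(real \<Rightarrow> 'h) \<Rightarrow> real \<Rightarrow> 'v" where
  "V_of u t \<equiv> V_part \<iota> (u t)"

definition drift :: "(real \<Rightarrow> real) \<Rightarrow> (real \<Rightarrow> 'h) \<Rightarrow> real \<Rightarrow> 'v \<Rightarrow>\<^sub>L real" where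
  "drift k u r = - dual_op (V_of u r) + f (u r) + B (V_of u r) (V_of u r) + to_dual \<iota> (k r *\<^sub>R \<sigma> (u r))"

definition f_sup :: real where "f_sup = norm (f 0) + C"
definition \<sigma>_sup :: real where "\<sigma>_sup = norm (\<sigma> 0) + C"

lemma f_sup: "norm x \<le> 1 \<Longrightarrow> norm (f x) \<le> f_sup" 
  and \<sigma>_sup: "norm x \<le> 1 \<Longrightarrow> norm (\<sigma> x) \<le> \<sigma>_sup"
  and f_sup_nonneg: "0 \<le> f_sup" and \<sigma>_sup_nonneg: "0 \<le> \<sigma>_sup"
proof -
  assume x: "norm x \<le> 1"
  then have "C * norm x \<le> C" using C_nonneg mult_left_mono[of "norm x" 1 C] by simp
  then show "norm (f x) \<le> f_sup" "norm (\<sigma> x) \<le> \<sigma>_sup"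
    using f_lipschitz[of x 0] \<sigma>_lipschitz[of x 0] norm_triangle_sub[of "f x" "f 0"] norm_triangle_sub[of "\<sigma> x" "\<sigma> 0"]
    by (auto simp: f_sup_def \<sigma>_sup_def)
qed (use C_nonneg in \<open>auto simp: f_sup_def \<sigma>_sup_def\<close>)

lemma continuous_f: "continuous_on A f" and continuous_\<sigma>: "continuous_on A \<sigma>"
proof -
  have "C-lipschitz_on A f" "C-lipschitz_on A \<sigma>"
    using f_lipschitz \<sigma>_lipschitz C_nonneg by (auto simp: lipschitz_on_def dist_norm)
  then show "continuous_on A f" "continuous_on A \<sigma>" by (auto intro: lipschitz_on_continuous_on)
qed

text \<open>Antisymmetry moves the test vector into the middle slot, where the bound is linear in
  its V norm, and the two outer slots then both hold \<open>x\<close>.\<close>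

lemma B_same_norm: "norm (B x x) \<le> 2 * norm x * norm (\<iota> x)"
proof (rule norm_blinfun_bound)
  fix z
  have "\<bar>B x x z\<bar> = \<bar>B x z x\<bar>" by (simp add: B_antisym[of x x z])
  also have "\<dots> \<le> 2 * (sqrt (norm x) * sqrt (norm x)) * (sqrt (norm (\<iota> x)) * sqrt (norm (\<iota> x))) * norm z"
    using B_bound[of x z x] by (simp only: ac_simps)
  finally show "norm (B x x z) \<le> 2 * norm x * norm (\<iota> x) * norm z" by simp
qed simp

lemma B_cancel: "B x y y = 0"
  using B_antisym[of x y y] by simp

text \<open>With \<open>w = x - y\<close>, the part \<open>B x w\<close> vanishes on
  \<open>w\<close> and what remains is \<open>B w y w\<close>. With \<open>w\<close> in both outer
  slots the bound has only one power of its V norm, so that Young's inequality can absorb it into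
  the dissipation.\<close>

lemma B_difference: "(B x x - B y y) (x - y) \<le> 2 * norm (x - y) * norm (\<iota> x - \<iota> y) * norm y"
proof -
  define w where "w = x - y"
  have x: "x = y + w" by (simp add: w_def)
  have "B x x = B x y + B x w" "B x y = B y y + B w y"
    using B_bilinear unfolding x by (auto simp: bilinear_ladd bilinear_radd)
  then have "(B x x - B y y) w = B w y w"
    by (simp add: blinfun.diff_left blinfun.add_left B_cancel)
  also have "\<dots> \<le> 2 * (sqrt (norm w) * sqrt (norm w)) * (sqrt (norm (\<iota> w)) * sqrt (norm (\<iota> w))) * norm y"
    using B_bound[of w y w] by (simp only: ac_simps)
  finally show ?thesis by (simp add: w_def blinfun.diff_right)
qed


text \<open>Estimating the H norms in the bound by V norms gives boundedness on V, hence joint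
  continuity, which yields measurability of the convective term along a path.\<close>

lemma B_bounded_bilinear: "bounded_bilinear B"
proof
  show "B (x + x') y = B x y + B x' y" "B x (y + y') = B x y + B x y'"
    "B (r *\<^sub>R x) y = r *\<^sub>R B x y" "B x (r *\<^sub>R y) = r *\<^sub>R B x y" for x x' y y' r
    using B_bilinear by (auto simp: bilinear_ladd bilinear_radd bilinear_lmul bilinear_rmul)
  have "norm (B x y) \<le> norm x * norm y * (2 * norm \<iota>)" for x y
  proof (rule norm_blinfun_bound)
    fix z
    have s: "sqrt (norm x) * sqrt (norm (\<iota> x)) \<le> sqrt (norm \<iota>) * norm x" for x
    proof -
      have "sqrt (norm (\<iota> x)) \<le> sqrt (norm \<iota>) * sqrt (norm x)"
        using norm_blinfun[of \<iota> x] by (simp add: real_sqrt_mult[symmetric])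
      then have "sqrt (norm x) * sqrt (norm (\<iota> x)) \<le> sqrt (norm x) * (sqrt (norm \<iota>) * sqrt (norm x))"
        by (intro mult_left_mono) auto
      also have "\<dots> = sqrt (norm \<iota>) * (sqrt (norm x) * sqrt (norm x))" by (simp only: ac_simps)
      finally show ?thesis by simp
    qed
    have "\<bar>B x y z\<bar> \<le> 2 * (sqrt (norm x) * sqrt (norm (\<iota> x))) * (sqrt (norm z) * sqrt (norm (\<iota> z))) * norm y"
      using B_bound[of x y z] by (simp only: ac_simps)
    also have "\<dots> \<le> 2 * (sqrt (norm \<iota>) * norm x) * (sqrt (norm \<iota>) * norm z) * norm y"
      by (intro mult_right_mono mult_mono s) auto
    also have "\<dots> = norm x * norm y * (2 * (sqrt (norm \<iota>) * sqrt (norm \<iota>))) * norm z"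
      by (simp only: ac_simps)
    finally show "norm (B x y z) \<le> norm x * norm y * (2 * norm \<iota>) * norm z" by simp
  qed simp
  then show "\<exists>K. \<forall>x y. norm (B x y) \<le> norm x * norm y * K" by blast
qed

section \<open>Estimates for a single solution\<close>

context
  fixes k :: "real \<Rightarrow> real" and u L :: "real \<Rightarrow> 'h"
  assumes sol: "reflection_solution \<iota> T f \<sigma> B u\<^sub>0 k u L"
begin

lemma sol_continuous: "continuous_on {0..T} u"
  using sol by (simp add: reflection_solution_def XT_space_def)

lemma sol_norm_le_1: "t \<in> {0..T} \<Longrightarrow> norm (u t) \<le> 1"
  using sol by (simp add: reflection_solution_def)

lemma sol_V_L2: "V_of u \<in> L2_space T"
  using sol by (simp add: reflection_solution_def XT_space_def)

lemma sol_V_eq: "AE t in lebesgue. t \<in> {0..T} \<longrightarrow> u t = \<iota> (V_of u t)"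
proof -
  have "AE t in lebesgue. t \<in> {0..T} \<longrightarrow> u t \<in> range (blinfun_apply \<iota>)"
    using sol by (simp add: reflection_solution_def XT_space_def)
  then show ?thesis
    by eventually_elim (auto simp: V_part_def f_inv_into_f)
qed

lemma sol_terms_L2:
  assumes "k \<in> L2_space T"
  shows "(\<lambda>r. dual_op (V_of u r)) \<in> L2_space T" and "(\<lambda>r. f (u r)) \<in> L2_space T"
    and "(\<lambda>r. B (V_of u r) (V_of u r)) \<in> L2_space T" and "(\<lambda>r. k r *\<^sub>R \<sigma> (u r)) \<in> L2_space T"
proof -
  note [measurable] = L2_space_measurable[OF sol_V_L2] L2_space_measurable[OF assms]
  have m: "(\<lambda>r. dual_op (V_of u r)) \<in> borel_measurable (lebesgue_on {0..T})"
    unfolding dual_op_def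
    by (rule borel_measurable_continuous_on[OF linear_continuous_on[OF bounded_linear_blinfun_inner_right]]) measurable
  show "(\<lambda>r. dual_op (V_of u r)) \<in> L2_space T"
  proof (rule L2_space_bound[OF m sol_V_L2])
    show "AE t in lebesgue. t \<in> {0..T} \<longrightarrow> norm (dual_op (V_of u t)) \<le> norm (V_of u t)"
      unfolding dual_op_def by (intro AE_I2 impI norm_blinfun_bound) (auto simp: Cauchy_Schwarz_ineq2)
  qed
  have cf: "continuous_on {0..T} (\<lambda>r. f (u r))" and cs: "continuous_on {0..T} (\<lambda>r. \<sigma> (u r))"
    using continuous_on_compose2[OF continuous_f sol_continuous] continuous_on_compose2[OF continuous_\<sigma> sol_continuous]
    by auto
  show "(\<lambda>r. f (u r)) \<in> L2_space T" by (rule L2_space_continuous[OF cf])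
  have mB: "(\<lambda>r. B (V_of u r) (V_of u r)) \<in> borel_measurable (lebesgue_on {0..T})"
    by (rule borel_measurable_continuous_Pair[where H = B])
      (auto intro!: bounded_bilinear.continuous_on[OF B_bounded_bilinear] continuous_intros)
  \<comment> \<open>On the unit ball of H the quadratic bound becomes linear in the V norm. This
    makes the convective term square integrable in the dual of V, as the energy inequality requires
    of the drift.\<close>
  show "(\<lambda>r. B (V_of u r) (V_of u r)) \<in> L2_space T"
  proof (rule L2_space_bound[OF mB L2_space_scaleR[OF sol_V_L2, of 2]])
    show "AE t in lebesgue. t \<in> {0..T} \<longrightarrow> norm (B (V_of u t) (V_of u t)) \<le> norm (2 *\<^sub>R V_of u t)"
      using sol_V_eq
    proof eventually_elim
      case (elim t)
      show ?case
      proof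
        assume t: "t \<in> {0..T}"
        then have "norm (\<iota> (V_of u t)) \<le> 1" using elim sol_norm_le_1 by metis
        then have "2 * norm (V_of u t) * norm (\<iota> (V_of u t)) \<le> 2 * norm (V_of u t) * 1"
          by (intro mult_left_mono) auto
        then show "norm (B (V_of u t) (V_of u t)) \<le> norm (2 *\<^sub>R V_of u t)"
          using B_same_norm[of "V_of u t"] by simp
      qed
    qed
  qed
  have ms: "(\<lambda>r. k r *\<^sub>R \<sigma> (u r)) \<in> borel_measurable (lebesgue_on {0..T})"
    using continuous_imp_measurable_lebesgue_on[OF cs] by measurable
  show "(\<lambda>r. k r *\<^sub>R \<sigma> (u r)) \<in> L2_space T"
  proof (rule L2_space_bound[OF ms L2_space_scaleR[OF assms, of \<sigma>_sup]])
    show "AE t in lebesgue. t \<in> {0..T} \<longrightarrow> norm (k t *\<^sub>R \<sigma> (u t)) \<le> norm (\<sigma>_sup *\<^sub>R k t)"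
    proof (intro AE_I2 impI)
      fix t assume "t \<in> {0..T}"
      then have "\<bar>k t\<bar> * norm (\<sigma> (u t)) \<le> \<bar>k t\<bar> * \<sigma>_sup"
        by (intro mult_left_mono \<sigma>_sup sol_norm_le_1) auto
      then show "norm (k t *\<^sub>R \<sigma> (u t)) \<le> norm (\<sigma>_sup *\<^sub>R k t)"
        using \<sigma>_sup_nonneg by (simp add: mult.commute)
    qed
  qed
qed

lemma drift_L2:
  assumes "k \<in> L2_space T"
  shows "drift k u \<in> L2_space T"
proof -
  have "(\<lambda>r. - dual_op (V_of u r)) \<in> L2_space T"
    using L2_space_scaleR[OF sol_terms_L2(1)[OF assms], of "-1"] by simp
  then have "(\<lambda>r. drift k u r) \<in> L2_space T"
    unfolding drift_def by (intro L2_space_add L2_space_to_dual sol_terms_L2 assms)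
  then show ?thesis by simp
qed

lemma sol_eq:
  "t \<in> {0..T} \<Longrightarrow> to_dual \<iota> (u t)
          + (LINT s:{0..t}|lebesgue. dual_op (V_of u s))
          - (LINT s:{0..t}|lebesgue. f (u s))
          - (LINT s:{0..t}|lebesgue. B (V_of u s) (V_of u s))
        = to_dual \<iota> (u\<^sub>0 + (LINT s:{0..t}|lebesgue. k s *\<^sub>R \<sigma> (u s)) + L t)"
  using sol by (simp add: reflection_solution_def)

text \<open>The equation tested with \<open>x\<close> and differenced in time, in the form in which
  \<open>energy_inequality\<close> takes it, with \<open>L\<close> as the integrator.\<close>

lemma sol_drift_eq:
  assumes k: "k \<in> L2_space T" and st: "0 \<le> s" "s \<le> t" "t \<le> T"
  shows "(u t - u s) \<bullet> \<iota> x = (LINT r:{s..t}|lebesgue. drift k u r x) + (L t - L s) \<bullet> \<iota> x"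
proof -
  have drift_int: "set_integrable lebesgue {0..T} (\<lambda>r. drift k u r x)"
    by (intro L2_space_blinfun_apply_integrable drift_L2 k L2_space_const)
  have from_0: "u t \<bullet> \<iota> x = u\<^sub>0 \<bullet> \<iota> x + (LINT r:{0..t}|lebesgue. drift k u r x) + L t \<bullet> \<iota> x"
    if t: "t \<in> {0..T}" for t
  proof -
    note int = sol_terms_L2[OF k, THEN L2_space_integrable, THEN set_integrable_subset, of "{0..t}"]
    have i: "set_integrable lebesgue {0..t} (\<lambda>r. dual_op (V_of u r))" "set_integrable lebesgue {0..t} (\<lambda>r. f (u r))"
      "set_integrable lebesgue {0..t} (\<lambda>r. B (V_of u r) (V_of u r))" "set_integrable lebesgue {0..t} (\<lambda>r. k r *\<^sub>R \<sigma> (u r))"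
      using int t by auto
    have ix_T: "set_integrable lebesgue {0..T} (\<lambda>r. dual_op (V_of u r) x)" "set_integrable lebesgue {0..T} (\<lambda>r. f (u r) x)"
      "set_integrable lebesgue {0..T} (\<lambda>r. B (V_of u r) (V_of u r) x)"
      "set_integrable lebesgue {0..T} (\<lambda>r. (k r *\<^sub>R \<sigma> (u r)) \<bullet> \<iota> x)"
      by (intro L2_space_blinfun_apply_integrable L2_space_inner_integrable sol_terms_L2[OF k] L2_space_const)+
    have ix: "set_integrable lebesgue {0..t} (\<lambda>r. dual_op (V_of u r) x)" "set_integrable lebesgue {0..t} (\<lambda>r. f (u r) x)"
      "set_integrable lebesgue {0..t} (\<lambda>r. B (V_of u r) (V_of u r) x)"
      "set_integrable lebesgue {0..t} (\<lambda>r. (k r *\<^sub>R \<sigma> (u r)) \<bullet> \<iota> x)"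
      using ix_T[THEN set_integrable_subset, of "{0..t}"] t by (auto simp del: inner_scaleR_left)
    from arg_cong[OF sol_eq[OF t], of "\<lambda>F. blinfun_apply F x"]
    have "u t \<bullet> \<iota> x + (LINT r:{0..t}|lebesgue. dual_op (V_of u r) x) - (LINT r:{0..t}|lebesgue. f (u r) x)
        - (LINT r:{0..t}|lebesgue. B (V_of u r) (V_of u r) x)
      = u\<^sub>0 \<bullet> \<iota> x + (LINT r:{0..t}|lebesgue. (k r *\<^sub>R \<sigma> (u r)) \<bullet> \<iota> x) + L t \<bullet> \<iota> x"
      by (simp add: blinfun.add_left blinfun.diff_left to_dual_apply set_integral_blinfun_apply[OF i(1)]
          set_integral_blinfun_apply[OF i(2)] set_integral_blinfun_apply[OF i(3)] inner_add_left
          set_integral_inner_left[OF i(4)] del: inner_scaleR_left)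
    moreover have "(LINT r:{0..t}|lebesgue. drift k u r x) = - (LINT r:{0..t}|lebesgue. dual_op (V_of u r) x)
      + (LINT r:{0..t}|lebesgue. f (u r) x) + (LINT r:{0..t}|lebesgue. B (V_of u r) (V_of u r) x)
      + (LINT r:{0..t}|lebesgue. (k r *\<^sub>R \<sigma> (u r)) \<bullet> \<iota> x)"
    proof -
      have "(LINT r:{0..t}|lebesgue. drift k u r x) = (LINT r:{0..t}|lebesgue. f (u r) x
          + B (V_of u r) (V_of u r) x + (k r *\<^sub>R \<sigma> (u r)) \<bullet> \<iota> x - dual_op (V_of u r) x)"
        by (simp add: drift_def blinfun.add_left blinfun.diff_left blinfun.minus_left to_dual_apply algebra_simps)
      also have "\<dots> = (LINT r:{0..t}|lebesgue. f (u r) x) + (LINT r:{0..t}|lebesgue. B (V_of u r) (V_of u r) x)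
        + (LINT r:{0..t}|lebesgue. (k r *\<^sub>R \<sigma> (u r)) \<bullet> \<iota> x) - (LINT r:{0..t}|lebesgue. dual_op (V_of u r) x)"
        using ix by (simp del: inner_scaleR_left)
      finally show ?thesis by simp
    qed
    ultimately show ?thesis by linarith
  qed
  have "set_integrable lebesgue {0..t} (\<lambda>r. drift k u r x)"
    using st by (intro set_integrable_subset[OF drift_int]) auto
  then have "(LINT r:{0..t}|lebesgue. drift k u r x)
    = (LINT r:{0..s}|lebesgue. drift k u r x) + (LINT r:{s..t}|lebesgue. drift k u r x)"
    using st by (intro set_integral_split)
  with from_0[of s] from_0[of t] st show ?thesis by (simp add: inner_diff_left)
qed

text \<open>At time 0 the equation holds in the dual of V; it passes to H because vectors of V
  separate the points of H by density.\<close>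

lemma sol_initial: "u 0 = u\<^sub>0"
proof -
  have "L 0 = 0" using sol by (simp add: reflection_solution_def)
  have "to_dual \<iota> (u 0) = to_dual \<iota> u\<^sub>0"
    using sol_eq[of 0] T \<open>L 0 = 0\<close> by simp
  then have "(u 0 - u\<^sub>0) \<bullet> \<iota> x = 0" for x
    by (metis inner_diff_left right_minus_eq to_dual_apply)
  then have "range (blinfun_apply \<iota>) \<subseteq> {y. (u 0 - u\<^sub>0) \<bullet> y = 0}" by auto
  moreover have "closed {y. (u 0 - u\<^sub>0) \<bullet> y = 0}"
    by (intro closed_Collect_eq continuous_intros)
  ultimately have "closure (range (blinfun_apply \<iota>)) \<subseteq> {y. (u 0 - u\<^sub>0) \<bullet> y = 0}"
    by (rule closure_minimal)
  then have "u 0 - u\<^sub>0 \<in> {y. (u 0 - u\<^sub>0) \<bullet> y = 0}" unfolding dense_V by (rule subsetD) simp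
  then show ?thesis by simp
qed

lemma sol_variational:
  assumes "continuous_on {0..T} \<phi>" and "\<And>t. t \<in> {0..T} \<Longrightarrow> norm (\<phi> t) \<le> 1"
  obtains I where "0 \<le> I" and "has_rs_integral (\<lambda>t. \<phi> t - u t) L 0 T I"
  using sol assms unfolding reflection_solution_def by (metis mem_cball_0)

text \<open>The energy inequality for the solution itself, with lower bound \<open>m = 0\<close>,
  limits how negative the integral can be. In the bound, 1 is the initial energy, the
  \<open>f_sup\<close> term is the forcing after absorption into the dissipation, and the last one
  is the control term with the product of \<open>\<bar>k r\<bar>\<close> and 1 split by Young's
  inequality.\<close>

lemma sol_cutoff_integral:
  assumes k: "k \<in> L2_space T" and N: "(LINT t:{0..T}|lebesgue. (k t)\<^sup>2) \<le> N"
    and t\<^sub>0: "0 \<le> t\<^sub>0" "d > 0" "t\<^sub>0 + d \<le> T"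
  obtains I where "has_rs_integral (\<lambda>t. cutoff t\<^sub>0 d t *\<^sub>R u t) L 0 T I"
    and "- 2 * I \<le> 1 + T * f_sup\<^sup>2 + \<sigma>_sup * (T + N)"
proof -
  define \<theta> where "\<theta> = cutoff t\<^sub>0 d"
  have \<theta>: "continuous_on {0..T} \<theta>" "\<And>t. 0 \<le> \<theta> t" "\<And>t. \<theta> t \<le> 1"
    using t\<^sub>0 by (auto simp: \<theta>_def cutoff_continuous cutoff_bounds)
  \<comment> \<open>Shrinking the solution towards 0 stays in the ball, so this path is admissible;
    its difference from \<open>u\<close> is \<open>- \<theta> t *\<^sub>R u t\<close>, which
    supplies the existence of the wanted integral.\<close>
  have "norm ((1 - \<theta> t) *\<^sub>R u t) \<le> 1" if "t \<in> {0..T}" for t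
  proof -
    have "(1 - \<theta> t) * norm (u t) \<le> 1 * 1"
      using \<theta>(2,3)[of t] sol_norm_le_1[OF that] by (intro mult_mono) auto
    then show ?thesis using \<theta>(3)[of t] by simp
  qed
  moreover have "continuous_on {0..T} (\<lambda>t. (1 - \<theta> t) *\<^sub>R u t)"
    by (intro continuous_intros \<theta> sol_continuous)
  ultimately obtain J where "has_rs_integral (\<lambda>t. (1 - \<theta> t) *\<^sub>R u t - u t) L 0 T J"
    using sol_variational by blast
  from has_rs_integral_lincomb[OF this this, of "-1" 0]
  have I: "has_rs_integral (\<lambda>t. \<theta> t *\<^sub>R u t) L 0 T (- J)"
    by (simp add: algebra_simps)
  let ?F = "\<lambda>r. \<theta> r * drift k u r (V_of u r)"
  let ?G = "\<lambda>r. f_sup\<^sup>2 / 2 + \<sigma>_sup / 2 * (1 + (k r)\<^sup>2)"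
  have "0 - (norm (u 0))\<^sup>2 \<le> 2 * (LINT r:{0..T}|lebesgue. ?F r) + 2 * (- J)"
  proof (rule energy_inequality[OF T dense_H sol_continuous sol_V_L2 sol_V_eq drift_L2[OF k] sol_drift_eq[OF k] \<theta>(1)
        _ _ _ t\<^sub>0 _ I])
  qed (use t\<^sub>0 in \<open>auto simp: \<theta>_def cutoff_antimono cutoff_eq_1 cutoff_eq_0\<close>)
  moreover have "(norm (u 0))\<^sup>2 \<le> 1"
    using sol_norm_le_1[of 0] T by (simp add: power_le_one)
  moreover have "(LINT r:{0..T}|lebesgue. ?F r) \<le> (LINT r:{0..T}|lebesgue. ?G r)"
  proof (rule set_integral_mono_AE)
    have "(\<lambda>r. \<theta> r *\<^sub>R V_of u r) \<in> L2_space T"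
      using \<theta>(2,3) by (intro L2_space_cutoff sol_V_L2 \<theta>(1)) auto
    from L2_space_blinfun_apply_integrable[OF drift_L2[OF k] this]
    show "set_integrable lebesgue {0..T} ?F" by (simp add: blinfun.scaleR_right)
    have "set_integrable lebesgue {0..T} (\<lambda>r. (k r)\<^sup>2)"
      using L2_space_integrable_square[OF k] by simp
    then show "set_integrable lebesgue {0..T} ?G" by simp
    show "AE r\<in>{0..T} in lebesgue. ?F r \<le> ?G r"
      using sol_V_eq
    proof eventually_elim
      case (elim r)
      show ?case
      proof
        assume r: "r \<in> {0..T}"
        define x where "x = V_of u r"
        have ux: "u r = \<iota> x" "norm (\<iota> x) \<le> 1" using elim r sol_norm_le_1[OF r] by (auto simp: x_def)
        \<comment> \<open>Tested with the solution itself, the operator gives the full dissipation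
          and the convective term cancels.\<close>
        have "drift k u r x = - (norm x)\<^sup>2 + f (u r) x + k r * (\<sigma> (u r) \<bullet> \<iota> x)"
          by (simp add: drift_def x_def[symmetric] blinfun.add_left blinfun.diff_left blinfun.minus_left dual_op_def B_cancel
              to_dual_apply power2_norm_eq_inner)
        also have "f (u r) x \<le> f_sup * norm x"
          using norm_blinfun[of "f (u r)" x] mult_right_mono[OF f_sup[OF sol_norm_le_1[OF r]], of "norm x"] by simp
        also have "f_sup * norm x \<le> f_sup\<^sup>2 / 2 + (norm x)\<^sup>2"
          using sum_squares_bound[of f_sup "norm x"] zero_le_power2[of "norm x"] by linarith
        also have "k r * (\<sigma> (u r) \<bullet> \<iota> x) \<le> \<sigma>_sup / 2 * (1 + (k r)\<^sup>2)"
        proof -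
          have "\<bar>\<sigma> (u r) \<bullet> \<iota> x\<bar> \<le> norm (\<sigma> (u r)) * norm (\<iota> x)" by (rule Cauchy_Schwarz_ineq2)
          also have "\<dots> \<le> \<sigma>_sup * 1"
            using \<sigma>_sup[OF sol_norm_le_1[OF r]] ux(2) \<sigma>_sup_nonneg by (intro mult_mono) auto
          finally have "\<bar>k r\<bar> * \<bar>\<sigma> (u r) \<bullet> \<iota> x\<bar> \<le> \<bar>k r\<bar> * \<sigma>_sup"
            by (intro mult_left_mono) auto
          also have "\<dots> \<le> ((1 + (k r)\<^sup>2) / 2) * \<sigma>_sup"
            using sum_squares_bound[of 1 "\<bar>k r\<bar>"] \<sigma>_sup_nonneg by (intro mult_right_mono) auto
          finally show ?thesis
            using abs_ge_self[of "k r * (\<sigma> (u r) \<bullet> \<iota> x)"] by (simp add: abs_mult mult.commute)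
        qed
        finally have le: "drift k u r x \<le> ?G r" by simp
        have "0 \<le> ?G r" using \<sigma>_sup_nonneg by simp
        have "\<theta> r * drift k u r x \<le> \<theta> r * ?G r" by (rule mult_left_mono[OF le \<theta>(2)])
        also have "\<dots> \<le> ?G r" using \<open>0 \<le> ?G r\<close> \<theta>(2,3) by (rule mult_left_le_one_le)
        finally show "?F r \<le> ?G r" by (simp add: x_def)
      qed
    qed
  qed
  moreover have "2 * (LINT r:{0..T}|lebesgue. ?G r) \<le> T * f_sup\<^sup>2 + \<sigma>_sup * (T + N)"
  proof -
    have ik: "set_integrable lebesgue {0..T} (\<lambda>r. (k r)\<^sup>2)"
      using L2_space_integrable_square[OF k] by simp
    have "(LINT r:{0..T}|lebesgue. ?G r) = T * (f_sup\<^sup>2 / 2) + \<sigma>_sup / 2 * (T + (LINT t:{0..T}|lebesgue. (k t)\<^sup>2))"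
      using ik T by (simp add: set_integral_const)
    also have "\<dots> \<le> T * (f_sup\<^sup>2 / 2) + \<sigma>_sup / 2 * (T + N)"
      using N \<sigma>_sup_nonneg by (intro add_left_mono mult_left_mono) auto
    finally show ?thesis by simp
  qed
  ultimately have "- 2 * (- J) \<le> 1 + T * f_sup\<^sup>2 + \<sigma>_sup * (T + N)" by linarith
  with I show thesis using that unfolding \<theta>_def by blast
qed

end

end

section \<open>Comparison of two solutions\<close>

context reflection_data
begin

text \<open>Here \<open>x\<close> and \<open>y\<close> stand for the two solutions in V at a fixed
  time, \<open>e\<close> for the corrector and \<open>g\<close> for the approximation of the
  coefficient. The right side is dissipation, a term for Gronwall's lemma, and a remainder that is
  small with \<open>c\<close>, with \<alpha> and with the error of \<open>g\<close>.\<close>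

lemma difference_pointwise:
  fixes x y e :: 'v and g :: 'h and k\<^sub>1 k c G \<alpha> :: real
  assumes xy: "norm (\<iota> x) \<le> 1" "norm (\<iota> y) \<le> 1" and c: "norm e \<le> c" "c \<le> 1"
    and g: "norm g \<le> G" and \<alpha>: "\<alpha> > 0"
  shows "(- dual_op x + f (\<iota> x) + B x x + to_dual \<iota> (k\<^sub>1 *\<^sub>R \<sigma> (\<iota> x))
      - (- dual_op y + f (\<iota> y) + B y y + to_dual \<iota> (k *\<^sub>R \<sigma> (\<iota> y)))
      - to_dual \<iota> ((k\<^sub>1 - k) *\<^sub>R g)) (x - y - e)
    \<le> - (norm (x - y))\<^sup>2 / 4 + (C\<^sup>2 + 4 * (norm y)\<^sup>2 + C * \<bar>k\<^sub>1\<bar>) * (norm (\<iota> x - \<iota> y))\<^sup>2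
      + (c * (13 + 2 * C + (norm y)\<^sup>2 + (1 + k\<^sub>1\<^sup>2 + k\<^sup>2) * ((\<sigma>_sup + G) * norm \<iota>))
        + \<alpha> * (k\<^sub>1\<^sup>2 + k\<^sup>2) + 2 * (norm (\<sigma> (\<iota> y) - g))\<^sup>2 / \<alpha>)" (is "?F (x - y - e) \<le> ?rhs")
proof -
  define W where "W = x - y"
  define w where "w = \<iota> x - \<iota> y"
  define n where "n = norm W"
  define m where "m = norm w"
  define Y where "Y = norm y"
  have wW: "w = \<iota> W" by (simp add: w_def W_def blinfun.diff_right)
  have nn: "0 \<le> n" "0 \<le> m" "0 \<le> Y" by (auto simp: n_def m_def Y_def)
  have c0: "0 \<le> c" using c(1) norm_ge_zero[of e] by linarith
  have G0: "0 \<le> G" using g norm_ge_zero[of g] by linarith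
  have m2: "m \<le> 2" using norm_triangle_ineq4[of "\<iota> x" "\<iota> y"] xy by (simp add: m_def w_def)
  have ne: "norm (W - e) \<le> n + c" using norm_triangle_ineq4[of W e] c by (simp add: n_def)
  \<comment> \<open>The B terms are tested with \<open>W\<close> and \<open>e\<close> separately
    because the cancellation works for \<open>W\<close> alone. In the control terms, subtracting
    \<open>g\<close> leaves \<open>k\<^sub>1\<close> times a Lipschitz difference plus the
    difference of the controls times the approximation error.\<close>
  have split: "?F (W - e) = - (W \<bullet> (W - e)) + (f (\<iota> x) - f (\<iota> y)) (W - e)
     + (B x x - B y y) W - (B x x - B y y) e
     + (k\<^sub>1 * ((\<sigma> (\<iota> x) - \<sigma> (\<iota> y)) \<bullet> w) + (k\<^sub>1 - k) * ((\<sigma> (\<iota> y) - g) \<bullet> w)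
      - (k\<^sub>1 *\<^sub>R \<sigma> (\<iota> x) - k *\<^sub>R \<sigma> (\<iota> y) - (k\<^sub>1 - k) *\<^sub>R g) \<bullet> \<iota> e)"
    unfolding wW
    by (simp add: blinfun.add_left blinfun.diff_left blinfun.minus_left blinfun.diff_right dual_op_def
        to_dual_apply inner_diff_left inner_diff_right blinfun.add_right
        inner_add_right W_def algebra_simps)
  have 1: "- (W \<bullet> (W - e)) \<le> - n\<^sup>2 + n * c"
  proof -
    have "W \<bullet> e \<le> n * c"
      using norm_cauchy_schwarz[of W e] mult_left_mono[OF c(1) nn(1)] by (simp add: n_def)
    then show ?thesis by (simp add: inner_diff_right n_def power2_norm_eq_inner)
  qed
  have 2: "(f (\<iota> x) - f (\<iota> y)) (W - e) \<le> C * m * n + 2 * C * c"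
  proof -
    have "(f (\<iota> x) - f (\<iota> y)) (W - e) \<le> norm (f (\<iota> x) - f (\<iota> y)) * norm (W - e)"
      using norm_blinfun[of "f (\<iota> x) - f (\<iota> y)" "W - e"] by simp
    also have "\<dots> \<le> (C * m) * (n + c)"
      using f_lipschitz[of "\<iota> x" "\<iota> y"] ne nn C_nonneg by (intro mult_mono) (auto simp: m_def w_def)
    also have "\<dots> = C * m * n + C * m * c" by (simp add: algebra_simps)
    also have "C * m * c \<le> C * 2 * c" using m2 C_nonneg c0 by (intro mult_left_mono mult_right_mono) auto
    finally show ?thesis by simp
  qed
  have 3: "(B x x - B y y) W \<le> 2 * n * m * Y"
    using B_difference[of x y] by (simp add: W_def w_def n_def m_def Y_def)
  have 4: "- (B x x - B y y) e \<le> (2 * n + 4 * Y) * c"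
  proof -
    have "norm (B x x) \<le> 2 * norm x" "norm (B y y) \<le> 2 * norm y"
      using B_same_norm[of x] B_same_norm[of y] mult_left_mono[OF xy(1), of "2 * norm x"]
        mult_left_mono[OF xy(2), of "2 * norm y"] by auto
    moreover have "norm x \<le> n + Y" using norm_triangle_ineq[of W y] by (simp add: W_def n_def Y_def)
    ultimately have "norm (B x x - B y y) \<le> 2 * n + 4 * Y"
      using norm_triangle_ineq4[of "B x x" "B y y"] by (simp add: Y_def)
    then have "norm (B x x - B y y) * norm e \<le> (2 * n + 4 * Y) * c"
      using c(1) nn by (intro mult_mono) auto
    then show ?thesis using norm_blinfun[of "B x x - B y y" e] by simp
  qed
  have 5: "k\<^sub>1 * ((\<sigma> (\<iota> x) - \<sigma> (\<iota> y)) \<bullet> w) \<le> C * \<bar>k\<^sub>1\<bar> * m\<^sup>2"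
  proof -
    have "\<bar>(\<sigma> (\<iota> x) - \<sigma> (\<iota> y)) \<bullet> w\<bar> \<le> norm (\<sigma> (\<iota> x) - \<sigma> (\<iota> y)) * m"
      unfolding m_def by (rule Cauchy_Schwarz_ineq2)
    also have "\<dots> \<le> (C * m) * m" using \<sigma>_lipschitz[of "\<iota> x" "\<iota> y"] nn
      by (intro mult_right_mono) (auto simp: m_def w_def)
    finally have "\<bar>k\<^sub>1\<bar> * \<bar>(\<sigma> (\<iota> x) - \<sigma> (\<iota> y)) \<bullet> w\<bar> \<le> \<bar>k\<^sub>1\<bar> * (C * m * m)"
      by (intro mult_left_mono) auto
    then show ?thesis
      using abs_ge_self[of "k\<^sub>1 * ((\<sigma> (\<iota> x) - \<sigma> (\<iota> y)) \<bullet> w)"]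
      by (simp add: abs_mult power2_eq_square ac_simps)
  qed
  have k_abs: "\<bar>k\<^sub>1 - k\<bar> \<le> \<bar>k\<^sub>1\<bar> + \<bar>k\<bar>" by simp
  have kk: "\<bar>k\<^sub>1\<bar> + \<bar>k\<bar> \<le> 1 + k\<^sub>1\<^sup>2 + k\<^sup>2"
    using sum_squares_bound[of 1 "\<bar>k\<^sub>1\<bar>"] sum_squares_bound[of 1 "\<bar>k\<bar>"] zero_le_power2[of k] zero_le_power2[of k\<^sub>1]
    unfolding power2_abs one_power2 mult_1_right by linarith
  have 6: "(k\<^sub>1 - k) * ((\<sigma> (\<iota> y) - g) \<bullet> w) \<le> \<alpha> * (k\<^sub>1\<^sup>2 + k\<^sup>2) + 2 * (norm (\<sigma> (\<iota> y) - g))\<^sup>2 / \<alpha>"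
  proof -
    define s where "s = norm (\<sigma> (\<iota> y) - g)"
    have s: "0 \<le> s" by (simp add: s_def)
    have "\<bar>(\<sigma> (\<iota> y) - g) \<bullet> w\<bar> \<le> s * m" unfolding s_def m_def by (rule Cauchy_Schwarz_ineq2)
    also have "\<dots> \<le> s * 2" using m2 s by (intro mult_left_mono) auto
    finally have "\<bar>k\<^sub>1 - k\<bar> * \<bar>(\<sigma> (\<iota> y) - g) \<bullet> w\<bar> \<le> (\<bar>k\<^sub>1\<bar> + \<bar>k\<bar>) * (s * 2)"
      using s by (intro mult_mono) auto
    also have "\<dots> = 2 * (s * \<bar>k\<^sub>1\<bar>) + 2 * (s * \<bar>k\<bar>)" by (simp add: algebra_simps)
    also have "\<dots> \<le> 2 * (s\<^sup>2 / (2 * \<alpha>) + \<alpha> * k\<^sub>1\<^sup>2 / 2) + 2 * (s\<^sup>2 / (2 * \<alpha>) + \<alpha> * k\<^sup>2 / 2)"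
      using young_ineq[OF \<alpha>, of s "\<bar>k\<^sub>1\<bar>"] young_ineq[OF \<alpha>, of s "\<bar>k\<bar>"] by simp
    also have "\<dots> = \<alpha> * (k\<^sub>1\<^sup>2 + k\<^sup>2) + 2 * s\<^sup>2 / \<alpha>" using \<alpha> by (simp add: field_simps)
    finally show ?thesis
      using abs_ge_self[of "(k\<^sub>1 - k) * ((\<sigma> (\<iota> y) - g) \<bullet> w)"] by (simp add: abs_mult s_def)
  qed
  have 7: "- ((k\<^sub>1 *\<^sub>R \<sigma> (\<iota> x) - k *\<^sub>R \<sigma> (\<iota> y) - (k\<^sub>1 - k) *\<^sub>R g) \<bullet> \<iota> e)
      \<le> c * ((1 + k\<^sub>1\<^sup>2 + k\<^sup>2) * ((\<sigma>_sup + G) * norm \<iota>))" (is "- (?z \<bullet> _) \<le> _")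
  proof -
    \<comment> \<open>Regrouped around \<open>g\<close>, so that each control multiplies one vector
      of norm at most \<open>\<sigma>_sup + G\<close>.\<close>
    have z: "?z = k\<^sub>1 *\<^sub>R (\<sigma> (\<iota> x) - g) - k *\<^sub>R (\<sigma> (\<iota> y) - g)" by (simp add: algebra_simps)
    have "norm (\<sigma> (\<iota> x) - g) \<le> \<sigma>_sup + G" "norm (\<sigma> (\<iota> y) - g) \<le> \<sigma>_sup + G"
      using norm_triangle_ineq4[of "\<sigma> (\<iota> x)" g] norm_triangle_ineq4[of "\<sigma> (\<iota> y)" g]
        \<sigma>_sup[OF xy(1)] \<sigma>_sup[OF xy(2)] g by auto
    then have "norm (k\<^sub>1 *\<^sub>R (\<sigma> (\<iota> x) - g)) \<le> \<bar>k\<^sub>1\<bar> * (\<sigma>_sup + G)" "norm (k *\<^sub>R (\<sigma> (\<iota> y) - g)) \<le> \<bar>k\<bar> * (\<sigma>_sup + G)"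
      by (auto intro: mult_left_mono)
    then have "norm ?z \<le> (\<bar>k\<^sub>1\<bar> + \<bar>k\<bar>) * (\<sigma>_sup + G)"
      unfolding z using norm_triangle_ineq4[of "k\<^sub>1 *\<^sub>R (\<sigma> (\<iota> x) - g)" "k *\<^sub>R (\<sigma> (\<iota> y) - g)"]
      by (simp add: distrib_right)
    also have "\<dots> \<le> (1 + k\<^sub>1\<^sup>2 + k\<^sup>2) * (\<sigma>_sup + G)"
      using kk G0 \<sigma>_sup_nonneg by (intro mult_right_mono) auto
    finally have z1: "norm ?z \<le> (1 + k\<^sub>1\<^sup>2 + k\<^sup>2) * (\<sigma>_sup + G)" .
    have "norm (\<iota> e) \<le> norm \<iota> * c"
      using norm_blinfun[of \<iota> e] mult_left_mono[OF c(1), of "norm \<iota>"] by simp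
    then have "norm ?z * norm (\<iota> e) \<le> ((1 + k\<^sub>1\<^sup>2 + k\<^sup>2) * (\<sigma>_sup + G)) * (norm \<iota> * c)"
      using z1 G0 \<sigma>_sup_nonneg by (intro mult_mono) auto
    moreover have "- (?z \<bullet> \<iota> e) \<le> norm ?z * norm (\<iota> e)"
      using Cauchy_Schwarz_ineq2[of ?z "\<iota> e"] by linarith
    ultimately show ?thesis by (simp only: ac_simps)
  qed
  \<comment> \<open>Of the four quarters of \<open>n\<^sup>2\<close>, \<open>a\<close>,
    \<open>b\<close> and \<open>d\<close> consume one each and one survives. The
    \<open>3 * c * n\<close> collects \<open>n * c\<close> from the operator and
    \<open>2 * n * c\<close> from B. The 13 of the claim is the 9 here plus the 4 of
    \<open>e'\<close>, and \<open>c \<le> 1\<close> makes the square of \<open>c\<close> at most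
    \<open>c\<close>.\<close>
  have a: "3 * c * n \<le> n\<^sup>2 / 4 + 9 * c"
  proof -
    have "0 \<le> (n / 2 - 3 * c)\<^sup>2" by simp
    then have "3 * c * n \<le> n\<^sup>2 / 4 + 9 * (c * c)" by (simp add: power2_eq_square algebra_simps)
    also have "c * c \<le> 1 * c" using c c0 by (intro mult_right_mono) auto
    finally show ?thesis by simp
  qed
  have b: "C * m * n \<le> n\<^sup>2 / 4 + C\<^sup>2 * m\<^sup>2"
  proof -
    have "0 \<le> (n / 2 - C * m)\<^sup>2" by simp
    then show ?thesis by (simp add: power2_eq_square algebra_simps)
  qed
  have d: "2 * n * m * Y \<le> n\<^sup>2 / 4 + 4 * Y\<^sup>2 * m\<^sup>2"
  proof -
    have "0 \<le> (n / 2 - 2 * (m * Y))\<^sup>2" by simp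
    then show ?thesis by (simp add: power2_eq_square algebra_simps)
  qed
  have e': "4 * Y * c \<le> c * (4 + Y\<^sup>2)"
  proof -
    have "0 \<le> (Y - 2)\<^sup>2" by simp
    then have "4 * Y \<le> 4 + Y\<^sup>2" by (simp add: power2_eq_square algebra_simps)
    then show ?thesis using mult_right_mono[OF _ c0, of "4 * Y" "4 + Y\<^sup>2"] by (simp add: mult.commute)
  qed
  define p where "p = (1 + k\<^sub>1\<^sup>2 + k\<^sup>2) * ((\<sigma>_sup + G) * norm \<iota>)"
  have "?F (W - e) \<le> - n\<^sup>2 + n * c + (C * m * n + 2 * C * c) + 2 * n * m * Y + (2 * n + 4 * Y) * c
      + (C * \<bar>k\<^sub>1\<bar> * m\<^sup>2 + (\<alpha> * (k\<^sub>1\<^sup>2 + k\<^sup>2) + 2 * (norm (\<sigma> (\<iota> y) - g))\<^sup>2 / \<alpha>) + c * p)"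
    unfolding split p_def using 1 2 3 4 5 6 7 by linarith
  also have "\<dots> \<le> - n\<^sup>2 / 4 + (C\<^sup>2 + 4 * Y\<^sup>2 + C * \<bar>k\<^sub>1\<bar>) * m\<^sup>2
      + (c * (13 + 2 * C + Y\<^sup>2 + p) + \<alpha> * (k\<^sub>1\<^sup>2 + k\<^sup>2) + 2 * (norm (\<sigma> (\<iota> y) - g))\<^sup>2 / \<alpha>)"
  proof -
    have "n * c + 2 * n * c = 3 * c * n" by simp
    moreover have "(C\<^sup>2 + 4 * Y\<^sup>2 + C * \<bar>k\<^sub>1\<bar>) * m\<^sup>2 = C\<^sup>2 * m\<^sup>2 + 4 * Y\<^sup>2 * m\<^sup>2 + C * \<bar>k\<^sub>1\<bar> * m\<^sup>2"
      by (simp add: algebra_simps)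
    moreover have "c * (13 + 2 * C + Y\<^sup>2 + p) = 9 * c + 2 * C * c + c * (4 + Y\<^sup>2) + c * p"
      by (simp add: algebra_simps)
    moreover have "(2 * n + 4 * Y) * c = 2 * n * c + 4 * Y * c" by (simp add: algebra_simps)
    ultimately show ?thesis using a b d e' by linarith
  qed
  finally show ?thesis by (simp add: W_def w_def n_def m_def Y_def p_def)
qed

lemma convex_combination_norm_le_1:
  fixes a b :: 'h
  assumes "norm a \<le> 1" and "norm b \<le> 1 + c" and "0 \<le> c" and "0 \<le> \<theta>" and "\<theta> \<le> 1"
  shows "norm ((1 - \<theta>) *\<^sub>R a + (\<theta> / (1 + c)) *\<^sub>R b) \<le> 1"
proof -
  have "norm ((1 - \<theta>) *\<^sub>R a + (\<theta> / (1 + c)) *\<^sub>R b) \<le> (1 - \<theta>) * norm a + (\<theta> / (1 + c)) * norm b"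
    using assms norm_triangle_ineq[of "(1 - \<theta>) *\<^sub>R a" "(\<theta> / (1 + c)) *\<^sub>R b"] by simp
  also have "\<dots> \<le> (1 - \<theta>) * 1 + (\<theta> / (1 + c)) * (1 + c)"
    using assms by (intro add_mono mult_left_mono) auto
  also have "\<dots> = 1" using assms by simp
  finally show ?thesis .
qed

text \<open>Dividing by \<open>1 + c\<close> pulls a perturbation of a path in the unit ball back into the ball.  The
  error made in the variational inequality is \<open>c\<close> times the integral bounded in
  \<open>sol_cutoff_integral\<close>, so that no bound on the variation of \<open>L\<close> is needed.\<close>

lemma difference_rs_integral:
  fixes e :: "real \<Rightarrow> 'h"
  assumes sol1: "reflection_solution \<iota> T f \<sigma> B u\<^sub>0 k\<^sub>1 u\<^sub>1 L\<^sub>1"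
    and sol: "reflection_solution \<iota> T f \<sigma> B u\<^sub>0 k u L"
    and k1: "k\<^sub>1 \<in> L2_space T" and k: "k \<in> L2_space T"
    and N1: "(LINT t:{0..T}|lebesgue. (k\<^sub>1 t)\<^sup>2) \<le> N" and N: "(LINT t:{0..T}|lebesgue. (k t)\<^sup>2) \<le> N"
    and e: "continuous_on {0..T} e" "\<And>t. t \<in> {0..T} \<Longrightarrow> norm (e t) \<le> c"
    and t\<^sub>0: "0 \<le> t\<^sub>0" "d > 0" "t\<^sub>0 + d \<le> T"
  obtains I where "has_rs_integral (\<lambda>t. cutoff t\<^sub>0 d t *\<^sub>R (u\<^sub>1 t - u t - e t)) (\<lambda>t. L\<^sub>1 t - L t) 0 T I"
    and "I \<le> c * (1 + T * f_sup\<^sup>2 + \<sigma>_sup * (T + N))"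
proof -
  define \<theta> where "\<theta> = cutoff t\<^sub>0 d"
  define K where "K = 1 + T * f_sup\<^sup>2 + \<sigma>_sup * (T + N)"
  have \<theta>: "continuous_on {0..T} \<theta>" "\<And>t. 0 \<le> \<theta> t" "\<And>t. \<theta> t \<le> 1"
    using t\<^sub>0 by (auto simp: \<theta>_def cutoff_continuous cutoff_bounds)
  have c0: "0 \<le> c" using order_trans[OF norm_ge_zero e(2)[of 0]] T by simp
  obtain I1 where I1: "has_rs_integral (\<lambda>t. \<theta> t *\<^sub>R u\<^sub>1 t) L\<^sub>1 0 T I1" "- 2 * I1 \<le> K"
    using sol_cutoff_integral[OF sol1 k1 N1 t\<^sub>0] unfolding \<theta>_def K_def by blast
  obtain I0 where I0: "has_rs_integral (\<lambda>t. \<theta> t *\<^sub>R u t) L 0 T I0" "- 2 * I0 \<le> K"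
    using sol_cutoff_integral[OF sol k N t\<^sub>0] unfolding \<theta>_def K_def by blast
  note [continuous_intros] = sol_continuous[OF sol1] sol_continuous[OF sol]
  \<comment> \<open>The test path is \<open>u + e\<close>, scaled back into the ball, before the
    cutoff, and the solution itself after it, so that the difference from \<open>u\<^sub>1\<close>
    vanishes there. The next choice is the mirror image, with the roles exchanged and
    \<open>e\<close> negated.\<close>
  obtain J1 where J1: "0 \<le> J1"
    "has_rs_integral (\<lambda>t. (1 - \<theta> t) *\<^sub>R u\<^sub>1 t + (\<theta> t / (1 + c)) *\<^sub>R (u t + e t) - u\<^sub>1 t) L\<^sub>1 0 T J1"
  proof (rule sol_variational[OF sol1])
    show "continuous_on {0..T} (\<lambda>t. (1 - \<theta> t) *\<^sub>R u\<^sub>1 t + (\<theta> t / (1 + c)) *\<^sub>R (u t + e t))"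
      using c0 by (intro continuous_intros \<theta> e) auto
    show "norm ((1 - \<theta> t) *\<^sub>R u\<^sub>1 t + (\<theta> t / (1 + c)) *\<^sub>R (u t + e t)) \<le> 1" if "t \<in> {0..T}" for t
      using sol_norm_le_1[OF sol1 that] sol_norm_le_1[OF sol that] e(2)[OF that] c0 \<theta>(2,3) norm_triangle_ineq[of "u t" "e t"]
      by (intro convex_combination_norm_le_1) auto
  qed blast
  obtain J0 where J0: "0 \<le> J0"
    "has_rs_integral (\<lambda>t. (1 - \<theta> t) *\<^sub>R u t + (\<theta> t / (1 + c)) *\<^sub>R (u\<^sub>1 t - e t) - u t) L 0 T J0"
  proof (rule sol_variational[OF sol])
    show "continuous_on {0..T} (\<lambda>t. (1 - \<theta> t) *\<^sub>R u t + (\<theta> t / (1 + c)) *\<^sub>R (u\<^sub>1 t - e t))"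
      using c0 by (intro continuous_intros \<theta> e) auto
    show "norm ((1 - \<theta> t) *\<^sub>R u t + (\<theta> t / (1 + c)) *\<^sub>R (u\<^sub>1 t - e t)) \<le> 1" if "t \<in> {0..T}" for t
      using sol_norm_le_1[OF sol1 that] sol_norm_le_1[OF sol that] e(2)[OF that] c0 \<theta>(2,3) norm_triangle_ineq4[of "u\<^sub>1 t" "e t"]
      by (intro convex_combination_norm_le_1) auto
  qed blast
  \<comment> \<open>Undoing the scaling produces the desired difference and an extra
    \<open>c\<close> times the cut-off solution, whose integral \<open>sol_cutoff_integral\<close>
    bounds.\<close>
  have scale: "(1 + c) *\<^sub>R ((1 - s) *\<^sub>R a + (s / (1 + c)) *\<^sub>R b - a) = s *\<^sub>R (b - a) - c *\<^sub>R s *\<^sub>R a" for s and a b :: 'h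
  proof -
    have "(1 + c) *\<^sub>R ((1 - s) *\<^sub>R a + (s / (1 + c)) *\<^sub>R b - a) = ((1 + c) * (s / (1 + c))) *\<^sub>R b - (1 + c) *\<^sub>R (s *\<^sub>R a)"
      by (simp only: scaleR_add_right scaleR_diff_right scaleR_diff_left scaleR_scaleR scaleR_one) simp
    also have "(1 + c) * (s / (1 + c)) = s" using c0 by simp
    finally show ?thesis by (simp add: algebra_simps)
  qed
  have "has_rs_integral (\<lambda>t. \<theta> t *\<^sub>R (u\<^sub>1 t - u t - e t)) L\<^sub>1 0 T (- (1 + c) * J1 + - c * I1)"
  proof -
    have "(\<lambda>t. \<theta> t *\<^sub>R (u\<^sub>1 t - u t - e t)) = (\<lambda>t. - (1 + c) *\<^sub>R ((1 - \<theta> t) *\<^sub>R u\<^sub>1 t + (\<theta> t / (1 + c)) *\<^sub>R (u t + e t) - u\<^sub>1 t)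
       + - c *\<^sub>R \<theta> t *\<^sub>R u\<^sub>1 t)"
      unfolding scaleR_minus_left scale by (auto simp: algebra_simps)
    then show ?thesis using has_rs_integral_lincomb[OF J1(2) I1(1), of "- (1 + c)" "- c"] by simp
  qed
  moreover have "has_rs_integral (\<lambda>t. \<theta> t *\<^sub>R (u\<^sub>1 t - u t - e t)) L 0 T ((1 + c) * J0 + c * I0)"
  proof -
    have "(\<lambda>t. \<theta> t *\<^sub>R (u\<^sub>1 t - u t - e t)) = (\<lambda>t. (1 + c) *\<^sub>R ((1 - \<theta> t) *\<^sub>R u t + (\<theta> t / (1 + c)) *\<^sub>R (u\<^sub>1 t - e t) - u t)
       + c *\<^sub>R \<theta> t *\<^sub>R u t)"
      unfolding scale by (auto simp: algebra_simps)
    then show ?thesis using has_rs_integral_lincomb[OF J0(2) I0(1), of "1 + c" c] by simp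
  qed
  ultimately have "has_rs_integral (\<lambda>t. \<theta> t *\<^sub>R (u\<^sub>1 t - u t - e t)) (\<lambda>t. L\<^sub>1 t - L t) 0 T
     (- (1 + c) * J1 + - c * I1 - ((1 + c) * J0 + c * I0))"
    by (rule has_rs_integral_diff_integrator)
  \<comment> \<open>The two variational integrals enter with a favourable sign and are dropped; each
    of the scaling errors is at most \<open>c * K / 2\<close>.\<close>
  moreover have "- (1 + c) * J1 + - c * I1 - ((1 + c) * J0 + c * I0) \<le> c * K"
  proof -
    have "0 \<le> (1 + c) * J1" "0 \<le> (1 + c) * J0" using c0 J1 J0 by auto
    moreover have "c * (- 2 * I1) \<le> c * K" "c * (- 2 * I0) \<le> c * K"
      by (rule mult_left_mono[OF I1(2) c0], rule mult_left_mono[OF I0(2) c0])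
    ultimately show ?thesis by (simp add: algebra_simps)
  qed
  ultimately show thesis using that unfolding \<theta>_def K_def by blast
qed

lemma weighted_difference_integrable:
  assumes sol1: "reflection_solution \<iota> T f \<sigma> B u\<^sub>0 k\<^sub>1 u\<^sub>1 L\<^sub>1"
    and sol: "reflection_solution \<iota> T f \<sigma> B u\<^sub>0 k u L"
    and a: "set_integrable lebesgue {0..T} a" "a \<in> borel_measurable (lebesgue_on {0..T})"
    and a_nonneg: "\<And>r. (0::real) \<le> a r"
  shows "set_integrable lebesgue {0..T} (\<lambda>r. a r * (norm (u\<^sub>1 r - u r))\<^sup>2)"
proof (rule set_integrable_bound)
  show "set_integrable lebesgue {0..T} (\<lambda>r. a r * 4)" using a by auto
  note [measurable] = a(2)
    sol_continuous[OF sol1, THEN continuous_imp_measurable_lebesgue_on]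
    sol_continuous[OF sol, THEN continuous_imp_measurable_lebesgue_on]
  have "(\<lambda>r. a r * (norm (u\<^sub>1 r - u r))\<^sup>2) \<in> borel_measurable (lebesgue_on {0..T})" by measurable
  then show "set_borel_measurable lebesgue {0..T} (\<lambda>r. a r * (norm (u\<^sub>1 r - u r))\<^sup>2)"
    by (simp add: set_borel_measurable_def borel_measurable_restrict_space_iff)
  show "AE r in lebesgue. r \<in> {0..T} \<longrightarrow> norm (a r * (norm (u\<^sub>1 r - u r))\<^sup>2) \<le> norm (a r * 4)"
  proof (intro AE_I2 impI)
    fix r assume r: "r \<in> {0..T}"
    have "norm (u\<^sub>1 r - u r) \<le> 2"
      using norm_triangle_ineq4[of "u\<^sub>1 r" "u r"] sol_norm_le_1[OF sol1 r] sol_norm_le_1[OF sol r] by simp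
    then have "(norm (u\<^sub>1 r - u r))\<^sup>2 \<le> 2\<^sup>2" by (intro power_mono) auto
    then show "norm (a r * (norm (u\<^sub>1 r - u r))\<^sup>2) \<le> norm (a r * 4)"
      by (simp add: abs_mult mult_left_mono)
  qed
qed

text \<open>The energy inequality is applied to \<open>v\<close>, the difference of the solutions
  minus the image of \<eta>, and the result is carried back to the difference itself. This costs a
  factor 2, which with the factor 2 of the energy inequality makes the 4 in front of the integrals,
  and the squared size of \<eta>.\<close>

lemma difference_estimate:
  fixes \<eta> :: "real \<Rightarrow> 'v" and g :: "real \<Rightarrow> 'h"
  assumes sol1: "reflection_solution \<iota> T f \<sigma> B u\<^sub>0 k\<^sub>1 u\<^sub>1 L\<^sub>1"
    and sol: "reflection_solution \<iota> T f \<sigma> B u\<^sub>0 k u L"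
    and k1: "k\<^sub>1 \<in> L2_space T" and k: "k \<in> L2_space T"
    and N1: "(LINT t:{0..T}|lebesgue. (k\<^sub>1 t)\<^sup>2) \<le> N" and N: "(LINT t:{0..T}|lebesgue. (k t)\<^sup>2) \<le> N"
    and g: "g \<in> L2_space T" "\<And>t. norm (g t) \<le> G"
    and \<alpha>: "\<alpha> > 0" "(LINT t:{0..T}|lebesgue. (norm (\<sigma> (u t) - g t))\<^sup>2) \<le> \<alpha>\<^sup>2"
    and \<eta>: "continuous_on {0..T} \<eta>" "\<eta> 0 = 0" "\<And>t. t \<in> {0..T} \<Longrightarrow> norm (\<eta> t) \<le> c" "c \<le> 1"
    and \<eta>_eq: "\<And>s t x. 0 \<le> s \<Longrightarrow> s \<le> t \<Longrightarrow> t \<le> T \<Longrightarrow>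
      (\<iota> (\<eta> t) - \<iota> (\<eta> s)) \<bullet> \<iota> x = (LINT r:{s..t}|lebesgue. ((k\<^sub>1 r - k r) *\<^sub>R g r) \<bullet> \<iota> x)"
    and t: "t \<in> {0..T}"
  shows "(norm (u\<^sub>1 t - u t))\<^sup>2 + (LINT r:{0..t}|lebesgue. (norm (V_of u\<^sub>1 r - V_of u r))\<^sup>2) \<le>
     4 * (c * ((13 + 2 * C) * T + (LINT r:{0..T}|lebesgue. (norm (V_of u r))\<^sup>2)
            + (T + 2 * N) * ((\<sigma>_sup + G) * norm \<iota>)) + 2 * \<alpha> * N + 2 * \<alpha>)
     + 4 * (norm \<iota> * c) * (1 + T * f_sup\<^sup>2 + \<sigma>_sup * (T + N)) + 2 * (norm \<iota> * c)\<^sup>2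
     + 4 * (LINT r:{0..t}|lebesgue. (C\<^sup>2 + 4 * (norm (V_of u r))\<^sup>2 + C * \<bar>k\<^sub>1 r\<bar>) * (norm (u\<^sub>1 r - u r))\<^sup>2)"
proof -
  define w where "w t = u\<^sub>1 t - u t" for t
  define W where "W t = V_of u\<^sub>1 t - V_of u t" for t
  define e where "e t = \<iota> (\<eta> t)" for t
  define v where "v t = w t - e t" for t
  define V where "V t = W t - \<eta> t" for t
  \<comment> \<open>Subtracting \<eta> removes the rough term with \<open>g\<close> from the drift;
    only the difference between \<open>\<sigma> (u r)\<close> and \<open>g r\<close> still meets the
    difference of the controls.\<close>
  define D where "D r = drift k\<^sub>1 u\<^sub>1 r - drift k u r - to_dual \<iota> ((k\<^sub>1 r - k r) *\<^sub>R g r)" for r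
  define a where "a r = C\<^sup>2 + 4 * (norm (V_of u r))\<^sup>2 + C * \<bar>k\<^sub>1 r\<bar>" for r
  \<comment> \<open>The part of the pointwise bound free of \<open>w\<close>; its integral becomes
    small through the choice of \<open>c\<close> and \<alpha>.\<close>
  define \<rho> where "\<rho> r = c * (13 + 2 * C + (norm (V_of u r))\<^sup>2 + (1 + (k\<^sub>1 r)\<^sup>2 + (k r)\<^sup>2) * ((\<sigma>_sup + G) * norm \<iota>))
        + \<alpha> * ((k\<^sub>1 r)\<^sup>2 + (k r)\<^sup>2) + 2 * (norm (\<sigma> (u r) - g r))\<^sup>2 / \<alpha>" for r
  define K where "K = 1 + T * f_sup\<^sup>2 + \<sigma>_sup * (T + N)"
  define \<rho>T where "\<rho>T = (LINT r:{0..T}|lebesgue. \<rho> r)"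
  have c0: "0 \<le> c" using order_trans[OF norm_ge_zero \<eta>(3)[of 0]] T by simp
  have G0: "0 \<le> G" using order_trans[OF norm_ge_zero g(2)] .
  note cont = sol_continuous[OF sol1] sol_continuous[OF sol]
  have w: "continuous_on {0..T} w" unfolding w_def by (intro continuous_intros cont)
  have e: "continuous_on {0..T} e" unfolding e_def by (intro continuous_intros \<eta>)
  have v: "continuous_on {0..T} v" unfolding v_def by (intro continuous_intros w e)
  have W: "W \<in> L2_space T" unfolding W_def by (intro L2_space_diff sol_V_L2[OF sol1] sol_V_L2[OF sol])
  have V: "V \<in> L2_space T" unfolding V_def by (intro L2_space_diff W L2_space_continuous \<eta>)
  have wW: "AE t in lebesgue. t \<in> {0..T} \<longrightarrow> u\<^sub>1 t = \<iota> (V_of u\<^sub>1 t) \<and> u t = \<iota> (V_of u t)"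
    using sol_V_eq[OF sol1] sol_V_eq[OF sol] by eventually_elim auto
  then have vV: "AE t in lebesgue. t \<in> {0..T} \<longrightarrow> v t = \<iota> (V t)"
    by eventually_elim (auto simp: v_def V_def w_def W_def e_def blinfun.diff_right)
  have kg: "(\<lambda>r. (k\<^sub>1 r - k r) *\<^sub>R g r) \<in> L2_space T"
  proof (rule L2_space_bound[OF _ L2_space_scaleR[OF L2_space_diff[OF k1 k], of G]])
    show "(\<lambda>r. (k\<^sub>1 r - k r) *\<^sub>R g r) \<in> borel_measurable (lebesgue_on {0..T})"
      using k1 k g(1) by (auto dest!: L2_space_measurable)
    show "AE t in lebesgue. t \<in> {0..T} \<longrightarrow> norm ((k\<^sub>1 t - k t) *\<^sub>R g t) \<le> norm (G *\<^sub>R (k\<^sub>1 t - k t))"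
    proof (intro AE_I2 impI)
      fix t
      have "\<bar>k\<^sub>1 t - k t\<bar> * norm (g t) \<le> \<bar>k\<^sub>1 t - k t\<bar> * G" by (intro mult_left_mono g(2)) auto
      then show "norm ((k\<^sub>1 t - k t) *\<^sub>R g t) \<le> norm (G *\<^sub>R (k\<^sub>1 t - k t))"
        using G0 by (simp add: abs_mult mult.commute)
    qed
  qed
  have D: "D \<in> L2_space T" unfolding D_def
    using drift_L2[OF sol1 k1] drift_L2[OF sol k] L2_space_to_dual[OF kg]
    by (intro L2_space_diff) auto
  have eq: "(v t - v s) \<bullet> \<iota> x = (LINT r:{s..t}|lebesgue. D r x) + ((L\<^sub>1 t - L t) - (L\<^sub>1 s - L s)) \<bullet> \<iota> x"
    if st: "0 \<le> s" "s \<le> t" "t \<le> T" for s t x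
  proof -
    have i: "set_integrable lebesgue {0..T} (\<lambda>r. drift k\<^sub>1 u\<^sub>1 r x)" "set_integrable lebesgue {0..T} (\<lambda>r. drift k u r x)"
      "set_integrable lebesgue {0..T} (\<lambda>r. ((k\<^sub>1 r - k r) *\<^sub>R g r) \<bullet> \<iota> x)"
      using drift_L2[OF sol1 k1] drift_L2[OF sol k] kg L2_space_const
      by (auto intro!: L2_space_blinfun_apply_integrable L2_space_inner_integrable simp del: inner_scaleR_left)
    have i': "set_integrable lebesgue {s..t} (\<lambda>r. drift k\<^sub>1 u\<^sub>1 r x)" "set_integrable lebesgue {s..t} (\<lambda>r. drift k u r x)"
      "set_integrable lebesgue {s..t} (\<lambda>r. ((k\<^sub>1 r - k r) *\<^sub>R g r) \<bullet> \<iota> x)"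
      using i[THEN set_integrable_subset, of "{s..t}"] st by (auto simp del: inner_scaleR_left)
    have "(LINT r:{s..t}|lebesgue. D r x) = (LINT r:{s..t}|lebesgue. drift k\<^sub>1 u\<^sub>1 r x - drift k u r x - ((k\<^sub>1 r - k r) *\<^sub>R g r) \<bullet> \<iota> x)"
      by (simp add: D_def blinfun.diff_left to_dual_apply)
    also have "\<dots> = (LINT r:{s..t}|lebesgue. drift k\<^sub>1 u\<^sub>1 r x) - (LINT r:{s..t}|lebesgue. drift k u r x)
        - (LINT r:{s..t}|lebesgue. ((k\<^sub>1 r - k r) *\<^sub>R g r) \<bullet> \<iota> x)"
      using i' by (simp del: inner_scaleR_left)
    finally show ?thesis
      using sol_drift_eq[OF sol1 k1 st, of x] sol_drift_eq[OF sol k st, of x] \<eta>_eq[OF st, of x]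
      by (simp add: v_def w_def e_def inner_diff_left)
  qed
  have v0: "v 0 = 0"
    using sol_initial[OF sol1] sol_initial[OF sol] \<eta>(2) by (simp add: v_def w_def e_def blinfun.zero_right)
  have e_le: "norm (e t) \<le> norm \<iota> * c" if "t \<in> {0..T}" for t
    using norm_blinfun[of \<iota> "\<eta> t"] mult_left_mono[OF \<eta>(3)[OF that], of "norm \<iota>"] by (simp add: e_def)
  have sq: "set_integrable lebesgue {0..T} (\<lambda>r. (norm (V_of u r))\<^sup>2)" "set_integrable lebesgue {0..T} (\<lambda>r. (norm (W r))\<^sup>2)"
    "set_integrable lebesgue {0..T} (\<lambda>r. (k\<^sub>1 r)\<^sup>2)" "set_integrable lebesgue {0..T} (\<lambda>r. (k r)\<^sup>2)"
    using L2_space_integrable_square[OF sol_V_L2[OF sol]] L2_space_integrable_square[OF W]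
      L2_space_integrable_square[OF k1] L2_space_integrable_square[OF k] by auto
  have sg: "set_integrable lebesgue {0..T} (\<lambda>r. (norm (\<sigma> (u r) - g r))\<^sup>2)"
    using continuous_on_compose2[OF continuous_\<sigma>[of UNIV] cont(2)]
    by (intro L2_space_integrable_square L2_space_diff g L2_space_continuous) auto
  have \<rho>_int: "set_integrable lebesgue {0..T} \<rho>"
    unfolding \<rho>_def using sq sg by auto
  have \<rho>_nonneg: "0 \<le> \<rho> r" for r
    unfolding \<rho>_def using c0 G0 \<sigma>_sup_nonneg C_nonneg \<alpha> by (auto intro!: add_nonneg_nonneg mult_nonneg_nonneg)
  have a_nonneg: "0 \<le> a r" for r unfolding a_def using C_nonneg by auto
  have "set_integrable lebesgue {0..T} (\<lambda>r. \<bar>k\<^sub>1 r\<bar>)"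
    using L2_space_integrable[OF k1] by (rule set_integrable_abs)
  then have "set_integrable lebesgue {0..T} a"
    unfolding a_def using sq by auto
  moreover have "a \<in> borel_measurable (lebesgue_on {0..T})"
    unfolding a_def using L2_space_measurable[OF sol_V_L2[OF sol]] L2_space_measurable[OF k1] by measurable
  ultimately have aw_int: "set_integrable lebesgue {0..T} (\<lambda>r. a r * (norm (w r))\<^sup>2)"
    unfolding w_def using a_nonneg by (rule weighted_difference_integrable[OF sol1 sol])
  define A where "A t = (LINT r:{0..t}|lebesgue. a r * (norm (w r))\<^sup>2)" for t
  define S where "S t = (LINT r:{0..t}|lebesgue. (norm (W r))\<^sup>2)" for t
  have A: "continuous_on {0..T} A" unfolding A_def by (rule continuous_on_indefinite_integral[OF aw_int])
  have S: "continuous_on {0..T} S" unfolding S_def by (rule continuous_on_indefinite_integral[OF sq(2)])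
  have point: "D r (V r) \<le> - (norm (W r))\<^sup>2 / 4 + a r * (norm (w r))\<^sup>2 + \<rho> r"
    if r: "r \<in> {0..T}" "u\<^sub>1 r = \<iota> (V_of u\<^sub>1 r)" "u r = \<iota> (V_of u r)" for r
  proof -
    have x: "\<iota> (V_of u\<^sub>1 r) = u\<^sub>1 r" and y: "\<iota> (V_of u r) = u r" using r by auto
    show ?thesis
      using difference_pointwise[of "V_of u\<^sub>1 r" "V_of u r", unfolded x y, OF sol_norm_le_1[OF sol1 r(1)]
          sol_norm_le_1[OF sol r(1)] \<eta>(3)[OF r(1)] \<eta>(4) g(2)[of r] \<alpha>(1), of "k\<^sub>1 r" "k r"]
      unfolding D_def drift_def V_def W_def w_def a_def \<rho>_def by simp
  qed
  have ind: "set_integrable lebesgue {0..T} (\<lambda>r. indicator {0..s} r * h r)"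
    if "set_integrable lebesgue {0..T} h" for h :: "real \<Rightarrow> real" and s
    using integrable_mult_indicator[of "{0..s}" lebesgue, OF _ that[unfolded set_integrable_def]]
    by (simp add: set_integrable_def ac_simps)
  have ind_eq: "(LINT r:{0..T}|lebesgue. indicator {0..s} r * h r) = (LINT r:{0..s}|lebesgue. h r)"
    if "s \<le> T" for h :: "real \<Rightarrow> real" and s
    unfolding set_lebesgue_integral_def using that
    by (intro Bochner_Integration.integral_cong) (auto simp: indicator_def)
  \<comment> \<open>The ramp needs room to the right of \<open>t\<close>, so T itself is left for a
    limit. Half of \<epsilon> pays for the variation of the squared norm of \<open>v\<close> near
    \<open>t\<close>, the other half for the growth of \<open>2 * A\<close> over the ramp.\<close>
  have before_T: "(norm (v t))\<^sup>2 + S t / 2 \<le> 2 * A t + 2 * \<rho>T + 2 * (norm \<iota> * c) * K" if t: "t \<in> {0..<T}" for t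
  proof (rule field_le_epsilon)
    fix \<epsilon> :: real assume \<epsilon>: "\<epsilon> > 0"
    have "continuous_on {0..T} (\<lambda>t. (norm (v t))\<^sup>2)" by (intro continuous_intros v)
    then obtain d1 where d1: "d1 > 0" "\<And>r. r \<in> {0..T} \<Longrightarrow> dist r t < d1 \<Longrightarrow> dist ((norm (v r))\<^sup>2) ((norm (v t))\<^sup>2) < \<epsilon> / 2"
      using t \<epsilon> unfolding continuous_on_iff by (metis atLeastAtMost_iff atLeastLessThan_iff half_gt_zero less_imp_le)
    obtain d2 where d2: "d2 > 0" "\<And>r. r \<in> {0..T} \<Longrightarrow> dist r t < d2 \<Longrightarrow> dist (A r) (A t) < \<epsilon> / 4"
      using t \<epsilon> A unfolding continuous_on_iff by (metis atLeastAtMost_iff atLeastLessThan_iff divide_pos_pos less_imp_le zero_less_numeral)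
    define d where "d = Min {d1, d2, T - t} / 2"
    have d: "d > 0" "d < d1" "d < d2" "t + d \<le> T" using d1(1) d2(1) t by (auto simp: d_def min_def field_simps)
    define \<theta> where "\<theta> = cutoff t d"
    have \<theta>: "continuous_on {0..T} \<theta>" "\<And>r. 0 \<le> \<theta> r" "\<And>r. \<theta> r \<le> 1" "\<And>r. r \<le> t \<Longrightarrow> \<theta> r = 1" "\<And>r. t + d \<le> r \<Longrightarrow> \<theta> r = 0"
      using d by (auto simp: \<theta>_def cutoff_continuous cutoff_bounds cutoff_eq_1 cutoff_eq_0)
    have t': "0 \<le> t" using t by simp
    obtain I where I: "has_rs_integral (\<lambda>r. \<theta> r *\<^sub>R v r) (\<lambda>r. L\<^sub>1 r - L r) 0 T I" "I \<le> (norm \<iota> * c) * K"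
      using difference_rs_integral[OF sol1 sol k1 k N1 N e e_le t' d(1,4)] unfolding \<theta>_def v_def w_def K_def by blast
    have "((norm (v t))\<^sup>2 - \<epsilon> / 2) - (norm (v 0))\<^sup>2 \<le> 2 * (LINT r:{0..T}|lebesgue. \<theta> r * D r (V r)) + 2 * I"
    proof (rule energy_inequality[OF T dense_H v V vV D eq \<theta>(1) _ _ _ t' d(1,4) _ I(1)])
      fix r assume r: "r \<in> {0..T}" "t - d \<le> r" "r \<le> t + d"
      then have "dist r t < d1" using d by (auto simp: dist_real_def)
      from d1(2)[OF r(1) this] show "(norm (v t))\<^sup>2 - \<epsilon> / 2 \<le> (norm (v r))\<^sup>2"
        unfolding dist_real_def by linarith
    qed (use d \<theta> in \<open>auto simp: \<theta>_def cutoff_antimono\<close>)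
    \<comment> \<open>Before \<open>t\<close> the weight is 1 and the dissipation is kept; on the
      ramp the dissipation is dropped and the weight is bounded by 1 on what is nonnegative; after
      the ramp the left side is 0. The nonnegative \<rho> is kept on the whole interval.\<close>
    also have "(LINT r:{0..T}|lebesgue. \<theta> r * D r (V r)) \<le>
      (LINT r:{0..T}|lebesgue. - (indicator {0..t} r * (norm (W r))\<^sup>2) / 4 + indicator {0..t + d} r * (a r * (norm (w r))\<^sup>2) + \<rho> r)"
    proof (rule set_integral_mono_AE)
      have "(\<lambda>r. \<theta> r *\<^sub>R V r) \<in> L2_space T"
        using \<theta>(2,3) by (intro L2_space_cutoff V \<theta>(1)) auto
      from L2_space_blinfun_apply_integrable[OF D this]
      show "set_integrable lebesgue {0..T} (\<lambda>r. \<theta> r * D r (V r))" by (simp add: blinfun.scaleR_right)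
      show "set_integrable lebesgue {0..T} (\<lambda>r. - (indicator {0..t} r * (norm (W r))\<^sup>2) / 4
          + indicator {0..t + d} r * (a r * (norm (w r))\<^sup>2) + \<rho> r)"
        using set_integrable_mult_right[OF ind[OF sq(2), of t], of "- 1 / 4"] ind[OF aw_int] \<rho>_int
        by (intro set_integral_add) auto
      show "AE r\<in>{0..T} in lebesgue. \<theta> r * D r (V r) \<le> - (indicator {0..t} r * (norm (W r))\<^sup>2) / 4
          + indicator {0..t + d} r * (a r * (norm (w r))\<^sup>2) + \<rho> r"
        using wW
      proof eventually_elim
        case (elim r)
        show ?case
        proof
          assume r: "r \<in> {0..T}"
          have le: "D r (V r) \<le> - (norm (W r))\<^sup>2 / 4 + a r * (norm (w r))\<^sup>2 + \<rho> r" using elim r point by blast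
          have aw: "0 \<le> a r * (norm (w r))\<^sup>2" using a_nonneg[of r] by simp
          consider "r \<le> t" | "t < r" "r \<le> t + d" | "t + d < r" by linarith
          then show "\<theta> r * D r (V r) \<le> - (indicator {0..t} r * (norm (W r))\<^sup>2) / 4
            + indicator {0..t + d} r * (a r * (norm (w r))\<^sup>2) + \<rho> r"
          proof cases
            case 1 then show ?thesis using le r \<theta>(4)[of r] d by simp
          next
            case 2
            have "D r (V r) \<le> a r * (norm (w r))\<^sup>2 + \<rho> r"
              using le zero_le_power2[of "norm (W r)"] by linarith
            then have "\<theta> r * D r (V r) \<le> \<theta> r * (a r * (norm (w r))\<^sup>2 + \<rho> r)" by (rule mult_left_mono[OF _ \<theta>(2)])
            also have "\<dots> \<le> a r * (norm (w r))\<^sup>2 + \<rho> r"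
              using aw \<rho>_nonneg[of r] \<theta>(2,3) by (intro mult_left_le_one_le) auto
            finally show ?thesis using 2 r by simp
          next
            case 3 then show ?thesis using \<theta>(5)[of r] \<rho>_nonneg[of r] d by simp
          qed
        qed
      qed
    qed
    also have "\<dots> = - S t / 4 + A (t + d) + \<rho>T"
    proof -
      have "(LINT r:{0..T}|lebesgue. - (indicator {0..t} r * (norm (W r))\<^sup>2) / 4
            + indicator {0..t + d} r * (a r * (norm (w r))\<^sup>2) + \<rho> r)
        = (LINT r:{0..T}|lebesgue. (- 1 / 4) * (indicator {0..t} r * (norm (W r))\<^sup>2)
            + indicator {0..t + d} r * (a r * (norm (w r))\<^sup>2) + \<rho> r)" by simp
      also have "\<dots> = (LINT r:{0..T}|lebesgue. (- 1 / 4) * (indicator {0..t} r * (norm (W r))\<^sup>2))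
          + (LINT r:{0..T}|lebesgue. indicator {0..t + d} r * (a r * (norm (w r))\<^sup>2)) + \<rho>T"
      proof -
        have i: "set_integrable lebesgue {0..T} (\<lambda>r. (- 1 / 4) * (indicator {0..t} r * (norm (W r))\<^sup>2))"
          by (rule set_integrable_mult_right) (rule ind[OF sq(2)])
        show ?thesis
          unfolding \<rho>T_def set_integral_add(2)[OF set_integral_add(1)[OF i ind[OF aw_int]] \<rho>_int]
            set_integral_add(2)[OF i ind[OF aw_int]] ..
      qed
      also have "\<dots> = - S t / 4 + A (t + d) + \<rho>T"
        using d t unfolding set_integral_mult_right by (simp add: ind_eq S_def A_def)
      finally show ?thesis .
    qed
    finally have "(norm (v t))\<^sup>2 - \<epsilon> / 2 \<le> 2 * (- S t / 4 + A (t + d) + \<rho>T) + 2 * I" by (simp add: v0)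
    moreover have "A (t + d) \<le> A t + \<epsilon> / 4"
    proof -
      have "t + d \<in> {0..T}" "dist (t + d) t < d2" using d t by (auto simp: dist_real_def)
      from d2(2)[OF this] show ?thesis unfolding dist_real_def by linarith
    qed
    ultimately show "(norm (v t))\<^sup>2 + S t / 2 \<le> 2 * A t + 2 * \<rho>T + 2 * (norm \<iota> * c) * K + \<epsilon>"
      using I(2) by argo
  qed
  \<comment> \<open>Both sides are continuous in time, so the bound extends from [0,T) to T.\<close>
  have main: "(norm (v t))\<^sup>2 + S t / 2 \<le> 2 * A t + 2 * \<rho>T + 2 * (norm \<iota> * c) * K"
  proof -
    have "closure {0..<T} = {0..T}" using T by simp
    moreover have "continuous_on {0..T} (\<lambda>t. 2 * A t + 2 * \<rho>T + 2 * (norm \<iota> * c) * K - ((norm (v t))\<^sup>2 + S t / 2))"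
      by (intro continuous_intros A S v) auto
    ultimately have "0 \<le> 2 * A t + 2 * \<rho>T + 2 * (norm \<iota> * c) * K - ((norm (v t))\<^sup>2 + S t / 2)"
      using continuous_ge_on_closure[of "{0..<T}" "\<lambda>t. 2 * A t + 2 * \<rho>T + 2 * (norm \<iota> * c) * K - ((norm (v t))\<^sup>2 + S t / 2)" t 0]
        before_T t by auto
    then show ?thesis by simp
  qed
  have "(norm (w t))\<^sup>2 \<le> 2 * (norm (v t))\<^sup>2 + 2 * (norm \<iota> * c)\<^sup>2"
  proof -
    have "norm (w t) \<le> norm (v t) + norm \<iota> * c"
      using norm_triangle_ineq[of "v t" "e t"] e_le[OF t] by (simp add: v_def)
    then have "(norm (w t))\<^sup>2 \<le> (norm (v t) + norm \<iota> * c)\<^sup>2" by (intro power_mono) auto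
    also have "\<dots> \<le> 2 * (norm (v t))\<^sup>2 + 2 * (norm \<iota> * c)\<^sup>2"
      using sum_squares_bound[of "norm (v t)" "norm \<iota> * c"] by (simp add: power2_sum)
    finally show ?thesis .
  qed
  with main have "(norm (w t))\<^sup>2 + S t \<le> 4 * \<rho>T + 4 * (norm \<iota> * c) * K + 2 * (norm \<iota> * c)\<^sup>2 + 4 * A t"
    by (simp add: algebra_simps)
  then have le: "(norm (w t))\<^sup>2 + S t \<le> 4 * z + 4 * (norm \<iota> * c) * K + 2 * (norm \<iota> * c)\<^sup>2 + 4 * A t"
    if "\<rho>T \<le> z" for z using that by linarith
  have "\<rho>T \<le> c * ((13 + 2 * C) * T + (LINT r:{0..T}|lebesgue. (norm (V_of u r))\<^sup>2)
            + (T + 2 * N) * ((\<sigma>_sup + G) * norm \<iota>)) + 2 * \<alpha> * N + 2 * \<alpha>"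
  proof -
    define X where "X = (LINT t:{0..T}|lebesgue. (norm (\<sigma> (u t) - g t))\<^sup>2)"
    define Q where "Q = (LINT r:{0..T}|lebesgue. (norm (V_of u r))\<^sup>2)"
    define M\<^sub>1 M where "M\<^sub>1 = (LINT t:{0..T}|lebesgue. (k\<^sub>1 t)\<^sup>2)" and "M = (LINT t:{0..T}|lebesgue. (k t)\<^sup>2)"
    define p where "p = (\<sigma>_sup + G) * norm \<iota>"
    have p0: "0 \<le> p" using \<sigma>_sup_nonneg G0 by (simp add: p_def)
    \<comment> \<open>The approximation error is squared and divided by \<alpha>, which explains its
      bound by the square of \<alpha>: the quotient is again of order \<alpha>.\<close>
    have "\<rho>T = c * ((13 + 2 * C) * T + Q + (T + M\<^sub>1 + M) * p) + \<alpha> * (M\<^sub>1 + M) + 2 * X / \<alpha>"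
      unfolding \<rho>T_def \<rho>_def p_def[symmetric] X_def Q_def M\<^sub>1_def M_def using sq sg T
      by (simp add: set_integral_const algebra_simps)
    also have "\<dots> \<le> c * ((13 + 2 * C) * T + Q + (T + 2 * N) * p) + \<alpha> * (2 * N) + 2 * \<alpha>\<^sup>2 / \<alpha>"
    proof -
      have MN: "M\<^sub>1 + M \<le> 2 * N" and X: "X \<le> \<alpha>\<^sup>2" using N1 N \<alpha> by (auto simp: X_def M\<^sub>1_def M_def)
      have "c * ((13 + 2 * C) * T + Q + (T + M\<^sub>1 + M) * p) \<le> c * ((13 + 2 * C) * T + Q + (T + 2 * N) * p)"
        using MN c0 p0 by (intro mult_left_mono[OF _ c0] add_left_mono mult_right_mono[OF _ p0]) linarith
      moreover have "\<alpha> * (M\<^sub>1 + M) \<le> \<alpha> * (2 * N)" using MN \<alpha> by (intro mult_left_mono) auto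
      moreover have "2 * X / \<alpha> \<le> 2 * \<alpha>\<^sup>2 / \<alpha>" using X \<alpha>(1) by (intro divide_right_mono) auto
      ultimately show ?thesis by linarith
    qed
    also have "\<dots> = c * ((13 + 2 * C) * T + Q + (T + 2 * N) * p) + 2 * \<alpha> * N + 2 * \<alpha>"
      using \<alpha>(1) by (simp add: power2_eq_square)
    finally show ?thesis unfolding p_def Q_def .
  qed
  then have "(norm (w t))\<^sup>2 + S t \<le>
     4 * (c * ((13 + 2 * C) * T + (LINT r:{0..T}|lebesgue. (norm (V_of u r))\<^sup>2)
            + (T + 2 * N) * ((\<sigma>_sup + G) * norm \<iota>)) + 2 * \<alpha> * N + 2 * \<alpha>)
     + 4 * (norm \<iota> * c) * K + 2 * (norm \<iota> * c)\<^sup>2 + 4 * A t"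
    by (rule le)
  then show ?thesis unfolding w_def S_def W_def A_def a_def K_def .
qed

end

section \<open>Weak convergence of the controls\<close>

lemma L2_space_scaleR_simple:
  fixes \<psi> :: "real \<Rightarrow> 'v::{real_normed_vector, second_countable_topology}" and q :: "real \<Rightarrow> real"
  assumes "q \<in> L2_space T" and "simple_function lebesgue \<psi>"
  shows "(\<lambda>r. q r *\<^sub>R \<psi> r) \<in> L2_space T"
proof -
  have "bounded (range \<psi>)" using simple_functionD(1)[OF assms(2)] by (auto intro: finite_imp_bounded)
  then obtain b where b: "\<And>r. norm (\<psi> r) \<le> b" "b > 0" unfolding bounded_pos by auto
  show ?thesis
  proof (rule L2_space_bound[OF _ L2_space_scaleR[OF assms(1), of b]])
    show "(\<lambda>r. q r *\<^sub>R \<psi> r) \<in> borel_measurable (lebesgue_on {0..T})"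
      using L2_space_measurable[OF assms(1)] measurable_restrict_space1[OF borel_measurable_simple_function[OF assms(2)]]
      by measurable
    show "AE t in lebesgue. t \<in> {0..T} \<longrightarrow> norm (q t *\<^sub>R \<psi> t) \<le> norm (b *\<^sub>R q t)"
    proof (intro AE_I2 impI)
      fix t
      have "\<bar>q t\<bar> * norm (\<psi> t) \<le> \<bar>q t\<bar> * b" by (intro mult_left_mono b(1)) auto
      then show "norm (q t *\<^sub>R \<psi> t) \<le> norm (b *\<^sub>R q t)"
        using b(2) by (simp add: abs_mult mult.commute)
    qed
  qed
qed

lemma norm_primitive_increment_le:
  fixes F :: "real \<Rightarrow> 'v::{banach, second_countable_topology}"
  assumes "set_integrable lebesgue {0..T} F" and "0 \<le> s" and "s \<le> t" and "t \<le> T"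
  shows "norm ((LINT r:{0..t}|lebesgue. F r) - (LINT r:{0..s}|lebesgue. F r)) \<le> (LINT r:{s..t}|lebesgue. norm (F r))"
proof -
  have i: "set_integrable lebesgue {0..t} F" using assms by (intro set_integrable_subset[OF assms(1)]) auto
  have "(LINT r:{0..t}|lebesgue. F r) - (LINT r:{0..s}|lebesgue. F r) = (LINT r:{s..t}|lebesgue. F r)"
    using set_integral_split[OF i assms(2,3)] by simp
  also have "norm \<dots> \<le> (LINT r|lebesgue. norm (indicator {s..t} r *\<^sub>R F r))"
    unfolding set_lebesgue_integral_def by (rule integral_norm_bound)
  also have "\<dots> = (LINT r:{s..t}|lebesgue. norm (F r))"
    by (simp add: set_lebesgue_integral_def)
  finally show ?thesis .
qed

text \<open>Increments of the vector-valued primitive are dominated by those of the primitive of the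
  norm, so the scalar case carries over.\<close>

lemma continuous_on_primitive:
  fixes F :: "real \<Rightarrow> 'v::{banach, second_countable_topology}"
  assumes F: "set_integrable lebesgue {0..T} F"
  shows "continuous_on {0..T} (\<lambda>t. LINT r:{0..t}|lebesgue. F r)"
proof -
  define p where "p t = (LINT r:{0..t}|lebesgue. norm (F r))" for t
  define \<eta> where "\<eta> t = (LINT r:{0..t}|lebesgue. F r)" for t
  have nF: "set_integrable lebesgue {0..T} (\<lambda>r. norm (F r))"
    using integrable_norm[OF F[unfolded set_integrable_def]] by (simp add: set_integrable_def)
  have p: "continuous_on {0..T} p"
    unfolding p_def using nF by (rule continuous_on_indefinite_integral)
  have le: "norm (\<eta> t - \<eta> s) \<le> p t - p s" if "0 \<le> s" "s \<le> t" "t \<le> T" for s t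
  proof -
    have "set_integrable lebesgue {0..t} (\<lambda>r. norm (F r))"
      using that by (intro set_integrable_subset[OF nF]) auto
    then show ?thesis
      using norm_primitive_increment_le[OF F that] set_integral_split[of 0 t "\<lambda>r. norm (F r)" s] that
      by (simp add: \<eta>_def p_def)
  qed
  have dist: "dist (\<eta> t) (\<eta> s) \<le> dist (p t) (p s)" if "s \<in> {0..T}" "t \<in> {0..T}" for s t
    using le[of s t] le[of t s] that by (cases "s \<le> t") (auto simp: dist_norm norm_minus_commute)
  have "continuous_on {0..T} \<eta>"
    using p dist unfolding continuous_on_iff by (meson le_less_trans)
  then show ?thesis by (simp add: \<eta>_def[abs_def])
qed

text \<open>A simple function has finitely many values, so the vector-valued integral is a finite
  combination of scalar pairings of the control with indicators, and each of these converges by weak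
  convergence.\<close>

lemma weak_conv_primitive_pointwise:
  fixes \<psi> :: "real \<Rightarrow> 'v::{banach, second_countable_topology}"
  assumes \<psi>: "simple_function lebesgue \<psi>" and k: "k \<in> L2_space T"
    and kk: "\<forall>\<epsilon>>0. kk \<epsilon> \<in> L2_space T" and weak: "L2_weak_conv T kk k (at_right 0)"
    and t: "t \<in> {0..T}"
  shows "((\<lambda>\<epsilon>. LINT r:{0..t}|lebesgue. (kk \<epsilon> r - k r) *\<^sub>R \<psi> r) \<longlongrightarrow> 0) (at_right 0)"
proof -
  \<comment> \<open>The scalar test function for the value \<open>y\<close>. The upper limit
    \<open>t\<close> of the integral is built in, since weak convergence concerns pairings over all
    of [0,T].\<close>
  define h where "h y r = indicat_real ({0..t} \<inter> \<psi> -` {y}) r" for y and r :: real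
  have fin: "finite (range \<psi>)" using simple_functionD(1)[OF \<psi>] by simp
  have sets: "\<psi> -` {y} \<in> sets lebesgue" for y using simple_functionD(2)[OF \<psi>, of "{y}"] by simp
  have h: "h y \<in> L2_space T" for y
  proof (rule L2_space_bounded)
    have "h y \<in> borel_measurable lebesgue" unfolding h_def[abs_def]
      by (intro borel_measurable_indicator sets.Int sets) auto
    then show "h y \<in> borel_measurable (lebesgue_on {0..T})" by (rule measurable_restrict_space1)
    show "norm (h y r) \<le> 1" for r by (simp add: h_def indicator_def)
  qed
  have expand: "(LINT r:{0..t}|lebesgue. (kk \<epsilon> r - k r) *\<^sub>R \<psi> r)
    = (\<Sum>y\<in>range \<psi>. ((LINT r:{0..T}|lebesgue. kk \<epsilon> r * h y r) - (LINT r:{0..T}|lebesgue. k r * h y r)) *\<^sub>R y)"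
    if \<epsilon>: "\<epsilon> > 0" for \<epsilon>
  proof -
    have i: "set_integrable lebesgue {0..T} (\<lambda>r. kk \<epsilon> r * h y r)" "set_integrable lebesgue {0..T} (\<lambda>r. k r * h y r)" for y
      using kk k h \<epsilon> by (auto intro: L2_space_mult_integrable)
    have pt: "indicator {0..t} r *\<^sub>R (kk \<epsilon> r - k r) *\<^sub>R \<psi> r
      = (\<Sum>y\<in>range \<psi>. (indicator {0..T} r *\<^sub>R (kk \<epsilon> r * h y r - k r * h y r)) *\<^sub>R y)" for r
    proof -
      have "(\<Sum>y\<in>range \<psi>. (indicator {0..T} r *\<^sub>R (kk \<epsilon> r * h y r - k r * h y r)) *\<^sub>R y)
        = (\<Sum>y\<in>range \<psi>. if y = \<psi> r then (indicator {0..t} r * (kk \<epsilon> r - k r)) *\<^sub>R y else 0)"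
        using t by (intro sum.cong) (auto simp: h_def indicator_def)
      also have "\<dots> = (indicator {0..t} r * (kk \<epsilon> r - k r)) *\<^sub>R \<psi> r"
        using fin by (subst sum.delta) auto
      finally show ?thesis by simp
    qed
    have i2: "integrable lebesgue (\<lambda>r. indicator {0..T} r *\<^sub>R (kk \<epsilon> r * h y r - k r * h y r))" for y
      using set_integral_diff(1)[OF i(1,2)] by (simp add: set_integrable_def)
    have "(LINT r:{0..t}|lebesgue. (kk \<epsilon> r - k r) *\<^sub>R \<psi> r)
      = (\<Sum>y\<in>range \<psi>. (LINT r|lebesgue. (indicator {0..T} r *\<^sub>R (kk \<epsilon> r * h y r - k r * h y r)) *\<^sub>R y))"
      unfolding set_lebesgue_integral_def pt
      by (intro Bochner_Integration.integral_sum integrable_scaleR_left impI i2)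
    also have "\<dots> = (\<Sum>y\<in>range \<psi>. (LINT r:{0..T}|lebesgue. kk \<epsilon> r * h y r - k r * h y r) *\<^sub>R y)"
      unfolding set_lebesgue_integral_def
      by (intro sum.cong refl integral_scaleR_left i2)
    finally show ?thesis using i by simp
  qed
  have "((\<lambda>\<epsilon>. \<Sum>y\<in>range \<psi>. ((LINT r:{0..T}|lebesgue. kk \<epsilon> r * h y r) - (LINT r:{0..T}|lebesgue. k r * h y r)) *\<^sub>R y)
    \<longlongrightarrow> (\<Sum>y\<in>range \<psi>. ((LINT r:{0..T}|lebesgue. k r * h y r) - (LINT r:{0..T}|lebesgue. k r * h y r)) *\<^sub>R y)) (at_right 0)"
    using weak h unfolding L2_weak_conv_def by (intro tendsto_intros) auto
  then have "((\<lambda>\<epsilon>. \<Sum>y\<in>range \<psi>. ((LINT r:{0..T}|lebesgue. kk \<epsilon> r * h y r) - (LINT r:{0..T}|lebesgue. k r * h y r)) *\<^sub>R y)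
    \<longlongrightarrow> 0) (at_right 0)" by simp
  \<comment> \<open>The controls are known to be square integrable for positive \<epsilon> only, so
    the expansion holds eventually and not everywhere.\<close>
  moreover have "\<forall>\<^sub>F \<epsilon> in at_right 0. (\<Sum>y\<in>range \<psi>. ((LINT r:{0..T}|lebesgue. kk \<epsilon> r * h y r) - (LINT r:{0..T}|lebesgue. k r * h y r)) *\<^sub>R y)
     = (LINT r:{0..t}|lebesgue. (kk \<epsilon> r - k r) *\<^sub>R \<psi> r)"
    using eventually_at_right_less by (rule eventually_mono) (rule expand[symmetric])
  ultimately show ?thesis by (rule Lim_transform_eventually)
qed

text \<open>Pointwise convergence is uniform because the bound on \<open>\<integral> (kk \<epsilon>)\<^sup>2\<close> makes the primitives
  equicontinuous.\<close>

lemma weak_conv_primitive_uniform: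
  fixes \<psi> :: "real \<Rightarrow> 'v::{banach, second_countable_topology}"
  assumes T: "T > 0" and \<psi>: "simple_function lebesgue \<psi>" and k: "k \<in> L2_space T"
    and kk: "\<forall>\<epsilon>>0. kk \<epsilon> \<in> L2_bounded T N" and weak: "L2_weak_conv T kk k (at_right 0)"
    and c: "c > 0"
  shows "\<forall>\<^sub>F \<epsilon> in at_right 0. \<forall>t\<in>{0..T}. norm (LINT r:{0..t}|lebesgue. (kk \<epsilon> r - k r) *\<^sub>R \<psi> r) \<le> c"
proof -
  define \<eta> where "\<eta> \<epsilon> t = (LINT r:{0..t}|lebesgue. (kk \<epsilon> r - k r) *\<^sub>R \<psi> r)" for \<epsilon> t
  define M where "M = 2 * \<bar>N\<bar> + 2 * (LINT t:{0..T}|lebesgue. (k t)\<^sup>2) + 1"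
  have kk2: "kk \<epsilon> \<in> L2_space T" "(LINT t:{0..T}|lebesgue. (kk \<epsilon> t)\<^sup>2) \<le> N" if "\<epsilon> > 0" for \<epsilon>
    using kk that by (auto simp: L2_bounded_def)
  have "0 \<le> (LINT t:{0..T}|lebesgue. (k t)\<^sup>2)" 
    unfolding set_lebesgue_integral_def by (intro Bochner_Integration.integral_nonneg) auto
  then have M: "M > 0" unfolding M_def by simp
  have "bounded (range \<psi>)" using simple_functionD(1)[OF \<psi>] by (auto intro: finite_imp_bounded)
  then obtain b where b: "\<And>r. norm (\<psi> r) \<le> b" "b > 0" unfolding bounded_pos by auto
  \<comment> \<open>Young's inequality with weight \<beta> bounds an increment by two terms. The
    choice of \<beta> makes the one with the squared control, whose integral is at most
    \<open>M\<close>, equal to \<open>c / 4\<close>; then \<delta> makes the one proportional to the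
    length at most \<open>c / 4\<close>.\<close>
  define \<beta> where "\<beta> = c / (2 * b * M)"
  define \<delta> where "\<delta> = c * \<beta> / (2 * b)"
  have \<beta>: "\<beta> > 0" and \<delta>: "\<delta> > 0" using c b M by (auto simp: \<beta>_def \<delta>_def)
  have equi: "norm (\<eta> \<epsilon> t - \<eta> \<epsilon> s) \<le> c / 2"
    if \<epsilon>: "\<epsilon> > 0" and st: "0 \<le> s" "s \<le> t" "t \<le> T" "t - s \<le> \<delta>" for \<epsilon> s t
  proof -
    define q where "q r = kk \<epsilon> r - k r" for r
    have q: "q \<in> L2_space T" unfolding q_def using kk2[OF \<epsilon>] k by (intro L2_space_diff)
    have F: "set_integrable lebesgue {0..T} (\<lambda>r. q r *\<^sub>R \<psi> r)"
      by (intro L2_space_integrable L2_space_scaleR_simple q \<psi>)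
    have sq: "set_integrable lebesgue {0..T} (\<lambda>r. (q r)\<^sup>2)" "set_integrable lebesgue {0..T} (\<lambda>r. (kk \<epsilon> r)\<^sup>2)"
      "set_integrable lebesgue {0..T} (\<lambda>r. (k r)\<^sup>2)"
      using L2_space_integrable_square[OF q] L2_space_integrable_square[OF kk2(1)[OF \<epsilon>]] L2_space_integrable_square[OF k]
      by auto
    have sub: "set_integrable lebesgue {s..t} f" if "set_integrable lebesgue {0..T} f" for f :: "real \<Rightarrow> real"
      using st by (intro set_integrable_subset[OF that]) auto
    have "(LINT r:{s..t}|lebesgue. (q r)\<^sup>2) \<le> (LINT r:{0..T}|lebesgue. (q r)\<^sup>2)"
      unfolding set_lebesgue_integral_def
      using sub[OF sq(1)] sq(1) st unfolding set_integrable_def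
      by (intro integral_mono) (auto simp: indicator_def)
    also have "\<dots> \<le> (LINT r:{0..T}|lebesgue. 2 * (kk \<epsilon> r)\<^sup>2 + 2 * (k r)\<^sup>2)"
    proof (rule set_integral_mono)
      show "(q r)\<^sup>2 \<le> 2 * (kk \<epsilon> r)\<^sup>2 + 2 * (k r)\<^sup>2" for r
        using zero_le_power2[of "kk \<epsilon> r + k r"] by (simp add: q_def power2_eq_square algebra_simps)
    qed (use sq in auto)
    also have "\<dots> = 2 * (LINT r:{0..T}|lebesgue. (kk \<epsilon> r)\<^sup>2) + 2 * (LINT r:{0..T}|lebesgue. (k r)\<^sup>2)"
      using sq by simp
    also have "\<dots> \<le> M" using kk2(2)[OF \<epsilon>] abs_ge_self[of N] by (simp add: M_def)
    finally have qM: "(LINT r:{s..t}|lebesgue. (q r)\<^sup>2) \<le> M" .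
    have "norm (\<eta> \<epsilon> t - \<eta> \<epsilon> s) \<le> (LINT r:{s..t}|lebesgue. norm (q r *\<^sub>R \<psi> r))"
      unfolding \<eta>_def q_def[symmetric] by (rule norm_primitive_increment_le[OF F st(1-3)])
    also have "\<dots> \<le> (LINT r:{s..t}|lebesgue. b * (1 / (2 * \<beta>) + \<beta> * (q r)\<^sup>2 / 2))"
    proof (rule set_integral_mono)
      show "set_integrable lebesgue {s..t} (\<lambda>r. norm (q r *\<^sub>R \<psi> r))"
        by (intro sub L2_space_integrable L2_space_norm L2_space_scaleR_simple q \<psi>)
      show "set_integrable lebesgue {s..t} (\<lambda>r. b * (1 / (2 * \<beta>) + \<beta> * (q r)\<^sup>2 / 2))"
        using sub[OF sq(1)] by auto
      fix r
      have "norm (q r *\<^sub>R \<psi> r) \<le> b * (1 * \<bar>q r\<bar>)"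
        using mult_left_mono[OF b(1), of "\<bar>q r\<bar>"] by (simp add: mult.commute)
      also have "\<dots> \<le> b * (1 / (2 * \<beta>) + \<beta> * (q r)\<^sup>2 / 2)"
        using young_ineq[OF \<beta>, of 1 "\<bar>q r\<bar>"] b by (intro mult_left_mono) auto
      finally show "norm (q r *\<^sub>R \<psi> r) \<le> b * (1 / (2 * \<beta>) + \<beta> * (q r)\<^sup>2 / 2)" .
    qed
    also have "\<dots> = b * ((t - s) / (2 * \<beta>) + \<beta> * (LINT r:{s..t}|lebesgue. (q r)\<^sup>2) / 2)"
      using sub[OF sq(1)] st by (simp add: set_integral_const)
    also have "\<dots> \<le> b * (\<delta> / (2 * \<beta>) + \<beta> * M / 2)"
      using st qM \<beta> b by (intro mult_left_mono add_mono divide_right_mono) auto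
    also have "\<dots> = c / 2"
      using \<beta> b M c unfolding \<delta>_def by (simp add: field_simps) (simp add: \<beta>_def field_simps)
    finally show ?thesis .
  qed
  \<comment> \<open>A finite grid of step at most \<delta>: at its points pointwise convergence
    gives \<open>c / 2\<close>, and between them equicontinuity adds another
    \<open>c / 2\<close>.\<close>
  obtain n where n: "T / \<delta> < real n" using reals_Archimedean2 by blast
  have "0 < T / \<delta>" using T \<delta> by simp
  with n have n0: "n > 0" by (metis gr0I less_asym of_nat_0)
  define h where "h = T / real n"
  have h: "h > 0" "h \<le> \<delta>" "real n * h = T" using T n n0 \<delta> by (auto simp: h_def field_simps)
  have "\<forall>\<^sub>F \<epsilon> in at_right 0. \<forall>i\<in>{..n}. norm (\<eta> \<epsilon> (real i * h)) < c / 2"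
  proof (intro eventually_ball_finite ballI)
    fix i assume "i \<in> {..n}"
    then have "real i * h \<le> real n * h" using h by (intro mult_right_mono) auto
    then have "((\<lambda>\<epsilon>. \<eta> \<epsilon> (real i * h)) \<longlongrightarrow> 0) (at_right 0)"
      unfolding \<eta>_def using h kk2(1) by (intro weak_conv_primitive_pointwise[OF \<psi> k _ weak]) auto
    then have "((\<lambda>\<epsilon>. norm (\<eta> \<epsilon> (real i * h))) \<longlongrightarrow> 0) (at_right 0)" by (rule tendsto_norm_zero)
    then show "\<forall>\<^sub>F \<epsilon> in at_right 0. norm (\<eta> \<epsilon> (real i * h)) < c / 2"
      using c by (intro order_tendstoD) auto
  qed simp
  then show ?thesis using eventually_at_right_less[of 0]
  proof eventually_elim
    case (elim \<epsilon>)
    show ?case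
    proof
      fix t assume t: "t \<in> {0..T}"
      define i where "i = nat \<lfloor>t / h\<rfloor>"
      have i: "real i * h \<le> t" "t < real i * h + h"
      proof -
        have "0 \<le> \<lfloor>t / h\<rfloor>" using t h by simp
        then have "real i = of_int \<lfloor>t / h\<rfloor>" by (simp add: i_def)
        then have "real i \<le> t / h" "t / h < real i + 1" by linarith+
        then show "real i * h \<le> t" "t < real i * h + h" using h(1) by (auto simp: field_simps)
      qed
      have "real i * h \<le> real n * h" using i(1) t h(3) by simp
      then have "i \<le> n" using h(1) by simp
      then have "norm (\<eta> \<epsilon> (real i * h)) < c / 2" using elim by auto
      moreover have "norm (\<eta> \<epsilon> t - \<eta> \<epsilon> (real i * h)) \<le> c / 2"
        using elim i t h by (intro equi) auto
      ultimately show "norm (LINT r:{0..t}|lebesgue. (kk \<epsilon> r - k r) *\<^sub>R \<psi> r) \<le> c"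
        using norm_triangle_sub[of "\<eta> \<epsilon> t" "\<eta> \<epsilon> (real i * h)"] by (simp add: \<eta>_def)
    qed
  qed
qed

section \<open>From the difference estimate to convergence in the norm of
  \<open>XT_space\<close>\<close>

context reflection_data
begin

text \<open>\<open>A\<close> bounds the integral of the Gronwall weight and depends on
  \<open>k\<^sub>1\<close> only through \<open>N\<close>. The exponent 8 is the 2 of
  \<open>gronwall\<close> times the 4 in front of the integral; inserting the resulting bound for
  the H norm back into the estimate gives the V part and the factor
  \<open>1 + 4 * A\<close>.\<close>

lemma XT_norm_difference_le:
  assumes sol1: "reflection_solution \<iota> T f \<sigma> B u\<^sub>0 k\<^sub>1 u\<^sub>1 L\<^sub>1"
    and sol: "reflection_solution \<iota> T f \<sigma> B u\<^sub>0 k u L"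
    and k1: "k\<^sub>1 \<in> L2_space T" and N1: "(LINT t:{0..T}|lebesgue. (k\<^sub>1 t)\<^sup>2) \<le> N"
    and est: "\<And>t. t \<in> {0..T} \<Longrightarrow>
      (norm (u\<^sub>1 t - u t))\<^sup>2 + (LINT r:{0..t}|lebesgue. (norm (V_of u\<^sub>1 r - V_of u r))\<^sup>2) \<le>
      R + 4 * (LINT r:{0..t}|lebesgue. (C\<^sup>2 + 4 * (norm (V_of u r))\<^sup>2 + C * \<bar>k\<^sub>1 r\<bar>) * (norm (u\<^sub>1 r - u r))\<^sup>2)"
    and A: "A = C\<^sup>2 * T + 4 * (LINT r:{0..T}|lebesgue. (norm (V_of u r))\<^sup>2) + C * (T + N)"
  shows "XT_norm \<iota> T (\<lambda>t. u\<^sub>1 t - u t) \<le> sqrt (R * (1 + exp (8 * A) * (1 + 4 * A)))"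
proof -
  define w where "w t = u\<^sub>1 t - u t" for t
  define W where "W t = V_of u\<^sub>1 t - V_of u t" for t
  define a where "a r = C\<^sup>2 + 4 * (norm (V_of u r))\<^sup>2 + C * \<bar>k\<^sub>1 r\<bar>" for r
  note cont = sol_continuous[OF sol1] sol_continuous[OF sol]
  have w: "continuous_on {0..T} w" unfolding w_def by (intro continuous_intros cont)
  have W: "W \<in> L2_space T" unfolding W_def by (intro L2_space_diff sol_V_L2[OF sol1] sol_V_L2[OF sol])
  have sq: "set_integrable lebesgue {0..T} (\<lambda>r. (norm (V_of u r))\<^sup>2)" "set_integrable lebesgue {0..T} (\<lambda>r. (norm (W r))\<^sup>2)"
    "set_integrable lebesgue {0..T} (\<lambda>r. (k\<^sub>1 r)\<^sup>2)"
    using L2_space_integrable_square[OF sol_V_L2[OF sol]] L2_space_integrable_square[OF W]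
      L2_space_integrable_square[OF k1] by auto
  have k1_abs: "set_integrable lebesgue {0..T} (\<lambda>r. \<bar>k\<^sub>1 r\<bar>)"
    using L2_space_integrable[OF k1] by (rule set_integrable_abs)
  have a_int: "set_integrable lebesgue {0..T} a"
    unfolding a_def using sq k1_abs by auto
  have a_nonneg: "0 \<le> a r" for r unfolding a_def using C_nonneg by auto
  have "a \<in> borel_measurable (lebesgue_on {0..T})"
    unfolding a_def using L2_space_measurable[OF sol_V_L2[OF sol]] L2_space_measurable[OF k1] by measurable
  then have aw_int: "set_integrable lebesgue {0..T} (\<lambda>r. a r * (norm (w r))\<^sup>2)"
    unfolding w_def using a_nonneg by (rule weighted_difference_integrable[OF sol1 sol a_int])
  have a_le: "(LINT r:{0..T}|lebesgue. a r) \<le> A"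
  proof -
    \<comment> \<open>The bound on the controls is quadratic whereas the weight contains the control
      linearly.\<close>
    have "(LINT r:{0..T}|lebesgue. \<bar>k\<^sub>1 r\<bar>) \<le> (LINT r:{0..T}|lebesgue. 1 + (k\<^sub>1 r)\<^sup>2)"
    proof (rule set_integral_mono)
      show "\<bar>k\<^sub>1 r\<bar> \<le> 1 + (k\<^sub>1 r)\<^sup>2" for r
        using sum_squares_bound[of 1 "\<bar>k\<^sub>1 r\<bar>"] abs_ge_zero[of "k\<^sub>1 r"]
        unfolding power2_abs one_power2 mult_1_right by linarith
    qed (use k1_abs sq in auto)
    also have "\<dots> \<le> T + N" using sq N1 T by (simp add: set_integral_const)
    finally have "C * (LINT r:{0..T}|lebesgue. \<bar>k\<^sub>1 r\<bar>) \<le> C * (T + N)" using C_nonneg by (intro mult_left_mono)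
    then show ?thesis unfolding a_def A using sq k1_abs T by (simp add: set_integral_const)
  qed
  have R: "0 \<le> R" using order_trans[OF _ est[of 0], of 0] T by simp
  have est': "(norm (w t))\<^sup>2 + (LINT r:{0..t}|lebesgue. (norm (W r))\<^sup>2) \<le> R + 4 * (LINT r:{0..t}|lebesgue. a r * (norm (w r))\<^sup>2)"
    if "t \<in> {0..T}" for t
    using est[OF that] unfolding w_def W_def a_def .
  have w_le: "(norm (w t))\<^sup>2 \<le> R * exp (8 * A)" if t: "t \<in> {0..T}" for t
  proof -
    have "(norm (w t))\<^sup>2 \<le> R * exp (2 * (LINT r:{0..T}|lebesgue. 4 * a r))"
    proof (rule gronwall[where y = "\<lambda>t. (norm (w t))\<^sup>2"])
      show "(norm (w t))\<^sup>2 \<le> R + (LINT r:{0..t}|lebesgue. 4 * a r * (norm (w r))\<^sup>2)" if "t \<in> {0..T}" for t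
        using est'[OF that] set_integral_nonneg_real[of "{0..t}" "\<lambda>r. (norm (W r))\<^sup>2" lebesgue]
        by (simp add: mult.assoc)
      show "continuous_on {0..T} (\<lambda>t. (norm (w t))\<^sup>2)" by (intro continuous_intros w)
    qed (use a_int a_nonneg aw_int t in \<open>auto simp: mult.assoc\<close>)
    also have "\<dots> \<le> R * exp (8 * A)" using R a_le by (intro mult_left_mono) auto
    finally show ?thesis .
  qed
  have W_le: "(LINT r:{0..T}|lebesgue. (norm (W r))\<^sup>2) \<le> R + 4 * (A * (R * exp (8 * A)))"
  proof -
    have "(LINT r:{0..T}|lebesgue. a r * (norm (w r))\<^sup>2) \<le> (LINT r:{0..T}|lebesgue. a r * (R * exp (8 * A)))"
      using w_le a_nonneg a_int aw_int by (intro set_integral_mono mult_left_mono) auto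
    also have "\<dots> = (LINT r:{0..T}|lebesgue. a r) * (R * exp (8 * A))" by simp
    also have "\<dots> \<le> A * (R * exp (8 * A))" using a_le R by (intro mult_right_mono) auto
    finally have "4 * (LINT r:{0..T}|lebesgue. a r * (norm (w r))\<^sup>2) \<le> 4 * (A * (R * exp (8 * A)))"
      by simp
    moreover have "T \<in> {0..T}" using T by simp
    ultimately show ?thesis using est' zero_le_power2[of "norm (w T)"] by (smt (verit))
  qed
  \<comment> \<open>\<open>V_part\<close> need not respect differences outside the range of
    \<open>\<iota>\<close>, so it agrees with \<open>W\<close> only almost everywhere. The case
    distinction takes the place of a proof of integrability: a non-integrable integrand would have
    the default integral 0, which satisfies the bound.\<close>
  have "(LINT r:{0..T}|lebesgue. (norm (V_part \<iota> (w r)))\<^sup>2) \<le> R + 4 * (A * (R * exp (8 * A)))"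
  proof (cases "set_integrable lebesgue {0..T} (\<lambda>r. (norm (V_part \<iota> (w r)))\<^sup>2)")
    case True
    have "AE r in lebesgue. r \<in> {0..T} \<longrightarrow> V_part \<iota> (w r) = W r"
      using sol_V_eq[OF sol1] sol_V_eq[OF sol]
    proof eventually_elim
      case (elim r)
      show ?case
      proof
        assume "r \<in> {0..T}"
        then have "w r = \<iota> (W r)" using elim by (simp add: w_def W_def blinfun.diff_right)
        then show "V_part \<iota> (w r) = W r" using inj by (simp add: V_part_def inv_f_f)
      qed
    qed
    then have "(LINT r:{0..T}|lebesgue. (norm (V_part \<iota> (w r)))\<^sup>2) \<le> (LINT r:{0..T}|lebesgue. (norm (W r))\<^sup>2)"
      by (intro set_integral_mono_AE True sq) (auto elim!: eventually_mono)
    with W_le show ?thesis by simp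
  next
    case False
    then have "(LINT r:{0..T}|lebesgue. (norm (V_part \<iota> (w r)))\<^sup>2) = 0"
      unfolding set_integrable_def set_lebesgue_integral_def by (rule not_integrable_integral_eq)
    also have "0 \<le> (LINT r:{0..T}|lebesgue. (norm (W r))\<^sup>2)" by (rule set_integral_nonneg_real) simp
    finally show ?thesis using W_le by simp
  qed
  moreover have "(SUP t\<in>{0..T}. (norm (w t))\<^sup>2) \<le> R * exp (8 * A)"
    using w_le T by (intro cSUP_least) auto
  ultimately have "(SUP t\<in>{0..T}. (norm (w t))\<^sup>2) + (LINT r:{0..T}|lebesgue. (norm (V_part \<iota> (w r)))\<^sup>2)
    \<le> R * (1 + exp (8 * A) * (1 + 4 * A))" by (simp add: algebra_simps)
  then show ?thesis unfolding XT_norm_def w_def by (rule real_sqrt_le_mono)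
qed

text \<open>The error \<open>R * \<Lambda>\<close> is split into a part linear in \<alpha> and a
  part linear in \<open>c\<close>, each at most a quarter of the square of \<open>e\<close>.
  \<Lambda> is fixed before both choices, since it involves neither \<open>g\<close> nor
  \<epsilon>.\<close>

lemma XT_norm_tendsto_0:
  assumes k: "k \<in> L2_space T" and k\<epsilon>: "\<forall>\<epsilon>>0. k\<epsilon> \<epsilon> \<in> L2_bounded T N"
    and weak: "L2_weak_conv T k\<epsilon> k (at_right 0)"
    and sol: "reflection_solution \<iota> T f \<sigma> B u\<^sub>0 k u L"
    and sol\<epsilon>: "\<forall>\<epsilon>>0. reflection_solution \<iota> T f \<sigma> B u\<^sub>0 (k\<epsilon> \<epsilon>) (u\<epsilon> \<epsilon>) (L\<epsilon> \<epsilon>)"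
  shows "((\<lambda>\<epsilon>. XT_norm \<iota> T (\<lambda>t. u\<epsilon> \<epsilon> t - u t)) \<longlongrightarrow> 0) (at_right 0)"
proof (rule tendstoI)
  fix e :: real assume e: "e > 0"
  \<comment> \<open>One bound for all controls and for their limit; putting the limit into the
    constant replaces an appeal to weak lower semicontinuity.\<close>
  define N' where "N' = \<bar>N\<bar> + (LINT t:{0..T}|lebesgue. (k t)\<^sup>2)"
  define Q where "Q = (LINT r:{0..T}|lebesgue. (norm (V_of u r))\<^sup>2)"
  define A where "A = C\<^sup>2 * T + 4 * Q + C * (T + N')"
  define \<Lambda> where "\<Lambda> = 1 + exp (8 * A) * (1 + 4 * A)"
  define K where "K = 1 + T * f_sup\<^sup>2 + \<sigma>_sup * (T + N')"
  have k0: "0 \<le> (LINT t:{0..T}|lebesgue. (k t)\<^sup>2)" by (rule set_integral_nonneg_real) simp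
  have N': "(LINT t:{0..T}|lebesgue. (k t)\<^sup>2) \<le> N'" "N \<le> N'" "0 \<le> N'"
    using k0 by (auto simp: N'_def)
  have Q0: "0 \<le> Q" unfolding Q_def by (rule set_integral_nonneg_real) simp
  have A0: "0 \<le> A" unfolding A_def using Q0 T C_nonneg N' by auto
  have \<Lambda>: "\<Lambda> > 0" unfolding \<Lambda>_def using A0 by (intro add_pos_nonneg) auto
  have K0: "0 \<le> K" unfolding K_def using T \<sigma>_sup_nonneg N' by auto
  define \<alpha> where "\<alpha> = e\<^sup>2 / (4 * (8 * (N' + 1)) * \<Lambda>)"
  have \<alpha>: "\<alpha> > 0" using e \<Lambda> N' by (simp add: \<alpha>_def)
  have \<sigma>u: "(\<lambda>t. \<sigma> (u t)) \<in> L2_space T"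
    using continuous_on_compose2[OF continuous_\<sigma>[of UNIV] sol_continuous[OF sol]]
    by (intro L2_space_continuous) auto
  obtain g where gs: "simple_function lebesgue g" and g_range: "range g \<subseteq> range (blinfun_apply \<iota>)"
    and g_close: "(LINT t:{0..T}|lebesgue. (norm (\<sigma> (u t) - g t))\<^sup>2) \<le> \<alpha>\<^sup>2"
    using L2_simple_approximation[OF \<sigma>u dense_V, of "\<alpha>\<^sup>2"] \<alpha> by auto
  \<comment> \<open>The lift of \<open>g\<close> to V; its primitives against the difference of the
    controls are the values of \<eta>, which are small in the norm of V.\<close>
  define \<psi> where "\<psi> t = inv (blinfun_apply \<iota>) (g t)" for t
  have \<psi>: "simple_function lebesgue \<psi>" unfolding \<psi>_def by (rule simple_function_compose1[OF gs])
  have \<iota>\<psi>: "\<iota> (\<psi> t) = g t" for t unfolding \<psi>_def using g_range by (intro f_inv_into_f) auto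
  have "bounded (range g)" using simple_functionD(1)[OF gs] by (auto intro: finite_imp_bounded)
  then obtain G where G: "\<And>t. norm (g t) \<le> G" "G > 0" unfolding bounded_pos by auto
  have gL2: "g \<in> L2_space T"
    by (rule L2_space_bounded[OF measurable_restrict_space1[OF borel_measurable_simple_function[OF gs]] G(1)])
  define K1 where "K1 = (13 + 2 * C) * T + Q + (T + 2 * N') * ((\<sigma>_sup + G) * norm \<iota>)"
  define K2 where "K2 = 4 * K1 + 4 * norm \<iota> * K + 2 * (norm \<iota>)\<^sup>2"
  have K1: "0 \<le> K1" unfolding K1_def using C_nonneg T Q0 N' \<sigma>_sup_nonneg G by auto
  have K2: "0 \<le> K2" unfolding K2_def using K1 K0 by auto
  \<comment> \<open>\<open>K2\<close> contains \<open>G\<close>, the bound of \<open>g\<close>, so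
    \<open>c\<close> can be chosen only after \<open>g\<close>. The minimum with 1 lets the
    quadratic term in \<open>c\<close> be counted as linear in \<open>K2\<close>.\<close>
  define c where "c = min 1 (e\<^sup>2 / (4 * (K2 + 1) * \<Lambda>))"
  have c: "c > 0" "c \<le> 1" using e \<Lambda> K2 by (auto simp: c_def)
  have c_le: "c * K2 * \<Lambda> \<le> e\<^sup>2 / 4"
  proof -
    have "c \<le> e\<^sup>2 / (4 * (K2 + 1) * \<Lambda>)" by (simp add: c_def)
    then have "c * (K2 * \<Lambda>) \<le> (e\<^sup>2 / (4 * (K2 + 1) * \<Lambda>)) * (K2 * \<Lambda>)"
      using K2 \<Lambda> by (intro mult_right_mono) auto
    also have "\<dots> = e\<^sup>2 / 4 * (K2 / (K2 + 1))" using \<Lambda> K2 by (simp add: divide_simps)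
    also have "\<dots> \<le> e\<^sup>2 / 4 * 1" using K2 by (intro mult_left_mono) auto
    finally show ?thesis by (simp add: mult.assoc)
  qed
  have \<alpha>_eq: "8 * (N' + 1) * \<alpha> * \<Lambda> = e\<^sup>2 / 4"
    using \<Lambda> N' by (simp add: \<alpha>_def divide_simps)
  have "\<forall>\<^sub>F \<epsilon> in at_right 0. \<forall>t\<in>{0..T}. norm (LINT r:{0..t}|lebesgue. (k\<epsilon> \<epsilon> r - k r) *\<^sub>R \<psi> r) \<le> c"
    by (rule weak_conv_primitive_uniform[OF T \<psi> k k\<epsilon> weak c(1)])
  then show "\<forall>\<^sub>F \<epsilon> in at_right 0. dist (XT_norm \<iota> T (\<lambda>t. u\<epsilon> \<epsilon> t - u t)) 0 < e"
    using eventually_at_right_less[of 0]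
  proof eventually_elim
    case (elim \<epsilon>)
    define k\<^sub>1 where "k\<^sub>1 = k\<epsilon> \<epsilon>"
    define \<eta> where "\<eta> t = (LINT r:{0..t}|lebesgue. (k\<^sub>1 r - k r) *\<^sub>R \<psi> r)" for t
    have sol1: "reflection_solution \<iota> T f \<sigma> B u\<^sub>0 k\<^sub>1 (u\<epsilon> \<epsilon>) (L\<epsilon> \<epsilon>)" using sol\<epsilon> elim by (simp add: k\<^sub>1_def)
    have k1: "k\<^sub>1 \<in> L2_space T" "(LINT t:{0..T}|lebesgue. (k\<^sub>1 t)\<^sup>2) \<le> N'"
      using k\<epsilon> elim N' by (auto simp: L2_bounded_def k\<^sub>1_def)
    have F: "set_integrable lebesgue {0..T} (\<lambda>r. (k\<^sub>1 r - k r) *\<^sub>R \<psi> r)"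
      by (intro L2_space_integrable L2_space_scaleR_simple L2_space_diff k1 k \<psi>)
    have \<eta>: "continuous_on {0..T} \<eta>" unfolding \<eta>_def by (rule continuous_on_primitive[OF F])
    have \<eta>0: "\<eta> 0 = 0" by (simp add: \<eta>_def)
    have \<eta>c: "norm (\<eta> t) \<le> c" if "t \<in> {0..T}" for t using elim that by (simp add: \<eta>_def k\<^sub>1_def)
    have \<eta>_eq: "(\<iota> (\<eta> t) - \<iota> (\<eta> s)) \<bullet> \<iota> x = (LINT r:{s..t}|lebesgue. ((k\<^sub>1 r - k r) *\<^sub>R g r) \<bullet> \<iota> x)"
      if st: "0 \<le> s" "s \<le> t" "t \<le> T" for s t x
    proof -
      have i: "set_integrable lebesgue {0..t} (\<lambda>r. (k\<^sub>1 r - k r) *\<^sub>R \<psi> r)"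
        "set_integrable lebesgue {s..t} (\<lambda>r. (k\<^sub>1 r - k r) *\<^sub>R \<psi> r)"
        using st by (auto intro: set_integrable_subset[OF F])
      have "\<eta> t - \<eta> s = (LINT r:{s..t}|lebesgue. (k\<^sub>1 r - k r) *\<^sub>R \<psi> r)"
        using set_integral_split[OF i(1) st(1,2)] by (simp add: \<eta>_def)
      moreover have "bounded_linear (\<lambda>y. \<iota> y \<bullet> \<iota> x)"
        by (rule bounded_linear_compose[OF bounded_linear_inner_left blinfun.bounded_linear_right])
      from set_integral_bounded_linear[OF this i(2)]
      have "\<iota> (LINT r:{s..t}|lebesgue. (k\<^sub>1 r - k r) *\<^sub>R \<psi> r) \<bullet> \<iota> x
        = (LINT r:{s..t}|lebesgue. ((k\<^sub>1 r - k r) *\<^sub>R g r) \<bullet> \<iota> x)"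
        by (simp add: blinfun.scaleR_right \<iota>\<psi>)
      ultimately show ?thesis by (simp add: blinfun.diff_right[symmetric])
    qed
    define R where "R = 4 * (c * K1 + 2 * \<alpha> * N' + 2 * \<alpha>) + 4 * (norm \<iota> * c) * K + 2 * (norm \<iota> * c)\<^sup>2"
    have "XT_norm \<iota> T (\<lambda>t. u\<epsilon> \<epsilon> t - u t) \<le> sqrt (R * \<Lambda>)"
      unfolding \<Lambda>_def
      by (rule XT_norm_difference_le[OF sol1 sol k1 _ A_def[unfolded Q_def]])
        (unfold R_def K1_def K_def Q_def,
          rule difference_estimate[OF sol1 sol k1(1) k k1(2) N'(1) gL2 G(1) \<alpha> g_close \<eta> \<eta>0 \<eta>c c(2) \<eta>_eq])
    also have "\<dots> < e"
    proof -
      have "(norm \<iota> * c)\<^sup>2 \<le> (norm \<iota>)\<^sup>2 * c"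
        using c mult_left_mono[of "c * c" c "(norm \<iota>)\<^sup>2"] by (simp add: power2_eq_square mult_left_le ac_simps)
      then have "R \<le> c * K2 + 8 * (N' + 1) * \<alpha>" by (simp add: R_def K2_def algebra_simps)
      then have "R * \<Lambda> \<le> (c * K2 + 8 * (N' + 1) * \<alpha>) * \<Lambda>" using \<Lambda> by (intro mult_right_mono) auto
      also have "\<dots> \<le> e\<^sup>2 / 4 + e\<^sup>2 / 4" using c_le \<alpha>_eq unfolding distrib_right by linarith
      also have "\<dots> < e\<^sup>2" using e by simp
      finally show ?thesis using e by (intro real_less_lsqrt) auto
    qed
    finally have "XT_norm \<iota> T (\<lambda>t. u\<epsilon> \<epsilon> t - u t) < e" .
    \<comment> \<open>The supremum is nonnegative because continuity bounds it above by a real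
      number; an unbounded set would have an unspecified supremum.\<close>
    moreover have "0 \<le> XT_norm \<iota> T (\<lambda>t. u\<epsilon> \<epsilon> t - u t)"
    proof -
      have "continuous_on {0..T} (\<lambda>t. (norm (u\<epsilon> \<epsilon> t - u t))\<^sup>2)"
        by (intro continuous_intros sol_continuous[OF sol1] sol_continuous[OF sol])
      then have "bdd_above ((\<lambda>t. (norm (u\<epsilon> \<epsilon> t - u t))\<^sup>2) ` {0..T})"
        by (intro bounded_imp_bdd_above compact_imp_bounded compact_continuous_image) auto
      then have "0 \<le> (SUP t\<in>{0..T}. (norm (u\<epsilon> \<epsilon> t - u t))\<^sup>2)"
        using T by (intro cSUP_upper2[of _ _ 0]) auto
      moreover have "0 \<le> (LINT t:{0..T}|lebesgue. (norm (V_part \<iota> (u\<epsilon> \<epsilon> t - u t)))\<^sup>2)"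
        by (rule set_integral_nonneg_real) simp
      ultimately show ?thesis by (simp add: XT_norm_def)
    qed
    ultimately show ?case by simp
  qed
qed

end

section \<open>Density of H in the dual of V, and the conclusion\<close>

lemma closure_eq_UNIV_iff_approx:
  "closure S = UNIV \<longleftrightarrow> (\<forall>x. \<forall>e>0. \<exists>y\<in>S. dist y x < e)"
  using closure_approachable[of _ S] by auto

text \<open>By the Riesz theorem a functional on \<open>V\<close> is \<open>v \<mapsto> (p, S v)\<close> for some \<open>p\<close>; it is in the image of
  \<open>H\<close> if \<open>p\<close> lies in the domain of \<open>S\<close>, which is dense.\<close>

lemma dense_range_to_dual:
  fixes S :: "'h::{real_inner, banach, second_countable_topology} \<Rightarrow> 'h"
    and \<iota> :: "'v::{real_inner, banach, second_countable_topology} \<Rightarrow>\<^sub>L 'h"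
  assumes S: "selfadjoint_op DS S" and \<iota>: "form_domain DS S \<iota>"
  shows "closure (range (to_dual \<iota>)) = UNIV"
  unfolding closure_eq_UNIV_iff_approx
proof (intro allI impI)
  fix F :: "'v \<Rightarrow>\<^sub>L real" and e :: real assume e: "e > 0"
  obtain z where z: "F = blinfun_inner_right z" by (rule riesz_representation)
  have dense: "closure DS = UNIV" and sym: "\<And>x y. x \<in> DS \<Longrightarrow> y \<in> DS \<Longrightarrow> S x \<bullet> y = x \<bullet> S y"
    using S unfolding selfadjoint_op_def by blast+
  have inner_V: "x \<bullet> y = S (\<iota> x) \<bullet> S (\<iota> y)" and \<iota>_in: "\<iota> x \<in> DS" for x y
    using \<iota> by (auto simp: form_domain_def)
  have norm_V: "norm (S (\<iota> x)) = norm x" for x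
    using inner_V[of x x] by (simp add: norm_eq_sqrt_inner)
  obtain q where q: "q \<in> DS" "dist q (S (\<iota> z)) < e / 2"
    using dense[unfolded closure_eq_UNIV_iff_approx] e by (meson half_gt_zero)
  have "norm (to_dual \<iota> (S q) - F) \<le> e / 2"
  proof (rule norm_blinfun_bound)
    fix x
    \<comment> \<open>Symmetry moves \<open>S\<close> from \<open>q\<close> to the test vector. As
      \<open>S\<close> composed with \<open>\<iota>\<close> is isometric, the dual norm of the error
      is then controlled by a distance in H.\<close>
    have "(to_dual \<iota> (S q) - F) x = (q - S (\<iota> z)) \<bullet> S (\<iota> x)"
      using sym[OF q(1) \<iota>_in[of x]] inner_V[of z x]
      by (simp add: z blinfun.diff_left to_dual_apply inner_diff_left)
    also have "\<bar>\<dots>\<bar> \<le> norm (q - S (\<iota> z)) * norm (S (\<iota> x))" by (rule Cauchy_Schwarz_ineq2)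
    also have "\<dots> \<le> e / 2 * norm x"
      unfolding norm_V using q(2) by (intro mult_right_mono) (auto simp: dist_norm)
    finally show "norm ((to_dual \<iota> (S q) - F) x) \<le> e / 2 * norm x" by simp
  qed (use e in simp)
  then have "dist (to_dual \<iota> (S q)) F < e" using e by (simp add: dist_norm)
  then show "\<exists>G\<in>range (to_dual \<iota>). dist G F < e" by blast
qed

theorem theorem4p1:
  fixes A S :: "'h::{real_inner, banach, second_countable_topology} \<Rightarrow> 'h"
    and DA DS :: "'h set"
    and \<iota> :: "'v::{real_inner, banach, second_countable_topology} \<Rightarrow>\<^sub>L 'h"
    and lambda\<^sub>1 T N :: real
    and f :: "'h \<Rightarrow> 'v \<Rightarrow>\<^sub>L real" and \<sigma> :: "'h \<Rightarrow> 'h"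
    and B :: "'v \<Rightarrow> 'v \<Rightarrow> 'v \<Rightarrow>\<^sub>L real"
    and u\<^sub>0 :: 'h
    and k :: "real \<Rightarrow> real" and k\<epsilon> :: "real \<Rightarrow> real \<Rightarrow> real"
    and u L :: "real \<Rightarrow> 'h" and u\<epsilon> L\<epsilon> :: "real \<Rightarrow> real \<Rightarrow> 'h"
  assumes "selfadjoint_op DA A" and "lambda\<^sub>1 > 0" and "\<forall>x\<in>DA. A x \<bullet> x \<ge> lambda\<^sub>1 * (norm x)\<^sup>2"
    and "sqrt_op DA A DS S" and "form_domain DS S \<iota>"
    and "lipschitz_coeffs f \<sigma>"
    and "antisym_bilinear \<iota> B"
    and "u\<^sub>0 \<in> cball 0 1"
    and "T > 0" and "N > 0"
    and "k \<in> L2_space T"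
    and "\<forall>\<epsilon>>0. k\<epsilon> \<epsilon> \<in> L2_bounded T N"
    and "L2_weak_conv T k\<epsilon> k (at_right 0)"
    and "reflection_solution \<iota> T f \<sigma> B u\<^sub>0 k u L"
    and "\<forall>\<epsilon>>0. reflection_solution \<iota> T f \<sigma> B u\<^sub>0 (k\<epsilon> \<epsilon>) (u\<epsilon> \<epsilon>) (L\<epsilon> \<epsilon>)"
  shows "((\<lambda>\<epsilon>. XT_norm \<iota> T (\<lambda>t. u\<epsilon> \<epsilon> t - u t)) \<longlongrightarrow> 0) (at_right 0)"
proof -
  have S: "selfadjoint_op DS S" using \<open>sqrt_op DA A DS S\<close> by (simp add: sqrt_op_def)
  obtain C where C: "\<And>x y. norm (f x - f y) + norm (\<sigma> x - \<sigma> y) \<le> C * norm (x - y)"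
    using \<open>lipschitz_coeffs f \<sigma>\<close> by (auto simp: lipschitz_coeffs_def)
  \<comment> \<open>The Lipschitz constant is unrestricted in sign and could be negative if H is
    trivial; the locale requires a nonnegative one.\<close>
  have C': "norm (f x - f y) + norm (\<sigma> x - \<sigma> y) \<le> \<bar>C\<bar> * norm (x - y)" for x y
    using order_trans[OF C[of x y] mult_right_mono[OF abs_ge_self[of C]]] by simp
  \<comment> \<open>The self-adjointness of \<open>S\<close> supplies both densities: its domain,
    the range of \<open>\<iota>\<close>, is dense in H, and its symmetry gives the density in the
    dual of V.\<close>
  interpret reflection_data \<iota> T f \<sigma> B u\<^sub>0 "\<bar>C\<bar>"
  proof
    show "closure (range (blinfun_apply \<iota>)) = UNIV"
      using S \<open>form_domain DS S \<iota>\<close> by (simp add: selfadjoint_op_def form_domain_def)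
    show "closure (range (to_dual \<iota>)) = UNIV"
      using S \<open>form_domain DS S \<iota>\<close> by (rule dense_range_to_dual)
    show "inj (blinfun_apply \<iota>)" using \<open>form_domain DS S \<iota>\<close> by (simp add: form_domain_def)
    show "norm (f x - f y) \<le> \<bar>C\<bar> * norm (x - y)" "norm (\<sigma> x - \<sigma> y) \<le> \<bar>C\<bar> * norm (x - y)" for x y
      using order_trans[OF _ C'[of x y]] by auto
    show "bilinear B" "\<And>x y z. B x y z = - B x z y"
      "\<And>x y z. \<bar>B x y z\<bar> \<le> 2 * sqrt (norm x) * sqrt (norm (\<iota> x)) * sqrt (norm z) * sqrt (norm (\<iota> z)) * norm y"
      using \<open>antisym_bilinear \<iota> B\<close> unfolding antisym_bilinear_def by blast+
  qed (use \<open>T > 0\<close> \<open>u\<^sub>0 \<in> cball 0 1\<close> in auto)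
  show ?thesis by (rule XT_norm_tendsto_0) fact+
qed

end
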